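(* Let $X$ be a stratifiable Fréchet-Urysohn space with a point-countable $k$-network. Then the following statements are equivalent: (1) $A_2(X)$ is a $k$-space; (2) $A_2(X)$ is a $k_R$-space; (3) the space $X$ is metrizable or $X$ is a locally $k_\omega$-space.
   Context: All spaces are assumed to be Tychonoff. For a non-empty Tychonoff space $X$, $A(X)$ is the free Abelian topological group over $X$: an Abelian topological group with a continuous map $i:X\to A(X)$ such that $i(X)$ algebraically generates $A(X)$ and every continuous map $f:X\to G$ to an Abelian topological group $G$ has the form $f=\overline{f}\circ i$ for some continuous homomorphism $\overline{f}:A(X)\to G$; $X$ is identified with $i(X)$, and is a free algebraic basis of $A(X)$. Each non-zero $g\in A(X)$ is uniquely $r_1x_1+\cdots+r_kx_k$ with $x_i\in X$ distinct and $r_i\in\mathbb{Z}\setminus\{0\}$; its reduced length is $\sum|r_i|$, and $0$ has reduced length $0$. $A_n(X)$ is the subspace of $A(X)$ of all elements of reduced length at most $n$. A space $X$ is a $k$-space if a subset $C\subseteq X$ is closed whenever $C\cap K$ is closed in $K$ for every compact $K\subseteq X$. $X$ is a $k_R$-space if $X$ is Tychonoff and every $f:X\to\mathbb{R}$ whose restriction to each compact subset is continuous is continuous. $X$ is a $k_\omega$-space if there is a countable family $\{K_n:n\in\mathbb{N}\}$ of compact subsets of $X$ such that $F\subseteq X$ is closed whenever $F\cap K_n$ is closed in $K_n$ for each $n$; $X$ is locally $k_\omega$ if every point has a neighbourhood that is a $k_\omega$-space. $X$ is Fréchet-Urysohn if whenever $x\in\overline{A}\subseteq X$ there is a sequence in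 $A$ converging to $x$. $X$ is stratifiable if to each open $U\subseteq X$ one can assign a sequence $\{U_n\}_{n=1}^\infty$ of open subsets of $X$ such that (a) $\overline{U_n}\subseteq U$; (b) $\bigcup_{n}U_n=U$; (c) $U_n\subseteq V_n$ for all $n$ whenever $U\subseteq V$. A family $\mathscr{P}$ of subsets of $X$ is a $k$-network if for every compact $K$ and every open $U\supseteq K$ there is a finite $\mathscr{P}'\subseteq\mathscr{P}$ with $K\subseteq\bigcup\mathscr{P}'\subseteq U$. It is point-countable if each point belongs to at most countably many of its members. *)

theory Defs
  imports "HOL-Analysis.Analysis" "HOL-Algebra.Free_Abelian_Groups"
begin

section \<open>Classes of topological spaces\<close>

definition tychonoff_space :: "'a topology \<Rightarrow> bool" where
  "tychonoff_space X \<longleftrightarrow> completely_regular_space X \<and> Hausdorff_space X"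

definition k_R_space :: "'a topology \<Rightarrow> bool" where
  "k_R_space X \<longleftrightarrow> tychonoff_space X \<and>
     (\<forall>f :: 'a \<Rightarrow> real.
        (\<forall>K. compactin X K \<longrightarrow> continuous_map (subtopology X K) euclideanreal f)
        \<longrightarrow> continuous_map X euclideanreal f)"

text \<open>The sets \<open>K n\<close> are not required to cover the space. In a Hausdorff space their union
  is then still clopen with discrete complement, so this makes no difference to the local notion.\<close>

definition k_omega_space :: "'a topology \<Rightarrow> bool" where
  "k_omega_space X \<longleftrightarrow>
     (\<exists>K :: nat \<Rightarrow> 'a set. (\<forall>n. compactin X (K n)) \<and>
        (\<forall>F \<subseteq> topspace X.
           (\<forall>n. closedin (subtopology X (K n)) (F \<inter> K n)) \<longrightarrow> closedin X F))"

definition locally_k_omega_space :: "'a topology \<Rightarrow> bool" where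
  "locally_k_omega_space X \<longleftrightarrow>
     (\<forall>x \<in> topspace X. \<exists>U N. openin X U \<and> x \<in> U \<and> U \<subseteq> N \<and> N \<subseteq> topspace X \<and>
        k_omega_space (subtopology X N))"

definition frechet_urysohn_space :: "'a topology \<Rightarrow> bool" where
  "frechet_urysohn_space X \<longleftrightarrow>
     (\<forall>A x. A \<subseteq> topspace X \<and> x \<in> X closure_of A \<longrightarrow>
        (\<exists>\<sigma> :: nat \<Rightarrow> 'a. range \<sigma> \<subseteq> A \<and> limitin X \<sigma> x sequentially))"

definition stratifiable_space :: "'a topology \<Rightarrow> bool" where
  "stratifiable_space X \<longleftrightarrow>
     (\<exists>G :: 'a set \<Rightarrow> nat \<Rightarrow> 'a set.
        (\<forall>U. openin X U \<longrightarrow>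
           (\<forall>n. openin X (G U n) \<and> X closure_of (G U n) \<subseteq> U) \<and> (\<Union>n. G U n) = U) \<and>
        (\<forall>U V. openin X U \<and> openin X V \<and> U \<subseteq> V \<longrightarrow> (\<forall>n. G U n \<subseteq> G V n)))"

definition k_network :: "'a topology \<Rightarrow> 'a set set \<Rightarrow> bool" where
  "k_network X \<P> \<longleftrightarrow> (\<forall>P \<in> \<P>. P \<subseteq> topspace X) \<and>
     (\<forall>K U. compactin X K \<and> openin X U \<and> K \<subseteq> U \<longrightarrow>
        (\<exists>\<Q> \<subseteq> \<P>. finite \<Q> \<and> K \<subseteq> \<Union>\<Q> \<and> \<Union>\<Q> \<subseteq> U))"

definition point_countable :: "'a topology \<Rightarrow> 'a set set \<Rightarrow> bool" where
  "point_countable X \<P> \<longleftrightarrow> (\<forall>x \<in> topspace X. countable {P \<in> \<P>. x \<in> P})"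

section \<open>Free Abelian topological groups\<close>

text \<open>All spaces are Tychonoff, including those underlying topological groups.\<close>

definition abelian_topological_group :: "('g, 'm) monoid_scheme \<Rightarrow> 'g topology \<Rightarrow> bool" where
  "abelian_topological_group G T \<longleftrightarrow>
     comm_group G \<and> topspace T = carrier G \<and> tychonoff_space T \<and>
     continuous_map (prod_topology T T) T (\<lambda>(x, y). x \<otimes>\<^bsub>G\<^esub> y) \<and>
     continuous_map T T (\<lambda>x. inv\<^bsub>G\<^esub> x)"

text \<open>\<open>free_abelian_topology X T\<close> says that \<open>T\<close> turns the algebraically free Abelian group over
  \<open>topspace X\<close>, with \<open>frag_of\<close> as the map \<open>i\<close>, into the free Abelian topological group \<open>A(X)\<close>.
  That \<open>i(X)\<close> generates the group is built into \<open>free_Abelian_group\<close>.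

  HOL cannot quantify over groups of all types inside a definition, so the universal property is
  required for groups on subsets of the type of \<open>A(X)\<close> itself. Up to isomorphism these include
  every group generated by an image of \<open>X\<close>, and the universal property for groups on
  arbitrary types follows: see \<open>free_abelian_topology_universal\<close> below.\<close>

definition free_abelian_topology :: "'a topology \<Rightarrow> ('a \<Rightarrow>\<^sub>0 int) topology \<Rightarrow> bool" where
  "free_abelian_topology X T \<longleftrightarrow>
     abelian_topological_group (free_Abelian_group (topspace X)) T \<and>
     continuous_map X T frag_of \<and>
     (\<forall>(H :: ('a \<Rightarrow>\<^sub>0 int) monoid) S f.
        abelian_topological_group H S \<and> continuous_map X S f \<longrightarrow>
        (\<exists>h \<in> hom (free_Abelian_group (topspace X)) H.
           continuous_map T S h \<and> (\<forall>x \<in> topspace X. h (frag_of x) = f x)))"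

definition reduced_length :: "('a \<Rightarrow>\<^sub>0 int) \<Rightarrow> nat" where
  "reduced_length g = (\<Sum>x \<in> Poly_Mapping.keys g. nat \<bar>Poly_Mapping.lookup g x\<bar>)"

text \<open>The subspace \<open>A\<^sub>n(X)\<close>, where \<open>T\<close> is the topology of \<open>A(X)\<close>.\<close>

definition free_abelian_level :: "('a \<Rightarrow>\<^sub>0 int) topology \<Rightarrow> nat \<Rightarrow> ('a \<Rightarrow>\<^sub>0 int) topology" where
  "free_abelian_level T n = subtopology T {g \<in> topspace T. reduced_length g \<le> n}"

section \<open>The universal property for groups on arbitrary types\<close>

lemma tychonoff_space_inj_pullback:
  fixes e :: "'a \<Rightarrow> 'b" and S :: "'b topology"
  assumes S: "tychonoff_space S" and e: "inj_on e C" "e ` C \<subseteq> topspace S"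
  shows "tychonoff_space (pullback_topology C e S)"
proof -
  let ?P = "pullback_topology C e S"
  have top: "topspace ?P = C"
    using e(2) by (auto simp: topspace_pullback_topology)
  have cont: "continuous_map ?P S e"
    using continuous_map_pullback[OF continuous_map_id, of C e S] by simp
  have "Hausdorff_space ?P"
    using S cont e(1) unfolding tychonoff_space_def
    by (metis Hausdorff_space_injective_preimage top)
  moreover have "completely_regular_space ?P"
    unfolding completely_regular_space_def
  proof (intro allI impI, elim conjE)
    fix A x assume A: "closedin ?P A" and x: "x \<in> topspace ?P - A"
    then have "openin ?P (C - A)"
      using top by (metis closedin_def)
    then obtain U where U: "openin S U" "C - A = e -` U \<inter> C"
      by (auto simp: openin_pullback_topology)
    have AC: "A \<subseteq> C" using A closedin_subset top by blast
    have ex: "e x \<in> topspace S - (topspace S - U)"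
      using x top U e(2) by auto
    have "closedin S (topspace S - U)" using U by auto
    then obtain f :: "'b \<Rightarrow> real" where f: "continuous_map S (top_of_set {0..1}) f"
      "f (e x) = 0" "f ` (topspace S - U) \<subseteq> {1}"
      using S ex unfolding tychonoff_space_def completely_regular_space_def by meson
    show "\<exists>f::'a \<Rightarrow> real. continuous_map ?P (top_of_set {0..1}) f \<and> f x = 0 \<and> f ` A \<subseteq> {1}"
    proof (intro exI conjI)
      show "continuous_map ?P (top_of_set {0..1}) (f \<circ> e)"
        using cont f(1) continuous_map_compose by blast
      have "e a \<in> topspace S - U" if "a \<in> A" for a
        using that AC U(2) e(2) by blast
      then show "(f \<circ> e) ` A \<subseteq> {1}" using f(3) by auto
    qed (use f in auto)
  qed
  ultimately show ?thesis by (simp add: tychonoff_space_def)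
qed

lemma free_abelian_topology_universal:
  fixes H :: "('g, 'm) monoid_scheme"
  assumes T: "free_abelian_topology X T"
    and H: "abelian_topological_group H S"
    and f: "continuous_map X S f"
  shows "\<exists>h \<in> hom (free_Abelian_group (topspace X)) H.
           continuous_map T S h \<and> (\<forall>x \<in> topspace X. h (frag_of x) = f x)"
proof -
  let ?F = "free_Abelian_group (topspace X)"
  interpret H: comm_group H using H by (simp add: abelian_topological_group_def)
  interpret F: comm_group ?F by (rule abelian_free_Abelian_group)
  have topS: "topspace S = carrier H" using H by (simp add: abelian_topological_group_def)
  have "f ` topspace X \<subseteq> carrier H"
    using f topS by (metis continuous_map_image_subset_topspace)
  then obtain e where e: "e \<in> hom ?F H" and ef: "\<And>x. x \<in> topspace X \<Longrightarrow> e (frag_of x) = f x"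
    using H.free_Abelian_group_universal by blast
  interpret e: group_hom ?F H e
    using e by unfold_locales (auto simp: hom_def)
  define K where "K = e ` carrier ?F"
  define s where "s = inv_into (carrier ?F) e"
  define C where "C = s ` K"
  have K_sub: "K \<subseteq> carrier H" unfolding K_def by auto
  have es: "e (s k) = k" if "k \<in> K" for k
    using that unfolding K_def s_def by (rule f_inv_into_f)
  have K_mult: "a \<otimes>\<^bsub>H\<^esub> b \<in> K" if "a \<in> K" "b \<in> K" for a b
    using that subgroup.m_closed[OF e.img_is_subgroup] unfolding K_def by blast
  have K_inv: "inv\<^bsub>H\<^esub> a \<in> K" if "a \<in> K" for a
    using that subgroup.m_inv_closed[OF e.img_is_subgroup] unfolding K_def by blast
  have K_one: "\<one>\<^bsub>H\<^esub> \<in> K"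
    using subgroup.one_closed[OF e.img_is_subgroup] unfolding K_def by blast
  have eC: "e c \<in> K" "s (e c) = c" if "c \<in> C" for c
    using that es by (auto simp: C_def)
  have inj: "inj_on e C" using eC(2) by (metis inj_on_inverseI)
  define H' where "H' = \<lparr>carrier = C, mult = (\<lambda>a b. s (e a \<otimes>\<^bsub>H\<^esub> e b)), one = s \<one>\<^bsub>H\<^esub>\<rparr>"
  have H'_simps: "carrier H' = C" "\<And>a b. a \<otimes>\<^bsub>H'\<^esub> b = s (e a \<otimes>\<^bsub>H\<^esub> e b)" "\<one>\<^bsub>H'\<^esub> = s \<one>\<^bsub>H\<^esub>"
    by (auto simp: H'_def)
  have eH: "e c \<in> carrier H" if "c \<in> C" for c using eC(1)[OF that] K_sub by blast
  have sC: "s k \<in> C" if "k \<in> K" for k using that by (simp add: C_def)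
  have comm: "comm_group H'"
  proof (rule comm_groupI)
    show "\<exists>y\<in>carrier H'. y \<otimes>\<^bsub>H'\<^esub> x = \<one>\<^bsub>H'\<^esub>" if "x \<in> carrier H'" for x
      using that by (intro bexI[of _ "s (inv\<^bsub>H\<^esub> e x)"]) (auto simp: H'_simps es eC eH sC K_inv)
  qed (auto simp: H'_simps es eC eH sC K_mult K_one H.m_ac)
  interpret H': comm_group H' by (rule comm)
  have inv': "inv\<^bsub>H'\<^esub> c = s (inv\<^bsub>H\<^esub> e c)" if "c \<in> C" for c
    using that by (intro H'.inv_equality) (auto simp: H'_simps es eC eH sC K_inv)
  let ?S' = "pullback_topology C e S"
  have top': "topspace ?S' = C"
    using eH topS by (auto simp: topspace_pullback_topology)
  have conte: "continuous_map ?S' S e"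
    using continuous_map_pullback[OF continuous_map_id, of C e S] by simp
  have contI: "continuous_map Z ?S' g"
    if "continuous_map Z S g'" "\<And>z. z \<in> topspace Z \<Longrightarrow> g z \<in> C \<and> e (g z) = g' z"
    for Z :: "'z topology" and g g'
    using that by (intro continuous_map_pullback')
      (auto intro: continuous_map_eq[OF that(1)])
  have "abelian_topological_group H' ?S'"
    unfolding abelian_topological_group_def
  proof (intro conjI)
    show "tychonoff_space ?S'"
      using H inj eH topS by (intro tychonoff_space_inj_pullback) (auto simp: abelian_topological_group_def)
    have m: "continuous_map (prod_topology S S) S (\<lambda>(x, y). x \<otimes>\<^bsub>H\<^esub> y)"
      and i: "continuous_map S S (\<lambda>x. inv\<^bsub>H\<^esub> x)"
      using H by (auto simp: abelian_topological_group_def)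
    have "continuous_map (prod_topology ?S' ?S') (prod_topology S S) (\<lambda>z. (e (fst z), e (snd z)))"
      by (intro continuous_map_pairedI continuous_map_compose[OF continuous_map_fst conte, unfolded o_def]
          continuous_map_compose[OF continuous_map_snd conte, unfolded o_def])
    from continuous_map_compose[OF this m]
    show "continuous_map (prod_topology ?S' ?S') ?S' (\<lambda>(x, y). x \<otimes>\<^bsub>H'\<^esub> y)"
      by (rule contI) (auto simp: top' H'_simps es eC sC K_mult)
    from continuous_map_compose[OF conte i]
    show "continuous_map ?S' ?S' (\<lambda>x. inv\<^bsub>H'\<^esub> x)"
      by (rule contI) (auto simp: top' inv' es eC sC K_inv)
  qed (simp_all add: comm top' H'_simps)
  moreover have fK: "f x \<in> K" if "x \<in> topspace X" for x
    unfolding K_def using that by (intro image_eqI[of _ _ "frag_of x"]) (auto simp: ef)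
  have "continuous_map X ?S' (\<lambda>x. s (f x))"
    by (rule contI[OF f]) (auto simp: es sC fK)
  ultimately obtain h where h: "h \<in> hom ?F H'" "continuous_map T ?S' h"
      "\<And>x. x \<in> topspace X \<Longrightarrow> h (frag_of x) = s (f x)"
    using T unfolding free_abelian_topology_def by meson
  show ?thesis
  proof (intro bexI[of _ "e \<circ> h"] conjI ballI)
    show "e \<circ> h \<in> hom ?F H"
      using h(1) by (auto simp: hom_def H'_simps Pi_iff es eC eH K_mult)
    show "continuous_map T S (e \<circ> h)"
      using h(2) conte by (rule continuous_map_compose)
  qed (auto simp: h(3) es fK)
qed

end

theory Submission
  imports Defs "HOL-Probability.Discrete_Topology"
begin

text \<open>
  If \<open>X\<close> is metrizable or locally \<open>k\<^sub>\<omega>\<close>, then \<open>X \<times> X\<close> is a k-space. In a stratifiable space every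
  neighbourhood of the diagonal contains one given by a continuous pseudometric, so \<open>A\<^sub>2(X)\<close> is
  glued from continuous images of \<open>X \<times> X\<close> and inherits the k-property.

  Conversely, a point-countable k-network in which finite unions of members form neighbourhoods
  yields a point-countable base (Burke--Michael) and hence a development (Heath), which makes \<open>X\<close>
  metrizable. If this fails at \<open>p\<close>, a sequential fan converges to \<open>p\<close>. Call \<open>q\<close> bad if some
  countable family of sequences without cluster points is such that every neighbourhood of \<open>q\<close>
  contains infinitely many terms of one of them. A fan at \<open>p\<close> together with a bad point \<open>q\<close> gives a
  countable set of pairs accumulating at \<open>(p, q)\<close> which every compact set meets in a finite set.
  Without bad points the network may be assumed to have relatively compact members. Then either
  every point has a separable neighbourhood and \<open>X\<close> is locally \<open>k\<^sub>\<omega>\<close>, or some \<open>q\<close> is the vertex of an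
  uncountable fan, and the square of that fan again contains such a set of pairs. In both cases a
  sum of bump functions around the points \<open>x + y\<close>, for pairs \<open>(x, y)\<close> of the set, is continuous on
  compact subsets of \<open>A\<^sub>2(X)\<close> but not continuous.
\<close>

section \<open>Stratifications\<close>

text \<open>The topology of A(X) is known only through its universal property, so neighbourhoods in
  A(X) are cut out by continuous homomorphisms into normed spaces. The reals suffice away from 0. At
  0 all differences x - x meet, and a neighbourhood of the entire diagonal has to be controlled at
  once; this is what calls for pseudometrics.

  A stratification replaces the missing metric: it provides neighbourhoods \<open>nb n x\<close>
  such that, whenever points of \<open>nb n (x n)\<close> converge, their centres \<open>x n\<close>
  converge to the same limit. Pairs of points can therefore be chosen first and fattened to supports
  of bumps afterwards.

  A k-space among Tychonoff spaces is a k_R-space for trivial reasons, so the obstruction must be a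
  function and not merely a non-closed set. Point-countability serves as a counting device: a
  sequence meets only countably many members of the network, which keeps the recursive and maximal
  choices going.

  For an uncountable fan, heights are assigned to pairs so that every threshold function on the fan
  is exceeded by some pair in both coordinates. Real labels achieve this because an uncountable set
  of reals contains arbitrarily close points.\<close>

locale stratified =
  fixes X :: "'a topology" and G :: "'a set \<Rightarrow> nat \<Rightarrow> 'a set"
  assumes t1: "t1_space X"
    and G_open: "openin X U \<Longrightarrow> openin X (G U n)"
    and G_closure: "openin X U \<Longrightarrow> X closure_of G U n \<subseteq> U"
    and G_Union: "openin X U \<Longrightarrow> (\<Union>n. G U n) = U"
    and G_mono: "\<lbrakk>openin X U; openin X V; U \<subseteq> V; m \<le> n\<rbrakk> \<Longrightarrow> G U m \<subseteq> G V n"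

text \<open>Uniting the first pieces makes the stratification increase with \<open>n\<close>;
  closures stay inside \<open>U\<close> because the unions are finite. The later separations compare
  pieces of different index and rest on this.\<close>

lemma stratifiable_imp_stratified:
  assumes "stratifiable_space X" "t1_space X"
  obtains G where "stratified X G"
proof -
  obtain G :: "'a set \<Rightarrow> nat \<Rightarrow> 'a set" where
    G: "\<And>U n. openin X U \<Longrightarrow> openin X (G U n) \<and> X closure_of G U n \<subseteq> U"
       "\<And>U. openin X U \<Longrightarrow> (\<Union>n. G U n) = U"
       "\<And>U V n. openin X U \<Longrightarrow> openin X V \<Longrightarrow> U \<subseteq> V \<Longrightarrow> G U n \<subseteq> G V n"
    using assms(1) unfolding stratifiable_space_def by metis
  have "stratified X (\<lambda>U n. \<Union>i\<le>n. G U i)"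
  proof
    show "t1_space X" by fact
    show "openin X (\<Union>i\<le>n. G U i)" if "openin X U" for U n
      using that G(1) by blast
    show "X closure_of (\<Union>i\<le>n. G U i) \<subseteq> U" if "openin X U" for U n
      using that G(1) by (simp add: closure_of_Union UN_subset_iff)
    show "(\<Union>n. \<Union>i\<le>n. G U i) = U" if "openin X U" for U
      using G(2)[OF that] by blast
    show "(\<Union>i\<le>m. G U i) \<subseteq> (\<Union>i\<le>n. G V i)"
      if "openin X U" "openin X V" "U \<subseteq> V" "m \<le> n" for U V m n
      using G(3)[OF that(1-3)] that(4) by (fastforce intro: le_trans)
  qed
  then show thesis by (rule that)
qed

context stratified
begin

text \<open>Since \<open>G\<close> increases with \<open>n\<close>, these neighbourhoods of
  \<open>x\<close> shrink. They need not form a base at \<open>x\<close>; their strength is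
  uniformity in the centre, see \<open>nb_separates\<close>.\<close>

definition nb :: "nat \<Rightarrow> 'a \<Rightarrow> 'a set" where
  "nb n x = topspace X - X closure_of G (topspace X - {x}) n"

lemma open_Diff_singleton [simp]: "openin X (topspace X - {x})"
  using t1 by (metis Diff_empty Diff_insert0 closedin_def openin_topspace t1_space_closedin_singleton)

lemma nb_open [simp]: "openin X (nb n x)"
  unfolding nb_def by auto

lemma nb_self: "x \<in> topspace X \<Longrightarrow> x \<in> nb n x"
  unfolding nb_def using G_closure[of "topspace X - {x}" n] by auto

lemma G_subset: "openin X U \<Longrightarrow> G U n \<subseteq> U"
  using G_Union by blast

lemma G_subset_closure: "openin X U \<Longrightarrow> G U n \<subseteq> X closure_of G U n"
  by (simp add: G_open closure_of_subset openin_subset)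

lemma G_cover: "openin X U \<Longrightarrow> x \<in> U \<Longrightarrow> \<exists>m. x \<in> G U m"
  using G_Union[of U] by auto

text \<open>For \<open>x\<close> outside \<open>V\<close>, monotonicity puts \<open>G V m\<close>
  inside \<open>G (topspace X - {x}) n\<close>, whose closure is removed in \<open>nb n x\<close>.
  So \<open>G V m\<close> serves all such \<open>x\<close> and all \<open>n \<ge> m\<close> at
  once.\<close>

lemma nb_separates:
  assumes V: "openin X V" "z \<in> V"
  obtains m O' where "openin X O'" "z \<in> O'" "\<And>n x. n \<ge> m \<Longrightarrow> x \<notin> V \<Longrightarrow> nb n x \<inter> O' = {}"
proof -
  obtain m where m: "z \<in> G V m" using G_cover[OF V] by blast
  have "nb n x \<inter> G V m = {}" if "n \<ge> m" "x \<notin> V" for n x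
  proof -
    have "V \<subseteq> topspace X - {x}" using that V openin_subset by blast
    then have "G V m \<subseteq> G (topspace X - {x}) n"
      using G_mono V that by simp
    also have "\<dots> \<subseteq> X closure_of G (topspace X - {x}) n"
      by (rule G_subset_closure) simp
    finally show ?thesis unfolding nb_def by blast
  qed
  then show thesis using that G_open[OF V(1)] m by blast
qed

text \<open>If \<open>x j\<close> were outside a neighbourhood \<open>V\<close> of \<open>z\<close>
  infinitely often, the sets \<open>nb (k j) (x j)\<close> for large such \<open>j\<close> would
  miss a fixed neighbourhood of \<open>z\<close>, where the points \<open>u j\<close> eventually
  lie. In this role \<open>nb n x\<close> stands in for a metric ball of radius 1/n.\<close>

lemma limitin_nb_centres:
  assumes u: "limitin X u z sequentially" and "filterlim k at_top sequentially"
    and "\<And>j. u j \<in> nb (k j) (x j)"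
  shows "limitin X x z sequentially"
  unfolding limitin_def
proof (intro conjI allI impI)
  show "z \<in> topspace X" using u by (rule limitin_topspace)
  fix V assume "openin X V \<and> z \<in> V"
  then obtain m O' where mO: "openin X O'" "z \<in> O'" "\<And>n x. n \<ge> m \<Longrightarrow> x \<notin> V \<Longrightarrow> nb n x \<inter> O' = {}"
    using nb_separates by metis
  have "\<forall>\<^sub>F j in sequentially. u j \<in> O'" using u mO limitinD by metis
  moreover have "\<forall>\<^sub>F j in sequentially. k j \<ge> m" using assms(2) by (simp add: filterlim_at_top)
  ultimately show "\<forall>\<^sub>F j in sequentially. x j \<in> V"
    by eventually_elim (use mO(3) assms(3) in blast)
qed

text \<open>\<open>V i\<close> collects the pieces of \<open>W i\<close>, each without the closure
  of the piece of the complement of \<open>D i\<close> with the same index. For distinct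
  \<open>i\<close> and \<open>j\<close>, \<open>W i\<close> lies in the complement of
  \<open>D j\<close>, so a piece of smaller index in one set is contained in what the other set has
  removed. Arbitrarily many sets are separated at once and no discreteness is assumed.\<close>

lemma disjoint_expansion:
  assumes D: "\<And>i. i \<in> I \<Longrightarrow> closedin X (D i)"
    and W: "\<And>i. i \<in> I \<Longrightarrow> openin X (W i)" "\<And>i. i \<in> I \<Longrightarrow> D i \<subseteq> W i"
    and dis: "\<And>i j. i \<in> I \<Longrightarrow> j \<in> I \<Longrightarrow> i \<noteq> j \<Longrightarrow> W i \<inter> D j = {}"
  obtains V where "\<And>i. i \<in> I \<Longrightarrow> openin X (V i)" "\<And>i. i \<in> I \<Longrightarrow> D i \<subseteq> V i"
    "\<And>i. i \<in> I \<Longrightarrow> V i \<subseteq> W i" "disjoint_family_on V I"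
proof
  define V where "V i = (\<Union>m. G (W i) m - X closure_of G (topspace X - D i) m)" for i
  have oD: "openin X (topspace X - D i)" if "i \<in> I" for i using D that by auto
  show "openin X (V i)" if "i \<in> I" for i
    unfolding V_def using W that by (auto intro!: openin_Union openin_diff G_open)
  show "V i \<subseteq> W i" if "i \<in> I" for i
    unfolding V_def using G_subset[OF W(1)[OF that]] by blast
  show "D i \<subseteq> V i" if i: "i \<in> I" for i
  proof
    fix x assume x: "x \<in> D i"
    then obtain m where "x \<in> G (W i) m" using G_cover[OF W(1)[OF i]] W(2)[OF i] by blast
    moreover have "x \<notin> X closure_of G (topspace X - D i) m" using G_closure[OF oD[OF i]] x by blast
    ultimately show "x \<in> V i" unfolding V_def by blast
  qed
  have key: False if "i \<in> I" "j \<in> I" "i \<noteq> j" "x \<in> G (W i) m - X closure_of G (topspace X - D i) m"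
    "x \<in> G (W j) k - X closure_of G (topspace X - D j) k" "m \<le> k" for i j x m k
  proof -
    have "W i \<subseteq> topspace X - D j" using that dis W openin_subset by blast
    then have "G (W i) m \<subseteq> G (topspace X - D j) k"
      using G_mono W oD that by simp
    also have "\<dots> \<subseteq> X closure_of G (topspace X - D j) k"
      using that by (intro G_subset_closure oD)
    finally show False using that by blast
  qed
  show "disjoint_family_on V I"
    unfolding disjoint_family_on_def V_def
  proof (intro ballI impI equals0I)
    fix i j x assume ij: "i \<in> I" "j \<in> I" "i \<noteq> j"
      and "x \<in> (\<Union>m. G (W i) m - X closure_of G (topspace X - D i) m) \<inter> (\<Union>m. G (W j) m - X closure_of G (topspace X - D j) m)"
    then obtain m k where mk: "x \<in> G (W i) m - X closure_of G (topspace X - D i) m" "x \<in> G (W j) k - X closure_of G (topspace X - D j) k"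
      by blast
    show False
    proof (cases "m \<le> k")
      case True then show ?thesis using key[OF ij mk] by blast
    next
      case False then show ?thesis using key[OF ij(2,1) _ mk(2,1)] ij by simp
    qed
  qed
qed

lemma normal: "normal_space X"
  unfolding normal_space_def
proof (intro allI impI, elim conjE)
  fix S T assume ST: "closedin X S" "closedin X T" "disjnt S T"
  define D where "D b = (if b then S else T)" for b
  define W where "W b = (if b then topspace X - T else topspace X - S)" for b
  obtain V where V: "\<And>i. i \<in> UNIV \<Longrightarrow> openin X (V i)" "\<And>i. i \<in> UNIV \<Longrightarrow> D i \<subseteq> V i"
    "\<And>i. i \<in> UNIV \<Longrightarrow> V i \<subseteq> W i" "disjoint_family_on V UNIV"
  proof (rule disjoint_expansion[of UNIV D W])
    show "closedin X (D i)" for i using ST D_def by auto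
    show "openin X (W i)" for i using ST by (auto simp: W_def)
    show "D i \<subseteq> W i" for i using ST closedin_subset by (fastforce simp: W_def D_def disjnt_def)
    show "W i \<inter> D j = {}" if "i \<noteq> j" for i j using that by (auto simp: W_def D_def)
  qed blast
  have "disjnt (V True) (V False)" using disjoint_family_onD[OF V(4), of True False] by (simp add: disjnt_def)
  then show "\<exists>U V. openin X U \<and> openin X V \<and> S \<subseteq> U \<and> T \<subseteq> V \<and> disjnt U V"
    using V(1,2)[of True] V(1,2)[of False] by (auto simp: D_def)
qed

lemma Hausdorff: "Hausdorff_space X"
  using normal t1 normal_t1_imp_Hausdorff_space by blast

lemma shrink:
  assumes "openin X U" "x \<in> U"
  obtains V where "openin X V" "x \<in> V" "X closure_of V \<subseteq> U"
  using normal t1 assms unfolding normal_space_alt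
  by (metis empty_subsetI insert_subset openin_subset subsetD t1_space_closedin_singleton)

text \<open>With the index set well-ordered, \<open>layer\<close> collects the points whose first member of the
  cover is \<open>U i\<close>; for fixed \<open>n\<close> this turns any open cover into a discrete family.\<close>

definition layer :: "('i \<Rightarrow> 'a set) \<Rightarrow> 'i rel \<Rightarrow> nat \<Rightarrow> 'i \<Rightarrow> 'a set" where
  "layer U r n i = G (\<Union>j\<in>{j. j = i \<or> (j, i) \<in> r}. U j) n - (\<Union>j\<in>{j. (j, i) \<in> r}. U j)"

text \<open>The index of the only layer set that the neighbourhood may meet also names a cover
  member containing the point. This is what later keeps the closures of the layer sets inside the
  cover members.\<close>

lemma layers:
  fixes U :: "'i \<Rightarrow> 'a set"
  assumes U: "\<And>i. openin X (U i)" "topspace X \<subseteq> (\<Union>i. U i)"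
  obtains H :: "nat \<Rightarrow> 'i \<Rightarrow> 'a set" where
    "\<And>x. x \<in> topspace X \<Longrightarrow> \<exists>n i. x \<in> H n i"
    "\<And>n i. H n i \<subseteq> U i"
    "\<And>n x. x \<in> topspace X \<Longrightarrow> \<exists>O' i. openin X O' \<and> x \<in> O' \<and> x \<in> U i \<and> (\<forall>j. j \<noteq> i \<longrightarrow> O' \<inter> H n j = {})"
proof -
  obtain r0 :: "'i rel" where "Well_order r0 \<and> Field r0 = UNIV" using well_ordering by metis
  then have r0: "wf (r0 - Id)" "total_on UNIV r0" "antisym r0" "trans r0"
    by (auto simp add: well_order_on_def linear_order_on_def partial_order_on_def preorder_on_def)
  define r where "r = r0 - Id"
  have r: "wf r" "\<And>i j. i \<noteq> j \<Longrightarrow> (i, j) \<in> r \<or> (j, i) \<in> r" "trans r"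
    using r0 by (auto simp: r_def total_on_def intro: trans_diff_Id)
  define H where "H = layer U r"
  define L where "L i = (\<Union>j\<in>{j. (j, i) \<in> r}. U j)" for i
  define L' where "L' i = (\<Union>j\<in>{j. j = i \<or> (j, i) \<in> r}. U j)" for i
  have LH: "H n i = G (L' i) n - L i" for n i
    by (simp add: H_def layer_def L_def L'_def)
  have oL: "openin X (L i)" "openin X (L' i)" for i
    unfolding L_def L'_def using U by blast+
  have least: "\<exists>i. x \<in> U i \<and> x \<notin> L i" if x: "x \<in> topspace X" for x
  proof -
    have "\<exists>i. i \<in> {i. x \<in> U i}" using U x by blast
    then obtain i where "x \<in> U i" "\<And>j. (j, i) \<in> r \<Longrightarrow> x \<notin> U j"
      using wfE_min[OF r(1)] by (metis mem_Collect_eq)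
    then show ?thesis unfolding L_def by blast
  qed
  show thesis
  proof
    fix x n assume x: "x \<in> topspace X"
    then obtain i where i: "x \<in> U i" "x \<notin> L i" using least by blast
    have "x \<in> L' i" using i unfolding L'_def by blast
    then obtain m where "x \<in> G (L' i) m" using G_cover[OF oL(2)] by blast
    with i have "x \<in> H m i" unfolding LH by blast
    then show "\<exists>n i. x \<in> H n i" by (intro exI)
    \<comment> \<open>Later layer sets have \<open>U i\<close> removed. Earlier ones lie in
      \<open>G (L i) n\<close> by monotonicity, so deleting its closure disposes of them, and
      \<open>x\<close> survives because it is not in \<open>L i\<close>.\<close>
    define O' where "O' = U i - X closure_of G (L i) n"
    have "O' \<inter> H n j = {}" if ji: "j \<noteq> i" for j
    proof -
      consider "(i, j) \<in> r" | "(j, i) \<in> r" using r(2)[OF ji] by blast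
      then show ?thesis
      proof cases
        case 1
        then have "U i \<subseteq> L j" unfolding L_def by blast
        then show ?thesis unfolding O'_def LH by blast
      next
        case 2
        then have "L' j \<subseteq> L i" unfolding L_def L'_def using r(3) by (auto dest: transD)
        then have "G (L' j) n \<subseteq> G (L i) n" using G_mono oL by simp
        also have "\<dots> \<subseteq> X closure_of G (L i) n" by (intro G_subset_closure oL)
        finally show ?thesis unfolding O'_def LH by blast
      qed
    qed
    moreover have "x \<in> O'" using i G_closure[OF oL(1)] unfolding O'_def by blast
    moreover have "openin X O'" unfolding O'_def using U by (simp add: openin_diff)
    ultimately show "\<exists>O' i. openin X O' \<and> x \<in> O' \<and> x \<in> U i \<and> (\<forall>j. j \<noteq> i \<longrightarrow> O' \<inter> H n j = {})"
      using i by blast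
  next
    show "H n i \<subseteq> U i" for n i
      using G_subset[OF oL(2)] unfolding LH L_def L'_def by blast
  qed
qed

end

section \<open>Continuous pseudometrics\<close>

text \<open>The bound 1 makes countable suprema exist and each function \<open>d x\<close> bounded.
  The axioms hold on the whole type, so no restriction to \<open>topspace X\<close> has to be
  carried along.\<close>

definition pseudometric :: "('a \<Rightarrow> 'a \<Rightarrow> real) \<Rightarrow> bool" where
  "pseudometric d \<longleftrightarrow> (\<forall>x y. d x x = 0 \<and> d x y = d y x \<and> 0 \<le> d x y \<and> d x y \<le> 1) \<and>
     (\<forall>x y z. d x z \<le> d x y + d y z)"

text \<open>Smallness near the diagonal is enough: joint continuity follows from the triangle
  inequality.\<close>

definition continuous_pseudometric :: "'a topology \<Rightarrow> ('a \<Rightarrow> 'a \<Rightarrow> real) \<Rightarrow> bool" where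
  "continuous_pseudometric X d \<longleftrightarrow> pseudometric d \<and>
     (\<forall>x\<in>topspace X. \<forall>e>0. \<exists>O'. openin X O' \<and> x \<in> O' \<and> (\<forall>y\<in>O'. d x y < e))"

lemma pseudometric_SUP:
  assumes "\<And>n::nat. pseudometric (d n)"
  shows "pseudometric (\<lambda>x y. SUP n. d n x y)" "d n x y \<le> (SUP n. d n x y)"
proof -
  have bdd: "bdd_above (range (\<lambda>n. d n x y))" for x y
    using assms by (intro bdd_aboveI2[of _ _ 1]) (auto simp: pseudometric_def)
  show up: "d n x y \<le> (SUP n. d n x y)" for n x y
    by (rule cSUP_upper[OF _ bdd]) auto
  show "pseudometric (\<lambda>x y. SUP n. d n x y)"
    unfolding pseudometric_def
  proof (intro conjI allI)
    fix x y z
    show "(SUP n. d n x x) = 0" using assms by (simp add: pseudometric_def)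
    show "(SUP n. d n x y) = (SUP n. d n y x)" using assms unfolding pseudometric_def by metis
    show "0 \<le> (SUP n. d n x y)" using up[of 0 x y] assms[of 0] unfolding pseudometric_def by (meson order_trans)
    show "(SUP n. d n x y) \<le> 1" using assms by (intro cSUP_least) (auto simp: pseudometric_def)
    show "(SUP n. d n x z) \<le> (SUP n. d n x y) + (SUP n. d n y z)"
    proof (intro cSUP_least)
      fix n show "d n x z \<le> (SUP n. d n x y) + (SUP n. d n y z)"
        using up[of n x y] up[of n y z] assms[of n] unfolding pseudometric_def by (smt (verit))
    qed auto
  qed
qed

text \<open>The hedgehog metric: spines are the values of \<open>c\<close>, and \<open>q\<close> is the distance from the centre.\<close>

definition hedgehog :: "('a \<Rightarrow> real) \<Rightarrow> ('a \<Rightarrow> 'c) \<Rightarrow> 'a \<Rightarrow> 'a \<Rightarrow> real" where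
  "hedgehog q c x y = (if c x = c y then \<bar>q x - q y\<bar> else max (q x) (q y))"

lemma pseudometric_hedgehog:
  assumes "\<And>x. 0 \<le> q x \<and> q x \<le> 1"
  shows "pseudometric (hedgehog q c)"
proof -
  have "hedgehog q c x z \<le> hedgehog q c x y + hedgehog q c y z" for x y z
    using assms[of x] assms[of y] assms[of z] unfolding hedgehog_def
    by (auto simp: abs_if max_def)
  moreover have "0 \<le> hedgehog q c x y" "hedgehog q c x y \<le> 1" "hedgehog q c x y = hedgehog q c y x" for x y
    using assms[of x] assms[of y] unfolding hedgehog_def by (auto simp: abs_if max_def)
  moreover have "hedgehog q c x x = 0" for x by (simp add: hedgehog_def)
  ultimately show ?thesis unfolding pseudometric_def by blast
qed

lemma openin_less_preimage:
  fixes f :: "'a \<Rightarrow> real"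
  assumes "continuous_map X euclideanreal f"
  shows "openin X {x \<in> topspace X. a < f x}" "openin X {x \<in> topspace X. f x < a}"
  using openin_continuous_map_preimage[OF assms, of "{a<..}"]
    openin_continuous_map_preimage[OF assms, of "{..<a}"] by (auto simp: open_openin[symmetric])

text \<open>The spine label has to be locally constant only where \<open>q\<close> is positive. At a
  point with \<open>q x = 0\<close> both clauses of the definition give the distance
  \<open>q y\<close>, whatever the labels are.\<close>

lemma hedgehog_continuous:
  assumes q: "continuous_map X euclideanreal q" "\<And>x. 0 \<le> q x"
    and c: "\<And>x. x \<in> topspace X \<Longrightarrow> 0 < q x \<Longrightarrow> \<exists>W. openin X W \<and> x \<in> W \<and> (\<forall>y\<in>W. c y = c x)"
    and x: "x \<in> topspace X" "0 < e"
  shows "\<exists>O'. openin X O' \<and> x \<in> O' \<and> (\<forall>y\<in>O'. hedgehog q c x y < e)"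
proof -
  define O1 where "O1 = {y \<in> topspace X. q x - e < q y} \<inter> {y \<in> topspace X. q y < q x + e}"
  have O1: "openin X O1" "x \<in> O1"
    using openin_less_preimage[OF q(1)] x by (auto simp: O1_def)
  show ?thesis
  proof (cases "0 < q x")
    case True
    then obtain W where W: "openin X W" "x \<in> W" "\<forall>y\<in>W. c y = c x" using c x by metis
    have "\<forall>y \<in> O1 \<inter> W. hedgehog q c x y < e"
      using W(3) by (auto simp: hedgehog_def O1_def abs_if)
    then show ?thesis using O1 W by (intro exI[of _ "O1 \<inter> W"]) auto
  next
    case False
    then have "q x = 0" using q(2)[of x] by simp
    then have "\<forall>y \<in> O1. hedgehog q c x y < e"
      using q(2) x by (auto simp: hedgehog_def O1_def abs_if max_def)
    then show ?thesis using O1 by blast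
  qed
qed

section \<open>Pseudometrics subordinate to an open cover\<close>

context stratified
begin

text \<open>The closures of the sets in one layer are again discrete, hence their unions are closed,
  they swell to disjoint open sets, and a single Urysohn function serves the entire layer.
  Disjointness gives each point with \<open>f n x > 0\<close> a unique index, its spine in the
  hedgehog.\<close>

lemma cover_functions:
  fixes U :: "'i \<Rightarrow> 'a set"
  assumes U: "\<And>i. openin X (U i)" "topspace X \<subseteq> (\<Union>i. U i)"
  obtains V :: "nat \<Rightarrow> 'i \<Rightarrow> 'a set" and f :: "nat \<Rightarrow> 'a \<Rightarrow> real" where
    "\<And>n i. openin X (V n i)" "\<And>n i. V n i \<subseteq> U i" "\<And>n. disjoint_family (V n)"
    "\<And>n. continuous_map X euclideanreal (f n)"
    "\<And>n x. x \<in> topspace X \<Longrightarrow> 0 \<le> f n x \<and> f n x \<le> 1"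
    "\<And>n x. x \<in> topspace X \<Longrightarrow> f n x > 0 \<Longrightarrow> x \<in> (\<Union>i. V n i)"
    "\<And>x. x \<in> topspace X \<Longrightarrow> \<exists>n. f n x = 1"
proof -
  obtain H :: "nat \<Rightarrow> 'i \<Rightarrow> 'a set" where H:
    "\<And>x. x \<in> topspace X \<Longrightarrow> \<exists>n i. x \<in> H n i" "\<And>n i. H n i \<subseteq> U i"
    "\<And>n x. x \<in> topspace X \<Longrightarrow> \<exists>O' i. openin X O' \<and> x \<in> O' \<and> x \<in> U i \<and> (\<forall>j. j \<noteq> i \<longrightarrow> O' \<inter> H n j = {})"
    using layers[OF U] by metis
  define D where "D n i = X closure_of H n i" for n i
  have HD: "H n i \<subseteq> D n i" for n i
    unfolding D_def by (meson H(2) U(1) closure_of_subset openin_subset order_trans)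
  have Dsub: "D n i \<subseteq> topspace X" for n i by (simp add: D_def closure_of_subset_topspace)
  have disc: "\<exists>O' i. openin X O' \<and> x \<in> O' \<and> x \<in> U i \<and> (\<forall>j. j \<noteq> i \<longrightarrow> O' \<inter> D n j = {})" if x: "x \<in> topspace X" for n x
  proof -
    obtain O' i where "openin X O'" "x \<in> O'" "x \<in> U i" "\<forall>j. j \<noteq> i \<longrightarrow> O' \<inter> H n j = {}"
      using H(3)[OF x, of n] by metis
    then show ?thesis unfolding D_def by (metis openin_Int_closure_of_eq_empty)
  qed
  have DU: "D n i \<subseteq> U i" for n i
  proof
    fix x assume x: "x \<in> D n i"
    then obtain O' k where k: "x \<in> O'" "x \<in> U k" "\<forall>j. j \<noteq> k \<longrightarrow> O' \<inter> D n j = {}"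
      using disc[of x n] Dsub by (metis subsetD)
    have "k = i" using k x by (metis IntI empty_iff)
    then show "x \<in> U i" using k by simp
  qed
  have Ddis: "D n i \<inter> D n j = {}" if "i \<noteq> j" for n i j
  proof (rule equals0I)
    fix x assume x: "x \<in> D n i \<inter> D n j"
    then obtain O' k where "x \<in> O'" "\<forall>j. j \<noteq> k \<longrightarrow> O' \<inter> D n j = {}"
      using disc[of x n] Dsub by (metis IntD1 subsetD)
    then show False using x that by (metis IntD1 IntD2 IntI empty_iff)
  qed
  have Dcl: "closedin X (\<Union>j\<in>J. D n j)" for J n
    unfolding closedin_def
  proof (intro conjI)
    show "(\<Union>j\<in>J. D n j) \<subseteq> topspace X" using Dsub by blast
    show "openin X (topspace X - (\<Union>j\<in>J. D n j))"
    proof (subst openin_subopen, intro ballI)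
      fix x assume x: "x \<in> topspace X - (\<Union>j\<in>J. D n j)"
      then obtain O' k where O': "openin X O'" "x \<in> O'" "\<forall>j. j \<noteq> k \<longrightarrow> O' \<inter> D n j = {}"
        using disc[of x n] by (metis DiffD1)
      \<comment> \<open>At most the closure with index \<open>k\<close> meets \<open>O'\<close>;
        deleting it when \<open>k\<close> belongs to \<open>J\<close> leaves a neighbourhood
        disjoint from the union.\<close>
      have "openin X (O' - (if k \<in> J then D n k else {}))"
        using O' by (auto simp: D_def)
      moreover have "O' - (if k \<in> J then D n k else {}) \<subseteq> topspace X - (\<Union>j\<in>J. D n j)"
      proof
        fix y assume y: "y \<in> O' - (if k \<in> J then D n k else {})"
        have "y \<notin> D n j" if "j \<in> J" for j
          using y that O'(3) by (cases "j = k") auto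
        then show "y \<in> topspace X - (\<Union>j\<in>J. D n j)" using y O'(1) openin_subset by blast
      qed
      moreover have "x \<in> O' - (if k \<in> J then D n k else {})" using x O'(2) by auto
      ultimately show "\<exists>T. openin X T \<and> x \<in> T \<and> T \<subseteq> topspace X - (\<Union>j\<in>J. D n j)"
        by blast
    qed
  qed
  have "\<exists>V. (\<forall>i. openin X (V i)) \<and> (\<forall>i. D n i \<subseteq> V i) \<and> (\<forall>i. V i \<subseteq> U i) \<and> disjoint_family V" for n
  proof -
    define W where "W i = U i - (\<Union>j\<in>-{i}. D n j)" for i
    have *: "openin X (W i)" "D n i \<subseteq> W i" "closedin X (D n i)" for i
    proof -
      show "openin X (W i)" unfolding W_def by (intro openin_diff U Dcl)
      show "D n i \<subseteq> W i" using Ddis DU unfolding W_def by blast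
      show "closedin X (D n i)" by (simp add: D_def)
    qed
    have **: "W i \<inter> D n j = {}" if "i \<noteq> j" for i j
      using that unfolding W_def by blast
    obtain V where V: "\<And>i. i \<in> UNIV \<Longrightarrow> openin X (V i)" "\<And>i. i \<in> UNIV \<Longrightarrow> D n i \<subseteq> V i"
      "\<And>i. i \<in> UNIV \<Longrightarrow> V i \<subseteq> W i" "disjoint_family V"
      by (rule disjoint_expansion[of UNIV "D n" W]) (use * ** in auto)
    have "W i \<subseteq> U i" for i unfolding W_def by blast
    then have "V i \<subseteq> U i" for i using V(3)[of i] by blast
    then show ?thesis using V by blast
  qed
  then obtain V where V: "\<And>n i. openin X (V n i)" "\<And>n i. D n i \<subseteq> V n i" "\<And>n i. V n i \<subseteq> U i"
    "\<And>n. disjoint_family (V n)" by metis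
  have "\<exists>f. continuous_map X (top_of_set {0..1::real}) f \<and> f ` (topspace X - (\<Union>i. V n i)) \<subseteq> {0} \<and>
      f ` (\<Union>i\<in>UNIV. D n i) \<subseteq> {1}" for n
  proof -
    have "closedin X (topspace X - (\<Union>i. V n i))" using V(1) by blast
    moreover have "disjnt (topspace X - (\<Union>i. V n i)) (\<Union>i\<in>UNIV. D n i)"
      using V(2) unfolding disjnt_def by blast
    ultimately show ?thesis
      using Urysohn_lemma[OF normal _ Dcl, of _ n UNIV 0 1] by (metis zero_le_one)
  qed
  then obtain f :: "nat \<Rightarrow> 'a \<Rightarrow> real" where f: "\<And>n. continuous_map X (top_of_set {0..1::real}) (f n)"
    "\<And>n. f n ` (topspace X - (\<Union>i. V n i)) \<subseteq> {0}" "\<And>n. f n ` (\<Union>i\<in>UNIV. D n i) \<subseteq> {1}" by metis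
  show thesis
  proof (rule that[of V f])
    show "continuous_map X euclideanreal (f n)" for n using f(1) by (simp add: continuous_map_in_subtopology)
    show "0 \<le> f n x \<and> f n x \<le> 1" if "x \<in> topspace X" for n x
      using f(1)[of n] that by (auto simp: continuous_map_in_subtopology)
    show "x \<in> (\<Union>i. V n i)" if "x \<in> topspace X" "f n x > 0" for n x
      using f(2)[of n] that by force
    show "\<exists>n. f n x = 1" if x: "x \<in> topspace X" for x
    proof -
      obtain n i where "x \<in> H n i" using H(1)[OF x] by blast
      then have "x \<in> (\<Union>i\<in>UNIV. D n i)" using HD by blast
      then show ?thesis using f(3)[of n] by blast
    qed
  qed (use V in auto)
qed

text \<open>The cut-off functions \<open>q n\<close> below form a locally finite family with maximum 1 at every
  point, and the spines of the \<open>n\<close>-th hedgehog refine the cover.\<close>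

lemma cover_pseudometric:
  fixes U :: "'i \<Rightarrow> 'a set"
  assumes U: "\<And>i. openin X (U i)" "topspace X \<subseteq> (\<Union>i. U i)"
  obtains d where "continuous_pseudometric X d"
    "\<And>x y. \<lbrakk>x \<in> topspace X; y \<in> topspace X; d x y < 1\<rbrakk> \<Longrightarrow> \<exists>i. x \<in> U i \<and> y \<in> U i"
proof -
  obtain V :: "nat \<Rightarrow> 'i \<Rightarrow> 'a set" and f :: "nat \<Rightarrow> 'a \<Rightarrow> real" where
    V: "\<And>n i. openin X (V n i)" "\<And>n i. V n i \<subseteq> U i" "\<And>n. disjoint_family (V n)"
    and fc: "\<And>n. continuous_map X euclideanreal (f n)"
    and f01: "\<And>n x. x \<in> topspace X \<Longrightarrow> 0 \<le> f n x \<and> f n x \<le> 1"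
    and fV: "\<And>n x. x \<in> topspace X \<Longrightarrow> f n x > 0 \<Longrightarrow> x \<in> (\<Union>i. V n i)"
    and f1: "\<And>x. x \<in> topspace X \<Longrightarrow> \<exists>n. f n x = 1"
    using cover_functions[OF U] by metis
  \<comment> \<open>\<open>t i x\<close> is 1 while \<open>f i x \<le> 1/2\<close> and 0 once
    \<open>f i x \<ge> 3/4\<close>. So at the first \<open>n\<close> with
    \<open>f n x \<ge> 1/2\<close> no earlier factor cuts off and \<open>q n x = 1\<close>, whereas
    near a point with \<open>f N x = 1\<close> all \<open>q n\<close> with \<open>n > N\<close>
    vanish.\<close>
  define t where "t i x = 1 - max 0 (min 1 (4 * f i x - 2))" for i x
  define q where "q n x = (if x \<in> topspace X then min 1 (2 * f n x) * (\<Prod>i<n. t i x) else 0)" for n x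
  define c where "c n x = {i. x \<in> V n i}" for n x
  define h where "h n = hedgehog (q n) (c n)" for n
  define d where "d x y = (SUP n. h n x y)" for x y
  have t01: "0 \<le> t i x" "t i x \<le> 1" for i x by (auto simp: t_def)
  have q01: "0 \<le> q n x \<and> q n x \<le> 1" for n x
  proof -
    have "0 \<le> (\<Prod>i<n. t i x)" "(\<Prod>i<n. t i x) \<le> 1"
      using t01 by (auto intro: prod_nonneg prod_le_1)
    then show ?thesis using f01[of x n] by (auto simp: q_def intro!: mult_le_one)
  qed
  have qc: "continuous_map X euclideanreal (q n)" for n
  proof -
    have "continuous_map X euclideanreal (\<lambda>x. min 1 (2 * f n x) * (\<Prod>i<n. t i x))"
      unfolding t_def by (intro continuous_intros fc) auto
    then show ?thesis by (rule continuous_map_eq) (simp add: q_def)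
  qed
  have hp: "pseudometric (h n)" for n unfolding h_def by (intro pseudometric_hedgehog q01)
  have qV: "x \<in> (\<Union>i. V n i)" if "x \<in> topspace X" "q n x > 0" for n x
  proof (rule fV[OF that(1)], rule ccontr)
    assume "\<not> 0 < f n x"
    then have "f n x = 0" using f01[OF that(1), of n] by simp
    then show False using that by (simp add: q_def)
  qed
  have hc: "\<exists>O'. openin X O' \<and> x \<in> O' \<and> (\<forall>y\<in>O'. h n x y < e)" if x: "x \<in> topspace X" "0 < e" for n x e
    unfolding h_def
  proof (rule hedgehog_continuous[OF qc _ _ x])
    fix z assume "z \<in> topspace X" "0 < q n z"
    then obtain i where i: "z \<in> V n i" using qV by blast
    have "c n y = {i}" if "y \<in> V n i" for y
      using that V(3)[of n] unfolding c_def disjoint_family_on_def by blast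
    then show "\<exists>W. openin X W \<and> z \<in> W \<and> (\<forall>y\<in>W. c n y = c n z)"
      using V(1) i by metis
  qed (use q01 in auto)
  show thesis
  proof (rule that[of d])
    show "continuous_pseudometric X d"
      unfolding continuous_pseudometric_def
    proof (intro conjI ballI allI impI)
      show "pseudometric d" unfolding d_def by (intro pseudometric_SUP hp)
      fix x and e :: real assume x: "x \<in> topspace X" and e: "0 < e"
      obtain N where N: "f N x = 1" using f1 x by metis
      define O0 where "O0 = {y \<in> topspace X. 3/4 < f N y}"
      have O0: "openin X O0" unfolding O0_def by (rule openin_less_preimage(1)[OF fc])
      have xO0: "x \<in> O0" using N x by (simp add: O0_def)
      have q0: "q n y = 0" if "n > N" "y \<in> O0" for n y
      proof -
        have "t N y = 0" using that by (auto simp: t_def O0_def)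
        then have "(\<Prod>i<n. t i y) = 0" using that by auto
        then show ?thesis by (simp add: q_def)
      qed
      obtain Oh where Oh: "\<And>n. openin X (Oh n)" "\<And>n. x \<in> Oh n" "\<And>n y. y \<in> Oh n \<Longrightarrow> h n x y < e/2"
        using hc[OF x, of "e/2"] e by (metis half_gt_zero)
      define O' where "O' = O0 \<inter> (\<Inter>n\<in>{..N}. Oh n)"
      have "openin X O'" unfolding O'_def using Oh O0 by (intro openin_Int openin_INT2) auto
      moreover have "x \<in> O'" using Oh xO0 by (auto simp: O'_def)
      moreover have "d x y < e" if y: "y \<in> O'" for y
      proof -
        have "h n x y \<le> e/2" for n
        proof (cases "n \<le> N")
          case True
          then have "y \<in> Oh n" using y by (auto simp: O'_def)
          then show ?thesis using Oh(3)[of y n] by simp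
        next
          case False
          then have "q n x = 0" "q n y = 0" using q0 xO0 y by (auto simp: O'_def)
          then show ?thesis using e by (simp add: h_def hedgehog_def)
        qed
        then have "d x y \<le> e/2" unfolding d_def by (intro cSUP_least) auto
        then show ?thesis using e by simp
      qed
      ultimately show "\<exists>O'. openin X O' \<and> x \<in> O' \<and> (\<forall>y\<in>O'. d x y < e)" by blast
    qed
  next
    fix x y assume xy: "x \<in> topspace X" "y \<in> topspace X" "d x y < 1"
    define n where "n = (LEAST n. 1/2 \<le> f n x)"
    obtain N where "f N x = 1" using f1 xy by metis
    then have "1/2 \<le> f N x" by simp
    then have n: "1/2 \<le> f n x" unfolding n_def by (rule LeastI)
    have "t i x = 1" if "i < n" for i
      using not_less_Least[of i "\<lambda>n. 1/2 \<le> f n x"] that by (simp add: n_def t_def)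
    then have "(\<Prod>i<n. t i x) = 1" by simp
    then have q1: "q n x = 1" using n xy by (simp add: q_def)
    have "h n x y < 1" using pseudometric_SUP(2)[of h n x y, OF hp] xy unfolding d_def by simp
    \<comment> \<open>On different spines the distance would be at least \<open>q n x = 1\<close>;
      on a common spine it is \<open>1 - q n y\<close>, so \<open>q n y\<close> is positive.\<close>
    then have *: "c n x = c n y" "q n y > 0"
      using q1 q01[of n y] by (auto simp: h_def hedgehog_def split: if_splits)
    obtain i where "x \<in> V n i" using qV[of x n] q1 xy by auto
    moreover have "y \<in> V n i" using * calculation by (auto simp: c_def)
    ultimately show "\<exists>i. x \<in> U i \<and> y \<in> U i" using V by blast
  qed
qed

end

text \<open>The supremum with weights \<open>(1/2)^n\<close> is a metric for the topology: near a
  point, finitely many terms are small by continuity and the others by their weights, while a ball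
  of one \<open>d n\<close> contains a ball of the supremum after rescaling by its weight.\<close>

lemma metrizable_from_pseudometrics:
  assumes t1: "t1_space X" and d: "\<And>n::nat. continuous_pseudometric X (d n)"
    and base: "\<And>U x. openin X U \<Longrightarrow> x \<in> U \<Longrightarrow> \<exists>n. \<exists>e>0. \<forall>y\<in>topspace X. d n x y < e \<longrightarrow> y \<in> U"
  shows "metrizable_space X"
proof -
  define h where "h n x y = (1/2)^n * d n x y" for n x y
  have dp: "pseudometric (d n)" for n using d by (simp add: continuous_pseudometric_def)
  have hp: "pseudometric (h n)" for n
    using dp[of n] unfolding pseudometric_def h_def
    by (auto simp: mult_le_one power_le_one simp flip: distrib_left intro!: mult_left_mono)
  define D where "D x y = (SUP n. h n x y)" for x y
  have Dp: "pseudometric D" unfolding D_def by (intro pseudometric_SUP hp)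
  have hD: "h n x y \<le> D x y" for n x y unfolding D_def by (intro pseudometric_SUP hp)
  have base': "\<exists>r>0. \<forall>y\<in>topspace X. D x y < r \<longrightarrow> y \<in> U" if U: "openin X U" "x \<in> U" for x U
  proof -
    obtain n e where e: "e > 0" "\<forall>y\<in>topspace X. d n x y < e \<longrightarrow> y \<in> U" using base[OF U] by blast
    have "y \<in> U" if "y \<in> topspace X" "D x y < (1/2)^n * e" for y
    proof -
      have "(1/2)^n * d n x y < (1/2)^n * e" using hD[of n x y] that unfolding h_def by linarith
      then have "d n x y < e" by (rule mult_left_less_imp_less) simp
      then show ?thesis using e that by blast
    qed
    then show ?thesis using e(1) by (intro exI[of _ "(1/2)^n * e"]) auto
  qed
  have nbhd: "\<exists>O'. openin X O' \<and> x \<in> O' \<and> (\<forall>y\<in>O'. D x y < e)" if x: "x \<in> topspace X" "0 < e" for x e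
  proof -
    obtain N where N: "(1/2::real)^N < e/2" using x(2) using real_arch_pow_inv[of "e/2" "1/2"] by auto 
    have "\<forall>n. \<exists>O'. openin X O' \<and> x \<in> O' \<and> (\<forall>y\<in>O'. d n x y < e/2)"
      using d x(1) half_gt_zero[OF x(2)] unfolding continuous_pseudometric_def by blast
    then obtain Oh where Oh: "\<And>n. openin X (Oh n)" "\<And>n. x \<in> Oh n" "\<And>n y. y \<in> Oh n \<Longrightarrow> d n x y < e/2"
      by metis
    define O' where "O' = (\<Inter>n\<in>{..N}. Oh n)"
    have "openin X O'" unfolding O'_def using Oh by (intro openin_INT2) auto
    moreover have "x \<in> O'" using Oh by (auto simp: O'_def)
    moreover have "D x y < e" if y: "y \<in> O'" for y
    proof -
      have "h n x y \<le> e/2" for n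
      proof (cases "n \<le> N")
        case True
        then have "d n x y < e/2" using y Oh(3)[of y n] by (auto simp: O'_def)
        moreover have "(1/2)^n * d n x y \<le> 1 * d n x y"
          using dp[of n] by (intro mult_right_mono) (auto simp: pseudometric_def power_le_one)
        ultimately show ?thesis by (simp add: h_def)
      next
        case False
        have "(1/2)^n * d n x y \<le> (1/2)^n * 1"
          using dp[of n] by (intro mult_left_mono) (auto simp: pseudometric_def)
        also have "\<dots> \<le> (1/2)^N" using False by (simp add: power_decreasing)
        finally show ?thesis using N by (simp add: h_def)
      qed
      then have "D x y \<le> e/2" unfolding D_def by (intro cSUP_least) auto
      then show ?thesis using x(2) by simp
    qed
    ultimately show ?thesis by blast
  qed
  interpret M: Metric_space "topspace X" D
  proof
    fix x y assume xy: "x \<in> topspace X" "y \<in> topspace X"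
    have "x = y" if "D x y = 0"
    proof (rule ccontr)
      assume "x \<noteq> y"
      have "openin X (topspace X - {y})"
        using t1 xy by (metis closedin_def t1_space_closedin_singleton)
      then obtain r where "r > 0" "\<forall>z\<in>topspace X. D x z < r \<longrightarrow> z \<in> topspace X - {y}"
        using base'[of "topspace X - {y}" x] xy \<open>x \<noteq> y\<close> by blast
      then show False using that xy by force
    qed
    then show "D x y = 0 \<longleftrightarrow> x = y" using Dp by (auto simp: pseudometric_def)
  qed (use Dp in \<open>auto simp: pseudometric_def\<close>)
  have "openin X U \<longleftrightarrow> openin M.mtopology U" for U
  proof
    assume U: "openin X U"
    show "openin M.mtopology U"
      unfolding M.openin_mtopology
    proof (intro conjI allI impI)
      show "U \<subseteq> topspace X" using U by (rule openin_subset)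
      fix x assume "x \<in> U"
      then obtain r where "r > 0" "\<forall>y\<in>topspace X. D x y < r \<longrightarrow> y \<in> U" using base' U by metis
      then show "\<exists>r>0. M.mball x r \<subseteq> U" by (intro exI[of _ r]) auto
    qed
  next
    assume U: "openin M.mtopology U"
    show "openin X U"
    proof (subst openin_subopen, intro ballI)
      fix x assume x: "x \<in> U"
      obtain r where r: "r > 0" "M.mball x r \<subseteq> U" using U x unfolding M.openin_mtopology by metis
      have xX: "x \<in> topspace X" using U x unfolding M.openin_mtopology by blast
      obtain O' where O': "openin X O'" "x \<in> O'" "\<forall>y\<in>O'. D x y < r" using nbhd[OF xX r(1)] by metis
      have "O' \<subseteq> M.mball x r" using O' xX openin_subset[OF O'(1)] by auto
      then have "O' \<subseteq> U" using r(2) by blast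
      then show "\<exists>T. openin X T \<and> x \<in> T \<and> T \<subseteq> U" using O' by blast
    qed
  qed
  then have "X = M.mtopology" by (simp add: topology_eq)
  then show ?thesis unfolding metrizable_space_def using M.Metric_space_axioms by blast
qed

section \<open>Sequences in Frechet-Urysohn spaces\<close>

lemma limitin_subseq_const:
  assumes "c \<in> topspace X" "infinite {j. u j = c}"
  shows "\<exists>r::nat\<Rightarrow>nat. strict_mono r \<and> limitin X (u \<circ> r) c sequentially"
proof -
  obtain r :: "nat \<Rightarrow> nat" where "strict_mono r" "\<forall>n. r n \<in> {j. u j = c}"
    using infinite_enumerate[OF assms(2)] by blast
  moreover from this have "u \<circ> r = (\<lambda>_. c)" by auto
  ultimately show ?thesis using assms by auto
qed

lemma strict_mono_subseq_finite_fibres: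
  fixes k :: "nat \<Rightarrow> nat"
  assumes "\<And>j. finite {i. k i = j}"
  obtains s :: "nat \<Rightarrow> nat" where "strict_mono s" "strict_mono (k \<circ> s)"
proof -
  have "\<exists>i'. k i < k i' \<and> i < i'" for i
  proof -
    have "finite ({..i} \<union> (\<Union>j\<le>k i. {i. k i = j}))" using assms by blast
    then obtain i' where "i' \<notin> {..i} \<union> (\<Union>j\<le>k i. {i. k i = j})"
      using infinite_UNIV_nat by (metis ex_new_if_finite)
    then show ?thesis by (intro exI[of _ i']) auto
  qed
  then obtain g where g: "\<And>i. k i < k (g i) \<and> i < g i" by metis
  define s where "s n = (g ^^ n) 0" for n
  have "s n < s (Suc n)" "k (s n) < k (s (Suc n))" for n using g by (auto simp: s_def)
  then have "strict_mono s" "strict_mono (k \<circ> s)" by (auto simp: strict_mono_Suc_iff)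
  then show thesis by (rule that)
qed

text \<open>If every neighbourhood of \<open>z\<close> contained infinitely many terms,
  \<open>z\<close> would be in the closure of the values other than \<open>z\<close>, since the
  value \<open>z\<close> itself is taken finitely often. A sequence of such values converges to
  \<open>z\<close>; in a T1 space it repeats each of them only finitely often, so its indices can be
  thinned to a strictly increasing sequence.\<close>

lemma frechet_urysohn_locally_finite:
  fixes u :: "nat \<Rightarrow> 'a"
  assumes FU: "frechet_urysohn_space X" and t1: "t1_space X"
    and u: "range u \<subseteq> topspace X"
    and no: "\<And>r z. strict_mono r \<Longrightarrow> \<not> limitin X (u \<circ> r) z sequentially"
    and z: "z \<in> topspace X"
  shows "\<exists>O'. openin X O' \<and> z \<in> O' \<and> finite {j. u j \<in> O'}"
proof (rule ccontr)
  assume *: "\<not> ?thesis"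
  define A where "A = range u - {z}"
  have "z \<in> X closure_of A"
    unfolding in_closure_of
  proof (intro conjI allI impI z)
    fix T assume T: "z \<in> T \<and> openin X T"
    have "finite {j. u j = z}" using no limitin_subseq_const[OF z, of u] by blast
    moreover have "infinite {j. u j \<in> T}" using * T by blast
    ultimately have "infinite ({j. u j \<in> T} - {j. u j = z})" by simp
    then have "{j. u j \<in> T} - {j. u j = z} \<noteq> {}" by (intro notI) simp
    then obtain j where "u j \<in> T" "u j \<noteq> z" by blast
    then show "\<exists>y. y \<in> A \<and> y \<in> T" unfolding A_def by blast
  qed
  moreover have "A \<subseteq> topspace X" using u by (auto simp: A_def)
  ultimately obtain \<sigma> where \<sigma>: "range \<sigma> \<subseteq> A" "limitin X \<sigma> z sequentially"
    using FU unfolding frechet_urysohn_space_def by metis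
  then have "\<forall>i. \<exists>k. \<sigma> i = u k" unfolding A_def by blast
  then obtain k where k: "\<And>i. \<sigma> i = u (k i)" by metis
  have "finite {i. k i = j}" for j
  proof (cases "u j = z")
    case True
    then have "{i. k i = j} = {}" using \<sigma>(1) k unfolding A_def by (auto simp: image_subset_iff)
    then show ?thesis by simp
  next
    case False
    have "openin X (topspace X - {u j})" 
      using t1 by (metis Diff_empty Diff_insert0 closedin_def openin_topspace t1_space_closedin_singleton)
    then have "\<forall>\<^sub>F i in sequentially. \<sigma> i \<in> topspace X - {u j}"
      using \<sigma>(2) z False by (intro limitinD) auto
    then obtain N where "\<And>i. i \<ge> N \<Longrightarrow> \<sigma> i \<noteq> u j" by (auto simp: eventually_sequentially)
    then have "i < N" if "k i = j" for i using that k[of i] by (cases "i \<ge> N") auto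
    then have "{i. k i = j} \<subseteq> {..<N}" by blast
    then show ?thesis using finite_subset by blast
  qed
  then obtain s :: "nat \<Rightarrow> nat" where s: "strict_mono s" "strict_mono (k \<circ> s)" by (rule strict_mono_subseq_finite_fibres)
  have "\<sigma> \<circ> s = u \<circ> (k \<circ> s)" using k by auto
  then have "limitin X (u \<circ> (k \<circ> s)) z sequentially" using limitin_subsequence[OF s(1) \<sigma>(2)] by simp
  then show False using no s(2) by blast
qed

lemma limitin_in_closure:
  assumes "limitin X f l sequentially" "\<And>n. f n \<in> S"
  shows "l \<in> X closure_of S"
  unfolding in_closure_of
proof (intro conjI allI impI)
  show "l \<in> topspace X" using assms(1) by (rule limitin_topspace)
  fix T assume "l \<in> T \<and> openin X T"
  then have "\<forall>\<^sub>F n in sequentially. f n \<in> T" using limitinD[OF assms(1)] by blast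
  then show "\<exists>y. y \<in> S \<and> y \<in> T" using assms(2) by (metis eventually_sequentially order_refl)
qed

lemma frechet_urysohn_closedin:
  assumes "frechet_urysohn_space X" "F \<subseteq> topspace X"
    and seq: "\<And>\<sigma> z. \<lbrakk>\<And>n::nat. \<sigma> n \<in> F; limitin X \<sigma> z sequentially\<rbrakk> \<Longrightarrow> z \<in> F"
  shows "closedin X F"
proof -
  have "X closure_of F \<subseteq> F"
  proof
    fix x assume "x \<in> X closure_of F"
    then obtain \<sigma> where "range \<sigma> \<subseteq> F" "limitin X \<sigma> x sequentially"
      using assms(1,2) unfolding frechet_urysohn_space_def by metis
    then show "x \<in> F" using seq[of \<sigma> x] by blast
  qed
  then show ?thesis using assms(2) closure_of_subset_eq by blast
qed

lemma frechet_urysohn_not_interior: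
  assumes "frechet_urysohn_space X" "x \<in> topspace X" "\<And>U. \<lbrakk>openin X U; x \<in> U\<rbrakk> \<Longrightarrow> \<not> U \<subseteq> A"
  obtains \<sigma> :: "nat \<Rightarrow> 'a" where "\<And>n. \<sigma> n \<in> topspace X - A" "limitin X \<sigma> x sequentially"
proof -
  have "x \<in> X closure_of (topspace X - A)"
    unfolding in_closure_of
  proof (intro conjI allI impI assms(2))
    fix T assume "x \<in> T \<and> openin X T"
    then have "\<not> T \<subseteq> A" "T \<subseteq> topspace X" using assms(3) openin_subset by auto
    then show "\<exists>y. y \<in> topspace X - A \<and> y \<in> T" by blast
  qed
  then obtain \<sigma> :: "nat \<Rightarrow> 'a" where "range \<sigma> \<subseteq> topspace X - A" "limitin X \<sigma> x sequentially"
    using assms(1) unfolding frechet_urysohn_space_def by (metis Diff_subset)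
  then show thesis using that[of \<sigma>] by blast
qed

section \<open>Relative sequential compactness\<close>

definition seq_precompact :: "'a topology \<Rightarrow> 'a set \<Rightarrow> bool" where
  "seq_precompact X P \<longleftrightarrow> (\<forall>u::nat \<Rightarrow> 'a. (\<forall>n. u n \<in> P) \<longrightarrow>
     (\<exists>r z. strict_mono r \<and> limitin X (u \<circ> r) z sequentially))"

context stratified
begin

text \<open>Each point \<open>x n\<close> of the closure is replaced by a point of \<open>P\<close>
  in \<open>nb n (x n)\<close>; a convergent subsequence of the replacements carries the original
  points with it.\<close>

lemma seq_precompact_closure:
  assumes "seq_precompact X P"
  shows "seq_precompact X (X closure_of P)"
  unfolding seq_precompact_def
proof (intro allI impI)
  fix x :: "nat \<Rightarrow> 'a" assume x: "\<forall>n. x n \<in> X closure_of P"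
  have "\<exists>y. y \<in> P \<and> y \<in> nb n (x n)" for n
  proof -
    have "x n \<in> topspace X" using x in_closure_of by metis
    then have "x n \<in> nb n (x n)" by (rule nb_self)
    then show ?thesis using x nb_open unfolding in_closure_of by metis
  qed
  then obtain y where y: "\<And>n. y n \<in> P" "\<And>n. y n \<in> nb n (x n)" by metis
  then obtain r z where r: "strict_mono r" "limitin X (y \<circ> r) z sequentially"
    using assms unfolding seq_precompact_def by metis
  have "limitin X (x \<circ> r) z sequentially"
    by (rule limitin_nb_centres[OF r(2) filterlim_subseq[OF r(1)]]) (simp add: y)
  then show "\<exists>r z. strict_mono r \<and> limitin X (x \<circ> r) z sequentially" using r by blast
qed

text \<open>Only finitely many sets of one discrete layer can meet \<open>C\<close>, because points
  from different sets of a layer have no convergent subsequence. Countably many layers thus leave a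
  countable subcover, which sequential compactness reduces to a finite one.\<close>

lemma seq_precompact_imp_compactin:
  assumes sp: "seq_precompact X C" and cl: "closedin X C"
  shows "compactin X C"
  unfolding compactin_def
proof (intro conjI allI impI, goal_cases)
  case 1
  show ?case using cl closedin_subset by blast
next
  case (2 \<U>)
  \<comment> \<open>\<open>None\<close> indexes the complement of \<open>C\<close>, which completes
    the given family to a cover of the whole space.\<close>
  define U where "U i = (case i of None \<Rightarrow> topspace X - C | Some V \<Rightarrow> if V \<in> \<U> then V else {})" for i
  have oU: "openin X (U i)" for i
    using 2 cl by (auto simp: U_def split: option.split)
  have cU: "topspace X \<subseteq> (\<Union>i. U i)"
  proof
    fix x assume x: "x \<in> topspace X"
    show "x \<in> (\<Union>i. U i)"
    proof (cases "x \<in> C")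
      case True
      then obtain V where "V \<in> \<U>" "x \<in> V" using 2 by blast
      then have "x \<in> U (Some V)" by (simp add: U_def)
      then show ?thesis by blast
    next
      case False
      then have "x \<in> U None" using x by (simp add: U_def)
      then show ?thesis by blast
    qed
  qed
  obtain H where H: "\<And>x. x \<in> topspace X \<Longrightarrow> \<exists>n i. x \<in> H n i" "\<And>n i. H n i \<subseteq> U i"
    "\<And>n x. x \<in> topspace X \<Longrightarrow> \<exists>O' i. openin X O' \<and> x \<in> O' \<and> x \<in> U i \<and> (\<forall>j. j \<noteq> i \<longrightarrow> O' \<inter> H (n::nat) j = {})"
    using layers[OF oU cU] by metis
  define B where "B n = {i. H n i \<inter> C \<noteq> {}}" for n
  have finB: "finite (B n)" for n
  proof (rule ccontr)
    assume "infinite (B n)"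
    then obtain g :: "nat \<Rightarrow> 'a set option" where g: "inj g" "range g \<subseteq> B n"
      using infinite_countable_subset by blast
    then have "\<forall>j. \<exists>x. x \<in> H n (g j) \<inter> C" unfolding B_def by blast
    then obtain u where u: "\<And>j. u j \<in> H n (g j)" "\<And>j. u j \<in> C" by (metis IntE)
    then obtain r z where r: "strict_mono r" "limitin X (u \<circ> r) z sequentially"
      using sp unfolding seq_precompact_def by metis
    have "z \<in> topspace X" using r(2) by (rule limitin_topspace)
    then obtain O' i where O': "openin X O'" "z \<in> O'" "\<forall>j. j \<noteq> i \<longrightarrow> O' \<inter> H n j = {}" using H(3) by metis
    have "\<forall>\<^sub>F j in sequentially. (u \<circ> r) j \<in> O'" using limitinD[OF r(2) O'(1,2)] .
    then obtain N where N: "\<And>j. j \<ge> N \<Longrightarrow> u (r j) \<in> O'" by (auto simp: eventually_sequentially)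
    have "g (r j) = i" if "j \<ge> N" for j using N[OF that] u(1)[of "r j"] O'(3) by blast
    then have "g (r N) = g (r (Suc N))" by simp
    then have "r N = r (Suc N)" using g(1) by (simp add: inj_eq)
    then show False using r(1) by (metis lessI less_irrefl strict_mono_less)
  qed
  define \<V> where "\<V> = {V \<in> \<U>. Some V \<in> (\<Union>n. B n)}"
  have cV: "countable \<V>"
  proof -
    have "countable (\<Union>n. B n)" using finB by (simp add: countable_finite)
    moreover have "Some ` \<V> \<subseteq> (\<Union>n. B n)" unfolding \<V>_def by blast
    ultimately have "countable (Some ` \<V>)" by (rule countable_subset[rotated])
    then show ?thesis by (rule countable_image_inj_on) auto
  qed
  have covV: "C \<subseteq> \<Union>\<V>"
  proof
    fix x assume x: "x \<in> C"
    then obtain n i where i: "x \<in> H n i" using H(1) closedin_subset[OF cl] by blast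
    then have "x \<in> U i" using H(2) by blast
    then obtain V where V: "i = Some V" "V \<in> \<U>" "x \<in> V"
      using x by (auto simp: U_def split: option.splits if_splits)
    have "i \<in> B n" using i x unfolding B_def by blast
    then have "V \<in> \<V>" using V unfolding \<V>_def by blast
    then show "x \<in> \<Union>\<V>" using V by blast
  qed
  show ?case
  proof (cases "\<V> = {}")
    case True
    then show ?thesis using covV by (intro exI[of _ "{}"]) auto
  next
    case False
    define b where "b = from_nat_into \<V>"
    have b: "b n \<in> \<V>" for n using False by (simp add: b_def from_nat_into)
    have rb: "range b = \<V>" unfolding b_def using False cV by (rule range_from_nat_into)
    have "\<exists>n. C \<subseteq> (\<Union>i<n. b i)"
    proof (rule ccontr)
      assume "\<nexists>n. C \<subseteq> (\<Union>i<n. b i)"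
      then have "\<forall>n. \<exists>x. x \<in> C \<and> x \<notin> (\<Union>i<n. b i)" by blast
      then obtain x where x: "\<And>n. x n \<in> C" "\<And>n. x n \<notin> (\<Union>i<n. b i)" by metis
      then obtain r z where r: "strict_mono r" "limitin X (x \<circ> r) z sequentially"
        using sp unfolding seq_precompact_def by metis
      have "z \<in> C" by (rule limitin_closedin[OF r(2) cl]) (use x in auto)
      then obtain k where k: "z \<in> b k" using covV rb by blast
      have "openin X (b k)" using b[of k] 2 by (simp add: \<V>_def)
      then have "\<forall>\<^sub>F j in sequentially. (x \<circ> r) j \<in> b k" using limitinD[OF r(2)] k by blast
      then obtain N where N: "\<And>j. j \<ge> N \<Longrightarrow> x (r j) \<in> b k" by (auto simp: eventually_sequentially)
      have "x (r (max N (Suc k))) \<in> b k" using N by simp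
      moreover have "k < r (max N (Suc k))"
        using seq_suble[OF r(1), of "max N (Suc k)"] by simp
      ultimately show False using x(2)[of "r (max N (Suc k))"] by blast
    qed
    then obtain n where "C \<subseteq> (\<Union>i<n. b i)" by blast
    then have "finite (b ` {..<n}) \<and> b ` {..<n} \<subseteq> \<U> \<and> C \<subseteq> \<Union>(b ` {..<n})"
      using b unfolding \<V>_def by blast
    then show ?thesis by blast
  qed
qed

text \<open>The dense set consists of finite nets with respect to \<open>nb n\<close> for all
  \<open>n\<close>: if \<open>x\<close> lies in \<open>nb n (y n)\<close> for each \<open>n\<close>,
  the centres \<open>y n\<close> converge to \<open>x\<close>.\<close>

lemma compactin_separable:
  assumes K: "compactin X K"
  obtains D where "countable D" "D \<subseteq> K" "K \<subseteq> X closure_of D"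
proof -
  have KX: "K \<subseteq> topspace X" using K by (rule compactin_subset_topspace)
  have "\<exists>F. finite F \<and> F \<subseteq> K \<and> K \<subseteq> (\<Union>x\<in>F. nb n x)" for n
  proof -
    have "\<exists>\<F>. finite \<F> \<and> \<F> \<subseteq> nb n ` K \<and> K \<subseteq> \<Union>\<F>"
      using K by (rule compactinD) (use nb_self KX in auto)
    then show ?thesis by (metis finite_subset_image)
  qed
  then obtain F where F: "\<And>n. finite (F n)" "\<And>n. F n \<subseteq> K" "\<And>n. K \<subseteq> (\<Union>x\<in>F n. nb n x)" by metis
  define D where "D = (\<Union>n. F n)"
  have "x \<in> X closure_of D" if x: "x \<in> K" for x
  proof -
    have "\<forall>n. \<exists>y. y \<in> F n \<and> x \<in> nb n y" using F(3) x by blast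
    then obtain y where y: "\<And>n. y n \<in> F n" "\<And>n. x \<in> nb n (y n)" by metis
    have "limitin X (\<lambda>_. x) x sequentially" using x KX by auto
    then have "limitin X y x sequentially"
      by (rule limitin_nb_centres[where k = "\<lambda>n. n"]) (auto simp: y filterlim_ident)
    then show ?thesis by (rule limitin_in_closure) (use y D_def in auto)
  qed
  then show thesis using F by (intro that[of D]) (auto simp: D_def countable_finite)
qed

end

section \<open>Point-countable families and metrizability\<close>

definition minimal_interior_cover :: "'a topology \<Rightarrow> 'a set set \<Rightarrow> 'a set \<Rightarrow> bool" where
  "minimal_interior_cover X F E \<longleftrightarrow> finite F \<and> E \<subseteq> X interior_of \<Union>F \<and>
     (\<forall>R. R \<subset> F \<longrightarrow> \<not> E \<subseteq> X interior_of \<Union>R)"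

lemma minimal_interior_cover_exists:
  assumes "finite F" "E \<subseteq> X interior_of \<Union>F"
  obtains F' where "F' \<subseteq> F" "minimal_interior_cover X F' E"
proof -
  have "\<exists>F'\<subseteq>F. minimal_interior_cover X F' E"
    using assms
  proof (induction F rule: finite_psubset_induct)
    case (psubset F)
    show ?case
    proof (cases "minimal_interior_cover X F E")
      case True then show ?thesis by blast
    next
      case False
      then obtain R where R: "R \<subset> F" "E \<subseteq> X interior_of \<Union>R"
        using psubset unfolding minimal_interior_cover_def by blast
      then show ?thesis using psubset.IH[OF R] by blast
    qed
  qed
  then show thesis using that by blast
qed

lemma point_countable_meets_countable:
  assumes "point_countable X P" "countable A" "A \<subseteq> topspace X"
  shows "countable {Q \<in> P. Q \<inter> A \<noteq> {}}"
proof -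
  have "{Q \<in> P. Q \<inter> A \<noteq> {}} = (\<Union>x\<in>A. {Q \<in> P. x \<in> Q})" by blast
  also have "countable \<dots>"
    by (intro countable_UN) (use assms in \<open>auto simp: point_countable_def\<close>)
  finally show ?thesis .
qed

text \<open>Mishchenko's argument, by induction on the number of members still missing from
  \<open>R\<close>. If \<open>\<Union>R\<close> is not a neighbourhood of some \<open>z\<close> in
  \<open>E\<close>, a sequence outside \<open>\<Union>R\<close> converges to \<open>z\<close>. Each
  cover extending \<open>R\<close> contains a member that meets this sequence, and
  point-countability leaves only countably many candidates.\<close>

lemma countable_minimal_interior_covers:
  assumes FU: "frechet_urysohn_space X" and P: "point_countable X P" and E: "E \<subseteq> topspace X"
  shows "countable {F. F \<subseteq> P \<and> minimal_interior_cover X F E}"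
proof -
  have claim: "countable {F. F \<subseteq> P \<and> R \<subseteq> F \<and> card (F - R) = k \<and> minimal_interior_cover X F E}" for R k
  proof (induction k arbitrary: R)
    case 0
    have "{F. F \<subseteq> P \<and> R \<subseteq> F \<and> card (F - R) = 0 \<and> minimal_interior_cover X F E} \<subseteq> {R}"
      by (auto simp: minimal_interior_cover_def)
    then show ?case by (rule countable_subset) simp
  next
    case (Suc k)
    let ?S = "{F. F \<subseteq> P \<and> R \<subseteq> F \<and> card (F - R) = Suc k \<and> minimal_interior_cover X F E}"
    show ?case
    proof (cases "E \<subseteq> X interior_of \<Union>R")
      case True
      have "F \<notin> ?S" for F
      proof
        assume "F \<in> ?S"
        then have "R \<subset> F" "\<forall>R. R \<subset> F \<longrightarrow> \<not> E \<subseteq> X interior_of \<Union>R"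
          by (auto simp: minimal_interior_cover_def)
        then show False using True by blast
      qed
      then have "?S = {}" by blast
      then show ?thesis by (metis countable_empty)
    next
      case False
      then obtain z where z: "z \<in> E" "z \<notin> X interior_of \<Union>R" by blast
      have zX: "z \<in> topspace X" using z E by blast
      have nR: "\<not> U \<subseteq> \<Union>R" if "openin X U" "z \<in> U" for U
        using z(2) that interior_of_maximal[of U "\<Union>R" X] by blast
      obtain \<sigma> :: "nat \<Rightarrow> 'a" where \<sigma>: "\<And>n. \<sigma> n \<in> topspace X - \<Union>R" "limitin X \<sigma> z sequentially"
        using frechet_urysohn_not_interior[OF FU zX nR] by blast
      define S where "S = {Q \<in> P. Q \<inter> range \<sigma> \<noteq> {}}"
      have "countable S" unfolding S_def
        by (rule point_countable_meets_countable[OF P]) (use \<sigma>(1) in auto)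
      then have "countable (\<Union>Q\<in>S. {F. F \<subseteq> P \<and> insert Q R \<subseteq> F \<and> card (F - insert Q R) = k \<and> minimal_interior_cover X F E})"
        using Suc by blast
      moreover have "?S \<subseteq> (\<Union>Q\<in>S. {F. F \<subseteq> P \<and> insert Q R \<subseteq> F \<and> card (F - insert Q R) = k \<and> minimal_interior_cover X F E})"
      proof
        fix F assume F: "F \<in> ?S"
        then have "z \<in> X interior_of \<Union>F" using z by (auto simp: minimal_interior_cover_def)
        then have "\<forall>\<^sub>F n in sequentially. \<sigma> n \<in> X interior_of \<Union>F"
          using limitinD[OF \<sigma>(2) openin_interior_of] by blast
        then obtain n where "\<sigma> n \<in> \<Union>F"
          by (metis eventually_sequentially interior_of_subset order_refl subsetD)
        then obtain Q where Q: "Q \<in> F" "\<sigma> n \<in> Q" by blast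
        have QR: "Q \<notin> R" using \<sigma>(1)[of n] Q by blast
        have fin: "finite F" using F by (simp add: minimal_interior_cover_def)
        have "F - insert Q R = (F - R) - {Q}" by blast
        then have "card (F - insert Q R) = k" using F Q QR fin by simp
        moreover have "Q \<in> S" unfolding S_def using Q F by blast
        ultimately show "F \<in> (\<Union>Q\<in>S. {F. F \<subseteq> P \<and> insert Q R \<subseteq> F \<and> card (F - insert Q R) = k \<and> minimal_interior_cover X F E})"
          using F Q by blast
      qed
      ultimately show ?thesis by (rule countable_subset[rotated])
    qed
  qed
  have "{F. F \<subseteq> P \<and> minimal_interior_cover X F E} =
      (\<Union>k. {F. F \<subseteq> P \<and> {} \<subseteq> F \<and> card (F - {}) = k \<and> minimal_interior_cover X F E})"
    by auto
  then show ?thesis using claim[of "{}"] by auto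
qed

text \<open>The enlarged sets contain every point that they help to cover minimally; a base is later
  built from finite interior covers of a point by sets that contain it.\<close>

definition star :: "'a topology \<Rightarrow> 'a set set \<Rightarrow> 'a set \<Rightarrow> 'a set" where
  "star X P Q = Q \<union> {x \<in> topspace X. \<exists>F. F \<subseteq> P \<and> minimal_interior_cover X F {x} \<and> Q \<in> F}"

text \<open>A member whose closure misses \<open>x\<close> could be dropped from the cover: off that
  closure the remaining members still cover an open neighbourhood of \<open>x\<close>, against
  minimality.\<close>

lemma star_subset_closure:
  assumes "\<Union>P \<subseteq> topspace X" "Q \<in> P"
  shows "star X P Q \<subseteq> X closure_of Q"
proof
  fix x assume "x \<in> star X P Q"
  then consider "x \<in> Q" | F where "x \<in> topspace X" "F \<subseteq> P" "minimal_interior_cover X F {x}" "Q \<in> F"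
    unfolding star_def by blast
  then show "x \<in> X closure_of Q"
  proof cases
    case 1
    then show ?thesis using assms by (meson Sup_upper closure_of_subset order_trans subsetD)
  next
    case 2
    show ?thesis
    proof (rule ccontr)
      assume x: "x \<notin> X closure_of Q"
      have QX: "Q \<subseteq> X closure_of Q" using assms by (meson Sup_upper closure_of_subset order_trans)
      have "X interior_of \<Union>F - X closure_of Q \<subseteq> \<Union>(F - {Q})"
        using interior_of_subset[of X "\<Union>F"] QX by blast
      moreover have "openin X (X interior_of \<Union>F - X closure_of Q)" by (simp add: openin_diff)
      ultimately have "X interior_of \<Union>F - X closure_of Q \<subseteq> X interior_of \<Union>(F - {Q})"
        by (rule interior_of_maximal)
      moreover have "x \<in> X interior_of \<Union>F" using 2(3) by (simp add: minimal_interior_cover_def)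
      ultimately have "{x} \<subseteq> X interior_of \<Union>(F - {Q})" using x by blast
      moreover have "F - {Q} \<subset> F" using 2(4) by blast
      ultimately show False using 2(3) unfolding minimal_interior_cover_def by blast
    qed
  qed
qed

definition interior_network :: "'a topology \<Rightarrow> 'a set set \<Rightarrow> bool" where
  "interior_network X P \<longleftrightarrow> (\<forall>U x. openin X U \<and> x \<in> U \<longrightarrow>
     (\<exists>F\<subseteq>P. finite F \<and> x \<in> X interior_of \<Union>F \<and> \<Union>F \<subseteq> U))"

lemma point_countable_star:
  assumes FU: "frechet_urysohn_space X" and P: "point_countable X P"
  shows "point_countable X (star X P ` P)"
  unfolding point_countable_def
proof
  fix x assume x: "x \<in> topspace X"
  let ?C = "{Q \<in> P. x \<in> Q} \<union> (\<Union>F\<in>{F. F \<subseteq> P \<and> minimal_interior_cover X F {x}}. F)"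
  have "countable ?C"
  proof (intro countable_Un countable_UN)
    show "countable {Q \<in> P. x \<in> Q}" using P x by (auto simp: point_countable_def)
    show "countable {F. F \<subseteq> P \<and> minimal_interior_cover X F {x}}"
      using countable_minimal_interior_covers[OF FU P] x by simp
  qed (auto simp: minimal_interior_cover_def countable_finite)
  moreover have "{Q \<in> star X P ` P. x \<in> Q} \<subseteq> star X P ` ?C"
    by (auto simp: star_def)
  ultimately show "countable {Q \<in> star X P ` P. x \<in> Q}"
    by (metis (lifting) countable_image countable_subset)
qed

section \<open>Point-countable bases and developments\<close>

context stratified
begin

text \<open>The base set of a family \<open>F\<close> is the interior of the union of those members
  of \<open>P'\<close> that \<open>F\<close> covers minimally. A point of it lies in one of these
  members, for which there are countably many choices, and each member has only countably many
  minimal covers; so the base is point-countable.\<close>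

lemma point_countable_base_exists:
  assumes FU: "frechet_urysohn_space X" and P: "point_countable X P" and PX: "\<Union>P \<subseteq> topspace X"
    and net: "interior_network X P"
  obtains \<B> where "\<And>B. B \<in> \<B> \<Longrightarrow> openin X B" "point_countable X \<B>"
    "\<And>U x. openin X U \<Longrightarrow> x \<in> U \<Longrightarrow> \<exists>B\<in>\<B>. x \<in> B \<and> B \<subseteq> U"
proof -
  define P' where "P' = star X P ` P"
  have pc': "point_countable X P'" unfolding P'_def by (rule point_countable_star[OF FU P])
  have P'X: "Q \<subseteq> topspace X" if "Q \<in> P'" for Q
    using that PX unfolding P'_def star_def by blast
  have strong: "\<exists>F\<subseteq>P'. minimal_interior_cover X F {x} \<and> \<Union>F \<subseteq> U \<and> (\<forall>Q\<in>F. x \<in> Q)"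
    if Ux: "openin X U" "x \<in> U" for U x
  proof -
    have xX: "x \<in> topspace X" using Ux openin_subset by blast
    \<comment> \<open>Enlarging \<open>Q\<close> to \<open>star X P Q\<close> may leave
      \<open>V\<close>, but not its closure.\<close>
    obtain V where V: "openin X V" "x \<in> V" "X closure_of V \<subseteq> U" using shrink[OF Ux] by metis
    obtain F1 where F1: "F1 \<subseteq> P" "finite F1" "x \<in> X interior_of \<Union>F1" "\<Union>F1 \<subseteq> V"
      using net V unfolding interior_network_def by metis
    obtain F where F: "F \<subseteq> F1" "minimal_interior_cover X F {x}"
      using minimal_interior_cover_exists[of F1 "{x}" X] F1 by auto
    have FP: "F \<subseteq> P" using F F1 by blast
    have 1: "star X P Q \<subseteq> U" if "Q \<in> F" for Q
    proof -
      have "star X P Q \<subseteq> X closure_of Q" using star_subset_closure[OF PX] that FP by blast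
      also have "\<dots> \<subseteq> X closure_of V" by (rule closure_of_mono) (use that F F1 in blast)
      finally show ?thesis using V by blast
    qed
    have 2: "x \<in> star X P Q" if "Q \<in> F" for Q using that F FP xX unfolding star_def by blast
    have "x \<in> X interior_of \<Union>F" using F(2) by (simp add: minimal_interior_cover_def)
    moreover have "\<Union>F \<subseteq> \<Union>(star X P ` F)" unfolding star_def by blast
    ultimately have "{x} \<subseteq> X interior_of \<Union>(star X P ` F)" using interior_of_mono by blast
    moreover have "finite (star X P ` F)" using F(2) by (simp add: minimal_interior_cover_def)
    ultimately obtain F' where F': "F' \<subseteq> star X P ` F" "minimal_interior_cover X F' {x}"
      using minimal_interior_cover_exists by metis
    have "F' \<subseteq> P'" using F' FP unfolding P'_def by blast
    moreover have "\<Union>F' \<subseteq> U" using F' 1 by blast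
    moreover have "\<forall>Q\<in>F'. x \<in> Q" using F' 2 by blast
    ultimately show ?thesis using F' by blast
  qed
  define B where "B F = X interior_of \<Union>{E \<in> P'. minimal_interior_cover X F E}" for F
  show thesis
  proof (rule that[of "B ` {F. F \<subseteq> P'}"])
    show "openin X W" if "W \<in> B ` {F. F \<subseteq> P'}" for W using that by (auto simp: B_def)
    show "point_countable X (B ` {F. F \<subseteq> P'})"
      unfolding point_countable_def
    proof
      fix x assume x: "x \<in> topspace X"
      let ?C = "\<Union>E\<in>{E\<in>P'. x \<in> E}. {F. F \<subseteq> P' \<and> minimal_interior_cover X F E}"
      have "countable ?C"
        using pc' x countable_minimal_interior_covers[OF FU pc' P'X] by (auto simp: point_countable_def)
      moreover have "{W \<in> B ` {F. F \<subseteq> P'}. x \<in> W} \<subseteq> B ` ?C"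
      proof
        fix W assume "W \<in> {W \<in> B ` {F. F \<subseteq> P'}. x \<in> W}"
        then obtain F where F: "F \<subseteq> P'" "W = B F" "x \<in> B F" by blast
        then have "x \<in> \<Union>{E \<in> P'. minimal_interior_cover X F E}"
          unfolding B_def using interior_of_subset by fast
        then show "W \<in> B ` ?C" using F by blast
      qed
      ultimately show "countable {W \<in> B ` {F. F \<subseteq> P'}. x \<in> W}"
        by (metis (lifting) countable_image countable_subset)
    qed
    show "\<exists>W\<in>B ` {F. F \<subseteq> P'}. x \<in> W \<and> W \<subseteq> U" if Ux: "openin X U" "x \<in> U" for U x
    proof -
      obtain F where F: "F \<subseteq> P'" "minimal_interior_cover X F {x}" "\<Union>F \<subseteq> U" "\<forall>Q\<in>F. x \<in> Q"
        using strong[OF Ux] by metis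
      have xF: "x \<in> X interior_of \<Union>F" using F(2) by (simp add: minimal_interior_cover_def)
      obtain F2 where F2: "F2 \<subseteq> P'" "minimal_interior_cover X F2 {x}" "\<Union>F2 \<subseteq> X interior_of \<Union>F" "\<forall>Q\<in>F2. x \<in> Q"
        using strong[OF openin_interior_of xF] by metis
      \<comment> \<open>No member of \<open>F\<close> can be spared for \<open>E\<close>, because
        already the point \<open>x\<close> of \<open>E\<close> needs all of them.\<close>
      have "minimal_interior_cover X F E" if E: "E \<in> F2" for E
        unfolding minimal_interior_cover_def
      proof (intro conjI allI impI)
        show "finite F" using F(2) by (simp add: minimal_interior_cover_def)
        show "E \<subseteq> X interior_of \<Union>F" using F2 E by blast
        fix R assume "R \<subset> F"
        then have "\<not> {x} \<subseteq> X interior_of \<Union>R" using F(2) by (simp add: minimal_interior_cover_def)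
        then show "\<not> E \<subseteq> X interior_of \<Union>R" using F2(4) E by blast
      qed
      then have "\<Union>F2 \<subseteq> \<Union>{E \<in> P'. minimal_interior_cover X F E}" using F2(1) by blast
      then have "X interior_of \<Union>F2 \<subseteq> B F" unfolding B_def by (rule interior_of_mono)
      then have "x \<in> B F" using F2(2) by (auto simp: minimal_interior_cover_def)
      moreover have "B F \<subseteq> U"
      proof -
        have "B F \<subseteq> \<Union>{E \<in> P'. minimal_interior_cover X F E}" unfolding B_def by (rule interior_of_subset)
        also have "\<dots> \<subseteq> X interior_of \<Union>F" by (auto simp: minimal_interior_cover_def)
        also have "\<dots> \<subseteq> \<Union>F" by (rule interior_of_subset)
        finally show ?thesis using F(3) by blast
      qed
      ultimately show ?thesis using F(1) by blast
    qed
  qed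
qed

text \<open>Heath's argument: \<open>hat k x\<close>, the first point whose \<open>k\<close>-th neighbourhood contains \<open>x\<close>, is
  locally constant enough for the base members around it to yield a development.\<close>

lemma development_exists:
  assumes \<B>: "\<And>B. B \<in> \<B> \<Longrightarrow> openin X B" "point_countable X \<B>"
    "\<And>U x. openin X U \<Longrightarrow> x \<in> U \<Longrightarrow> \<exists>B\<in>\<B>. x \<in> B \<and> B \<subseteq> U"
  obtains h :: "nat \<Rightarrow> 'a \<Rightarrow> 'a set" where
    "\<And>n x. x \<in> topspace X \<Longrightarrow> openin X (h n x) \<and> x \<in> h n x"
    "\<And>U x. openin X U \<Longrightarrow> x \<in> U \<Longrightarrow> \<exists>n. \<forall>y\<in>topspace X. x \<in> h n y \<longrightarrow> h n y \<subseteq> U"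
proof -
  obtain r0 :: "'a rel" where "Well_order r0 \<and> Field r0 = UNIV" using well_ordering by metis
  then have r0: "wf (r0 - Id)" "total_on UNIV r0"
    by (auto simp: well_order_on_def linear_order_on_def)
  define r where "r = r0 - Id"
  have r: "wf r" "\<And>i j. i \<noteq> j \<Longrightarrow> (i, j) \<in> r \<or> (j, i) \<in> r"
    using r0 by (auto simp: r_def total_on_def)
  have "\<exists>z. z \<in> topspace X \<and> x \<in> nb k z \<and> (\<forall>y. (y, z) \<in> r \<longrightarrow> \<not> (y \<in> topspace X \<and> x \<in> nb k y))"
    if x: "x \<in> topspace X" for k x
  proof -
    define Q where "Q = {z \<in> topspace X. x \<in> nb k z}"
    have "x \<in> Q" using x nb_self by (simp add: Q_def)
    then have "\<exists>z\<in>Q. \<forall>y. (y, z) \<in> r \<longrightarrow> y \<notin> Q"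
      using r(1) unfolding wf_eq_minimal by blast
    then show ?thesis unfolding Q_def by blast
  qed
  then have "\<forall>k. \<forall>x\<in>topspace X. \<exists>z. z \<in> topspace X \<and> x \<in> nb k z \<and>
      (\<forall>y. (y, z) \<in> r \<longrightarrow> \<not> (y \<in> topspace X \<and> x \<in> nb k y))" by blast
  then obtain hat where "\<forall>k. \<forall>x\<in>topspace X. hat k x \<in> topspace X \<and> x \<in> nb k (hat k x) \<and>
      (\<forall>y. (y, hat k x) \<in> r \<longrightarrow> \<not> (y \<in> topspace X \<and> x \<in> nb k y))"
    unfolding bchoice_iff choice_iff by blast
  then have hat: "\<And>k x. x \<in> topspace X \<Longrightarrow> hat k x \<in> topspace X"
    "\<And>k x. x \<in> topspace X \<Longrightarrow> x \<in> nb k (hat k x)"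
    "\<And>k x y. x \<in> topspace X \<Longrightarrow> (y, hat k x) \<in> r \<Longrightarrow> y \<in> topspace X \<Longrightarrow> x \<notin> nb k y"
    by blast+
  define bs where "bs z = from_nat_into {B \<in> \<B>. z \<in> B}" for z
  have bs: "range (bs z) = {B \<in> \<B>. z \<in> B}" if z: "z \<in> topspace X" for z
    unfolding bs_def
  proof (rule range_from_nat_into)
    show "{B \<in> \<B>. z \<in> B} \<noteq> {}" using \<B>(3)[OF openin_topspace z] by blast
    show "countable {B \<in> \<B>. z \<in> B}" using \<B>(2) z by (auto simp: point_countable_def)
  qed
  \<comment> \<open>The default \<open>topspace X\<close> is neutral in the intersection below: only
    base members that contain \<open>x\<close> constrain \<open>h n x\<close>.\<close>
  define b where "b x z j = (if x \<in> bs z j then bs z j else topspace X)" for x z j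
  have ob: "openin X (b x z j)" if "z \<in> topspace X" for x z j
    using bs[OF that] \<B>(1) unfolding b_def by (auto split: if_splits)
  have xb: "x \<in> b x z j" if "x \<in> topspace X" for x z j using that by (simp add: b_def)
  define h where "h n x = nb n x \<inter> (\<Inter>k\<in>{..n}. nb k (hat k x)) \<inter> (\<Inter>k\<in>{..n}. \<Inter>j\<in>{..n}. b x (hat k x) j)" for n x
  show thesis
  proof (rule that[of h])
    show "openin X (h n x) \<and> x \<in> h n x" if x: "x \<in> topspace X" for n x
    proof
      show "openin X (h n x)" unfolding h_def
        by (intro openin_Int openin_INT2 nb_open ob hat(1) x) auto
      show "x \<in> h n x" unfolding h_def using nb_self[OF x] hat(2)[OF x] xb[OF x] by blast
    qed
    show "\<exists>n. \<forall>y\<in>topspace X. x \<in> h n y \<longrightarrow> h n y \<subseteq> U" if Ux: "openin X U" "x \<in> U" for U x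
    proof (rule ccontr)
      assume "\<nexists>n. \<forall>y\<in>topspace X. x \<in> h n y \<longrightarrow> h n y \<subseteq> U"
      then obtain y where y: "\<And>n. y n \<in> topspace X" "\<And>n. x \<in> h n (y n)" "\<And>n. \<not> h n (y n) \<subseteq> U" by metis
      have xX: "x \<in> topspace X" using Ux openin_subset by blast
      have cx: "limitin X (\<lambda>_. x) x sequentially" using xX by simp
      have yx: "limitin X y x sequentially"
        by (rule limitin_nb_centres[OF cx, where k = "\<lambda>n. n"]) (use y(2) in \<open>auto simp: h_def filterlim_ident\<close>)
      have hx: "limitin X (\<lambda>k. hat k x) x sequentially"
        by (rule limitin_nb_centres[OF cx, where k = "\<lambda>n. n"]) (use hat(2) xX in \<open>auto simp: filterlim_ident\<close>)
      obtain B where B: "B \<in> \<B>" "x \<in> B" "B \<subseteq> U" using \<B>(3)[OF Ux] by metis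
      then have oB: "openin X B" using \<B>(1) by blast
      have "\<forall>\<^sub>F k in sequentially. hat k x \<in> B" using limitinD[OF hx oB B(2)] .
      then obtain k where k: "hat k x \<in> B" by (auto simp: eventually_sequentially)
      then have "B \<in> range (bs (hat k x))" using bs[OF hat(1)[OF xX]] B by simp
      then obtain j where j: "bs (hat k x) j = B" by blast
      have "\<forall>\<^sub>F n in sequentially. y n \<in> nb k (hat k x)"
        using limitinD[OF yx nb_open hat(2)[OF xX]] .
      moreover have "\<forall>\<^sub>F n in sequentially. y n \<in> B" using limitinD[OF yx oB B(2)] .
      ultimately have "\<forall>\<^sub>F n in sequentially. y n \<in> nb k (hat k x) \<and> y n \<in> B \<and> n \<ge> k \<and> n \<ge> j"
        using eventually_ge_at_top[of k] eventually_ge_at_top[of j] by eventually_elim auto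
      then obtain n where n: "y n \<in> nb k (hat k x)" "y n \<in> B" "n \<ge> k" "n \<ge> j"
        by (auto simp: eventually_sequentially)
      \<comment> \<open>Each of \<open>x\<close> and \<open>y n\<close> lies in the
        \<open>k\<close>-th neighbourhood chosen for the other one. As both choices are first in the
        well-order, neither precedes the other, so they agree and \<open>B\<close> is among the sets
        intersected in \<open>h n (y n)\<close>.\<close>
      have "x \<in> nb k (hat k (y n))" using y(2)[of n] n(3) by (auto simp: h_def)
      then have 1: "(hat k (y n), hat k x) \<notin> r" using hat(3)[OF xX] hat(1)[OF y(1)] by blast
      have 2: "(hat k x, hat k (y n)) \<notin> r" using hat(3)[OF y(1)] hat(1)[OF xX] n(1) by blast
      have "hat k (y n) = hat k x" using r(2) 1 2 by metis
      then have "b (y n) (hat k (y n)) j = B" using j n(2) by (simp add: b_def)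
      moreover have "h n (y n) \<subseteq> b (y n) (hat k (y n)) j" unfolding h_def using n by auto
      ultimately show False using y(3)[of n] B(3) by blast
    qed
  qed
qed

text \<open>Each cover by the sets \<open>h n i\<close> yields a continuous pseudometric. If
  \<open>d n x y < 1\<close>, both points lie in one \<open>h n i\<close>, and since this set
  contains \<open>x\<close>, the development confines it to \<open>U\<close> for a suitable
  \<open>n\<close>.\<close>

theorem interior_network_imp_metrizable:
  assumes FU: "frechet_urysohn_space X" and P: "point_countable X P" "\<Union>P \<subseteq> topspace X"
    and net: "interior_network X P"
  shows "metrizable_space X"
proof -
  obtain \<B> where \<B>: "\<And>B. B \<in> \<B> \<Longrightarrow> openin X B" "point_countable X \<B>"
    "\<And>U x. openin X U \<Longrightarrow> x \<in> U \<Longrightarrow> \<exists>B\<in>\<B>. x \<in> B \<and> B \<subseteq> U"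
    using point_countable_base_exists[OF assms] by metis
  obtain h :: "nat \<Rightarrow> 'a \<Rightarrow> 'a set" where
    h: "\<And>n x. x \<in> topspace X \<Longrightarrow> openin X (h n x) \<and> x \<in> h n x"
    "\<And>U x. openin X U \<Longrightarrow> x \<in> U \<Longrightarrow> \<exists>n. \<forall>y\<in>topspace X. x \<in> h n y \<longrightarrow> h n y \<subseteq> U"
    using development_exists[OF \<B>] by metis
  have "\<exists>d. continuous_pseudometric X d \<and>
    (\<forall>x\<in>topspace X. \<forall>y\<in>topspace X. d x y < 1 \<longrightarrow> (\<exists>i\<in>topspace X. x \<in> h n i \<and> y \<in> h n i))" for n
  proof -
    define U where "U i = (if i \<in> topspace X then h n i else {})" for i
    have "openin X (U i)" for i using h(1) by (simp add: U_def)
    moreover have "topspace X \<subseteq> (\<Union>i. U i)"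
    proof
      fix x assume "x \<in> topspace X"
      then have "x \<in> U x" using h(1) by (simp add: U_def)
      then show "x \<in> (\<Union>i. U i)" by blast
    qed
    ultimately obtain d where d: "continuous_pseudometric X d"
      "\<And>x y. \<lbrakk>x \<in> topspace X; y \<in> topspace X; d x y < 1\<rbrakk> \<Longrightarrow> \<exists>i. x \<in> U i \<and> y \<in> U i"
      using cover_pseudometric[of U] by metis
    then have "\<exists>i\<in>topspace X. x \<in> h n i \<and> y \<in> h n i" if "x \<in> topspace X" "y \<in> topspace X" "d x y < 1" for x y
      using d(2)[OF that] by (auto simp: U_def split: if_splits)
    then show ?thesis using d(1) by blast
  qed
  then obtain d where d: "\<And>n. continuous_pseudometric X (d n)"
    "\<And>n x y. x \<in> topspace X \<Longrightarrow> y \<in> topspace X \<Longrightarrow> d n x y < 1 \<Longrightarrow> \<exists>i\<in>topspace X. x \<in> h n i \<and> y \<in> h n i"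
    by metis
  show ?thesis
  proof (rule metrizable_from_pseudometrics[OF t1 d(1)])
    fix U x assume Ux: "openin X U" "x \<in> U"
    then obtain n where n: "\<forall>y\<in>topspace X. x \<in> h n y \<longrightarrow> h n y \<subseteq> U" using h(2) by metis
    have xX: "x \<in> topspace X" using Ux openin_subset by blast
    have "\<forall>y\<in>topspace X. d n x y < 1 \<longrightarrow> y \<in> U"
      using n d(2)[OF xX] by blast
    then show "\<exists>n. \<exists>e>0. \<forall>y\<in>topspace X. d n x y < e \<longrightarrow> y \<in> U" using zero_less_one by blast
  qed
qed

end

section \<open>Sequence networks and fans\<close>

text \<open>A pigeonhole form of the network property: one member catches infinitely many terms and
  need not contain the limit. This form is what remains once the members that are not relatively
  compact are discarded.\<close>

definition seq_network :: "'a topology \<Rightarrow> 'a set set \<Rightarrow> bool" where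
  "seq_network X P \<longleftrightarrow> (\<forall>\<sigma> q U. limitin X \<sigma> q sequentially \<and> openin X U \<and> q \<in> U \<longrightarrow>
     (\<exists>Q\<in>P. Q \<subseteq> U \<and> infinite {n::nat. \<sigma> n \<in> Q}))"

lemma compactin_convergent_sequence:
  assumes "limitin X \<tau> q sequentially" "range \<tau> \<subseteq> topspace X"
  shows "compactin X (insert q (range \<tau>))"
  unfolding compactin_def
proof (intro conjI allI impI)
  show "insert q (range \<tau>) \<subseteq> topspace X" using assms limitin_topspace by fastforce
  fix \<U> assume \<U>: "(\<forall>U\<in>\<U>. openin X U) \<and> insert q (range \<tau>) \<subseteq> \<Union>\<U>"
  then obtain U where U: "U \<in> \<U>" "q \<in> U" by blast
  have oU: "openin X U" using \<U> U by blast
  have "\<forall>\<^sub>F n in sequentially. \<tau> n \<in> U" using limitinD[OF assms(1) oU U(2)] .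
  then obtain N where N: "\<And>n. n \<ge> N \<Longrightarrow> \<tau> n \<in> U" by (auto simp: eventually_sequentially)
  have "\<forall>n. \<exists>W. W \<in> \<U> \<and> \<tau> n \<in> W" using \<U> by blast
  then obtain W where W: "\<And>n. W n \<in> \<U>" "\<And>n. \<tau> n \<in> W n" by metis
  have "\<tau> n \<in> \<Union>(insert U (W ` {..<N}))" for n
    using N[of n] W(2)[of n] by (cases "n \<ge> N") auto
  then have "insert q (range \<tau>) \<subseteq> \<Union>(insert U (W ` {..<N}))" using U by blast
  moreover have "insert U (W ` {..<N}) \<subseteq> \<U>" using U W by blast
  ultimately show "\<exists>\<F>. finite \<F> \<and> \<F> \<subseteq> \<U> \<and> insert q (range \<tau>) \<subseteq> \<Union>\<F>"
    by (intro exI[of _ "insert U (W ` {..<N})"]) auto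
qed

lemma k_network_imp_seq_network:
  assumes "k_network X P"
  shows "seq_network X P"
  unfolding seq_network_def
proof (intro allI impI, elim conjE)
  fix \<sigma> :: "nat \<Rightarrow> 'a" and q U assume \<sigma>: "limitin X \<sigma> q sequentially" and U: "openin X U" "q \<in> U"
  obtain N where N: "\<And>n. n \<ge> N \<Longrightarrow> \<sigma> n \<in> U"
    using limitinD[OF \<sigma> U] by (auto simp: eventually_sequentially)
  let ?K = "insert q (range (\<lambda>n. \<sigma> (n + N)))"
  have KU: "?K \<subseteq> U" using N U by auto
  have "compactin X ?K"
    by (rule compactin_convergent_sequence[OF limitin_sequentially_offset[OF \<sigma>]])
      (use KU openin_subset[OF U(1)] in auto)
  then obtain F where F: "F \<subseteq> P" "finite F" "?K \<subseteq> \<Union>F" "\<Union>F \<subseteq> U"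
    using assms U KU unfolding k_network_def by metis
  have "{N..} \<subseteq> (\<Union>Q\<in>F. {n. \<sigma> n \<in> Q})"
  proof
    fix n assume "n \<in> {N..}"
    then have "\<sigma> n = \<sigma> ((n - N) + N)" by simp
    then have "\<sigma> n \<in> ?K" by blast
    then show "n \<in> (\<Union>Q\<in>F. {n. \<sigma> n \<in> Q})" using F(3) by blast
  qed
  then have "infinite (\<Union>Q\<in>F. {n. \<sigma> n \<in> Q})" using infinite_Ici infinite_super by blast
  then obtain Q where "Q \<in> F" "infinite {n. \<sigma> n \<in> Q}" using F(2) by blast
  then show "\<exists>Q\<in>P. Q \<subseteq> U \<and> infinite {n. \<sigma> n \<in> Q}" using F by blast
qed

text \<open>For sequences in a T1 Frechet-Urysohn space this amounts to local finiteness of the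
  indexed family, by \<open>frechet_urysohn_locally_finite\<close>.\<close>

definition no_convergent_subseq :: "'a topology \<Rightarrow> (nat \<Rightarrow> 'a) \<Rightarrow> bool" where
  "no_convergent_subseq X u \<longleftrightarrow> (\<forall>r z. strict_mono r \<longrightarrow> \<not> limitin X (u \<circ> r) z sequentially)"

definition bad_point :: "'a topology \<Rightarrow> 'a \<Rightarrow> bool" where
  "bad_point X q \<longleftrightarrow> q \<in> topspace X \<and> (\<exists>d :: nat \<Rightarrow> nat \<Rightarrow> 'a. (\<forall>n m. d n m \<in> topspace X) \<and>
     (\<forall>n. no_convergent_subseq X (d n)) \<and>
     (\<forall>V. openin X V \<and> q \<in> V \<longrightarrow> (\<exists>n. infinite {m. d n m \<in> V})))"

text \<open>Only countably many members meet the given sequence. If every neighbourhood of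
  \<open>q\<close> contained one of these that is not relatively compact, sequences witnessing this
  would make \<open>q\<close> bad. So inside some neighbourhood of \<open>q\<close> all of them are
  relatively compact, and one of them catches the sequence.\<close>

lemma seq_network_precompact:
  assumes good: "\<And>q. \<not> bad_point X q" and P: "point_countable X P" and PX: "\<Union>P \<subseteq> topspace X"
    and net: "seq_network X P"
  shows "seq_network X {Q \<in> P. seq_precompact X Q}"
  unfolding seq_network_def
proof (intro allI impI, elim conjE)
  fix \<sigma> :: "nat \<Rightarrow> 'a" and q U assume \<sigma>: "limitin X \<sigma> q sequentially" and U: "openin X U" "q \<in> U"
  define A where "A = range \<sigma> \<inter> topspace X"
  have "countable A" "A \<subseteq> topspace X" by (auto simp: A_def)
  then have cC: "countable {Q \<in> P. Q \<inter> A \<noteq> {}}" by (rule point_countable_meets_countable[OF P])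
  have q: "q \<in> topspace X" using \<sigma> by (rule limitin_topspace)
  have "\<exists>V. openin X V \<and> q \<in> V \<and> (\<forall>Q \<in> {Q \<in> P. Q \<inter> A \<noteq> {}}. Q \<subseteq> V \<longrightarrow> seq_precompact X Q)"
  proof (rule ccontr)
    assume *: "\<not> ?thesis"
    define C where "C = {Q \<in> P. Q \<inter> A \<noteq> {} \<and> \<not> seq_precompact X Q}"
    have C: "\<exists>Q\<in>C. Q \<subseteq> V" if "openin X V" "q \<in> V" for V
    proof -
      have "\<not> (\<forall>Q \<in> {Q \<in> P. Q \<inter> A \<noteq> {}}. Q \<subseteq> V \<longrightarrow> seq_precompact X Q)" using * that by auto
      then show ?thesis unfolding C_def by auto
    qed
    have ne: "C \<noteq> {}" using C[OF openin_topspace q] by blast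
    have "C \<subseteq> {Q \<in> P. Q \<inter> A \<noteq> {}}" by (auto simp: C_def)
    then have cC': "countable C" using cC by (rule countable_subset)
    define e where "e = from_nat_into C"
    have re: "range e = C" unfolding e_def using ne cC' by (rule range_from_nat_into)
    have "\<exists>d::nat \<Rightarrow> 'a. (\<forall>m. d m \<in> e n) \<and> no_convergent_subseq X d" for n
    proof -
      have "\<not> seq_precompact X (e n)" using re by (auto simp: C_def)
      then show ?thesis unfolding seq_precompact_def no_convergent_subseq_def by blast
    qed
    then obtain d :: "nat \<Rightarrow> nat \<Rightarrow> 'a" where d: "\<And>n m. d n m \<in> e n" "\<And>n. no_convergent_subseq X (d n)" by metis
    have eX: "e n \<subseteq> topspace X" for n using re PX by (auto simp: C_def)
    have "bad_point X q"
      unfolding bad_point_def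
    proof (intro conjI q exI[of _ d] allI impI)
      show "d n m \<in> topspace X" for n m using d eX by blast
      show "no_convergent_subseq X (d n)" for n using d by blast
      fix V assume "openin X V \<and> q \<in> V"
      then obtain Q where Q: "Q \<in> C" "Q \<subseteq> V" using C by blast
      then obtain n where "e n = Q" using re by blast
      then have "{m. d n m \<in> V} = UNIV" using d(1)[of n] Q by auto
      then show "\<exists>n. infinite {m. d n m \<in> V}" by (metis infinite_UNIV_nat)
    qed
    then show False using good by blast
  qed
  then obtain V where V0: "openin X V \<and> q \<in> V \<and> (\<forall>Q \<in> {Q \<in> P. Q \<inter> A \<noteq> {}}. Q \<subseteq> V \<longrightarrow> seq_precompact X Q)" ..
  have V: "openin X V" "q \<in> V" "\<And>Q. Q \<in> P \<Longrightarrow> Q \<inter> A \<noteq> {} \<Longrightarrow> Q \<subseteq> V \<Longrightarrow> seq_precompact X Q"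
    using V0 by auto
  have "openin X (U \<inter> V)" "q \<in> U \<inter> V" using U V by auto
  then obtain Q where Q: "Q \<in> P" "Q \<subseteq> U \<inter> V" "infinite {n. \<sigma> n \<in> Q}"
    using net \<sigma> unfolding seq_network_def by metis
  have "{n. \<sigma> n \<in> Q} \<noteq> {}" using Q(3) by (intro notI) simp
  then have "Q \<inter> A \<noteq> {}" using PX Q(1) unfolding A_def by blast
  then have "seq_precompact X Q" using V Q by blast
  then show "\<exists>Q\<in>{Q \<in> P. seq_precompact X Q}. Q \<subseteq> U \<and> infinite {n. \<sigma> n \<in> Q}" using Q by blast
qed

context stratified
begin

text \<open>\<open>s n\<close> avoids the first \<open>n\<close> members inside \<open>U\<close> on
  the lists of those meeting each of the \<open>n\<close> earlier sequences; this is possible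
  because no finite union of members inside \<open>U\<close> is a neighbourhood of \<open>p\<close>.
  A convergent transversal would return infinitely often to one member \<open>Q\<close>, which has a
  number on the list of an early sequence and is avoided from some point on.\<close>

lemma countable_fan_exists:
  assumes FU: "frechet_urysohn_space X" and P: "point_countable X P" and net: "seq_network X P"
    and pU: "openin X U" "p \<in> U"
    and no: "\<And>F. \<lbrakk>F \<subseteq> P; finite F; \<Union>F \<subseteq> U\<rbrakk> \<Longrightarrow> p \<notin> X interior_of \<Union>F"
  obtains s :: "nat \<Rightarrow> nat \<Rightarrow> 'a" where "\<And>n. limitin X (s n) p sequentially"
    "\<And>n m. s n m \<in> topspace X - {p}"
    "\<And>i m z. strict_mono i \<Longrightarrow> \<not> limitin X (\<lambda>j::nat. s (i j) (m j)) z sequentially"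
proof -
  \<comment> \<open>The sequences will run in \<open>V\<close>, so limits of transversals stay in
    \<open>U\<close>, where members inside \<open>U\<close> can catch them.\<close>
  obtain V where V: "openin X V" "p \<in> V" "X closure_of V \<subseteq> U" using shrink[OF pU] by metis
  have VX: "V \<subseteq> topspace X" using V openin_subset by blast
  have VU: "V \<subseteq> U" using V VX closure_of_subset by fast
  have pX: "p \<in> topspace X" using VX V by blast
  \<comment> \<open>Applied to a constant sequence, the network property provides a member
    containing \<open>p\<close>. Once it is among the sets to be avoided, all terms differ from
    \<open>p\<close>.\<close>
  have "limitin X (\<lambda>_::nat. p) p sequentially" using pX by simp
  then obtain Q0 where Q0: "Q0 \<in> P" "Q0 \<subseteq> U" "infinite {n::nat. p \<in> Q0}"
    using net[unfolded seq_network_def, rule_format, of "\<lambda>_. p" p U] pU by blast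
  then have pQ0: "p \<in> Q0" by (cases "p \<in> Q0") auto
  define C where "C a = {Q \<in> P. Q \<subseteq> U \<and> Q \<inter> range (a::nat \<Rightarrow> 'a) \<noteq> {}}" for a
  define e where "e a j = (if C a = {} then {} else from_nat_into (C a) j)" for a and j :: nat
  have e1: "e a j = {} \<or> e a j \<in> P \<and> e a j \<subseteq> U" for a j
    using from_nat_into[of "C a" j] by (auto simp: e_def C_def)
  have e2: "\<exists>j. e a j = Q" if a: "range a \<subseteq> topspace X" and Q: "Q \<in> C a" for a Q
  proof -
    have "C a \<subseteq> {Q \<in> P. Q \<inter> range a \<noteq> {}}" by (auto simp: C_def)
    moreover have "countable {Q \<in> P. Q \<inter> range a \<noteq> {}}"
      by (rule point_countable_meets_countable[OF P _ a]) simp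
    ultimately have "countable (C a)" by (rule countable_subset)
    moreover have "C a \<noteq> {}" using Q by blast
    ultimately have "range (from_nat_into (C a)) = C a" by (intro range_from_nat_into)
    then show ?thesis using Q \<open>C a \<noteq> {}\<close> unfolding e_def by (metis (no_types, lifting) imageE)
  qed
  define R where "R f n r \<longleftrightarrow> limitin X r p sequentially \<and> (\<forall>m. r m \<in> V - {p}) \<and>
      (\<forall>i<n. \<forall>j<n. \<forall>m. r m \<notin> e (f i) j)" for f :: "nat \<Rightarrow> nat \<Rightarrow> 'a" and n :: nat and r :: "nat \<Rightarrow> 'a"
  have "\<exists>s. \<forall>n. R s n (s n)"
  proof (rule dependent_wellorder_choice)
    show "R f n r = R g n r" if "\<And>y. y < n \<Longrightarrow> f y = g y" for r f g n
      using that unfolding R_def by (metis (no_types, lifting))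
  next
    fix n f
    define F where "F = insert Q0 ((\<lambda>(i, j). e (f i) j) ` ({..<n} \<times> {..<n}) - {{}})"
    have "Q \<in> P \<and> Q \<subseteq> U" if Q: "Q \<in> F" for Q
    proof (cases "Q = Q0")
      case True
      then show ?thesis using Q0 by simp
    next
      case False
      then obtain i j where "Q = e (f i) j" "Q \<noteq> {}" using Q unfolding F_def by auto
      then show ?thesis using e1[of "f i" j] by auto
    qed
    then have F: "F \<subseteq> P" "\<Union>F \<subseteq> U" by blast+
    have "finite F" by (simp add: F_def)
    then have "p \<notin> X interior_of \<Union>F" using no F by blast
    then have nF: "\<not> W \<subseteq> \<Union>F" if "openin X W" "p \<in> W" for W
      using that interior_of_maximal[of W "\<Union>F" X] by blast
    obtain \<sigma> :: "nat \<Rightarrow> 'a" where \<sigma>: "\<And>n. \<sigma> n \<in> topspace X - \<Union>F" "limitin X \<sigma> p sequentially"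
      using frechet_urysohn_not_interior[OF FU pX nF] by blast
    obtain N where N: "\<And>n. n \<ge> N \<Longrightarrow> \<sigma> n \<in> V"
      using limitinD[OF \<sigma>(2) V(1,2)] by (auto simp: eventually_sequentially)
    have "R f n (\<lambda>m. \<sigma> (m + N))"
      unfolding R_def
    proof (intro conjI allI impI)
      show "limitin X (\<lambda>m. \<sigma> (m + N)) p sequentially" by (rule limitin_sequentially_offset[OF \<sigma>(2)])
      show "\<sigma> (m + N) \<in> V - {p}" for m
        using N[of "m + N"] \<sigma>(1)[of "m + N"] pQ0 unfolding F_def by auto
      fix i j m assume ij: "i < n" "j < n"
      show "\<sigma> (m + N) \<notin> e (f i) j"
      proof
        assume *: "\<sigma> (m + N) \<in> e (f i) j"
        then have "e (f i) j \<in> F" using ij unfolding F_def by force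
        then show False using \<sigma>(1)[of "m + N"] * by blast
      qed
    qed
    then show "\<exists>r. R f n r" by blast
  qed
  then obtain s where s: "\<And>n. R s n (s n)" by blast
  have sV: "s n m \<in> V - {p}" for n m using s unfolding R_def by blast
  show thesis
  proof (rule that[of s])
    show "limitin X (s n) p sequentially" for n using s unfolding R_def by blast
    show "s n m \<in> topspace X - {p}" for n m using sV VX by blast
    fix i :: "nat \<Rightarrow> nat" and m z assume i: "strict_mono i"
    show "\<not> limitin X (\<lambda>j. s (i j) (m j)) z sequentially"
    proof
      assume lim: "limitin X (\<lambda>j. s (i j) (m j)) z sequentially"
      have "z \<in> X closure_of V" by (rule limitin_in_closure[OF lim]) (use sV in blast)
      then have "z \<in> U" using V by blast
      then obtain Q where Q: "Q \<in> P" "Q \<subseteq> U" "infinite {j. s (i j) (m j) \<in> Q}"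
        using net lim pU(1) unfolding seq_network_def by metis
      have "{j. s (i j) (m j) \<in> Q} \<noteq> {}" using Q(3) by (intro notI) simp
      then obtain j0 where j0: "s (i j0) (m j0) \<in> Q" by blast
      have "Q \<in> C (s (i j0))" using Q j0 unfolding C_def by blast
      moreover have "range (s (i j0)) \<subseteq> topspace X" using sV VX by blast
      ultimately obtain l where l: "e (s (i j0)) l = Q" using e2 by blast
      obtain j where j: "j > max (i j0) l" "s (i j) (m j) \<in> Q"
        using Q(3) unfolding infinite_nat_iff_unbounded by blast
      have "j \<le> i j" using seq_suble[OF i] .
      then have "i j0 < i j" "l < i j" using j(1) by auto
      then have "s (i j) (m j) \<notin> e (s (i j0)) l" using s[of "i j"] unfolding R_def by blast
      then show False using l j(2) by simp
    qed
  qed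
qed

end

text \<open>Take a maximal family of sequences such that no member of \<open>P\<close> meets two of
  them. If it were countable, only countably many members would meet it, and their countable dense
  sets would form, with the terms and \<open>q\<close>, a countable set \<open>D\<close>. As
  \<open>q\<close> is not interior to the closure of \<open>D\<close>, a further sequence avoiding
  this closure could be added.\<close>

lemma uncountable_fan_exists:
  fixes X :: "'a topology"
  assumes FU: "frechet_urysohn_space X" and P: "point_countable X P" and PX: "\<Union>P \<subseteq> topspace X"
    and sep: "\<And>Q. Q \<in> P \<Longrightarrow> \<exists>D. countable D \<and> D \<subseteq> topspace X \<and> Q \<subseteq> X closure_of D"
    and q: "q \<in> topspace X"
    and no: "\<And>D. \<lbrakk>countable D; D \<subseteq> topspace X\<rbrakk> \<Longrightarrow> q \<notin> X interior_of (X closure_of D)"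
  obtains S :: "(nat \<Rightarrow> 'a) set" where "uncountable S"
    "\<And>s. s \<in> S \<Longrightarrow> limitin X s q sequentially" "\<And>s m. s \<in> S \<Longrightarrow> s m \<in> topspace X - {q}"
    "\<And>s t Q m n. \<lbrakk>s \<in> S; t \<in> S; Q \<in> P; s m \<in> Q; t n \<in> Q\<rbrakk> \<Longrightarrow> s = t"
proof -
  define ok where "ok s \<longleftrightarrow> limitin X s q sequentially \<and> (\<forall>m. s m \<in> topspace X - {q})" for s :: "nat \<Rightarrow> 'a"
  define \<A> where "\<A> = {S. (\<forall>s\<in>S. ok s) \<and> (\<forall>s\<in>S. \<forall>t\<in>S. \<forall>Q\<in>P. \<forall>m n. s m \<in> Q \<longrightarrow> t n \<in> Q \<longrightarrow> s = t)}"
  have "\<exists>M\<in>\<A>. \<forall>S\<in>\<A>. M \<subseteq> S \<longrightarrow> S = M"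
  proof (rule subset_Zorn')
    fix C assume C: "subset.chain \<A> C"
    then have CA: "C \<subseteq> \<A>" and lin: "\<And>S T. S \<in> C \<Longrightarrow> T \<in> C \<Longrightarrow> S \<subseteq> T \<or> T \<subseteq> S"
      by (auto simp: subset.chain_def)
    show "\<Union>C \<in> \<A>"
      unfolding \<A>_def
    proof (intro CollectI conjI ballI allI impI)
      show "ok s" if "s \<in> \<Union>C" for s using that CA by (auto simp: \<A>_def)
      fix s t Q m n assume st: "s \<in> \<Union>C" "t \<in> \<Union>C" "Q \<in> P" "s m \<in> Q" "t n \<in> Q"
      then obtain S T where "S \<in> C" "s \<in> S" "T \<in> C" "t \<in> T" by blast
      then obtain Z where "Z \<in> C" "s \<in> Z" "t \<in> Z" using lin[of S T] by blast
      then show "s = t" using st CA unfolding \<A>_def by blast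
    qed
  qed
  then obtain M where M: "M \<in> \<A>" "\<And>S. S \<in> \<A> \<Longrightarrow> M \<subseteq> S \<Longrightarrow> S = M" by blast
  have "uncountable M"
  proof
    assume cM: "countable M"
    define A where "A = insert q (\<Union>s\<in>M. range s)"
    have cA: "countable A" using cM by (simp add: A_def)
    have AX: "A \<subseteq> topspace X" using M(1) q by (auto simp: A_def \<A>_def ok_def)
    define PA where "PA = {Q \<in> P. Q \<inter> A \<noteq> {}}"
    have cPA: "countable PA" unfolding PA_def by (rule point_countable_meets_countable[OF P cA AX])
    obtain DD where DD: "\<And>Q. Q \<in> P \<Longrightarrow> countable (DD Q) \<and> DD Q \<subseteq> topspace X \<and> Q \<subseteq> X closure_of DD Q"
      using sep by metis
    define D where "D = A \<union> (\<Union>Q\<in>PA. DD Q)"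
    have cD: "countable D" unfolding D_def
      by (intro countable_Un cA countable_UN cPA) (use DD in \<open>auto simp: PA_def\<close>)
    have DX: "D \<subseteq> topspace X" using AX DD unfolding D_def PA_def by blast
    have nD: "\<not> W \<subseteq> X closure_of D" if "openin X W" "q \<in> W" for W
      using no[OF cD DX] that interior_of_maximal[of W "X closure_of D" X] by blast
    obtain \<sigma> :: "nat \<Rightarrow> 'a" where \<sigma>: "\<And>n. \<sigma> n \<in> topspace X - X closure_of D" "limitin X \<sigma> q sequentially"
      using frechet_urysohn_not_interior[OF FU q nD] by blast
    have Dcl: "D \<subseteq> X closure_of D" using DX by (rule closure_of_subset)
    then have \<sigma>A: "\<sigma> n \<notin> A" for n using \<sigma>(1)[of n] unfolding D_def by blast
    have PAcl: "Q \<subseteq> X closure_of D" if "Q \<in> PA" for Q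
    proof -
      have "Q \<subseteq> X closure_of DD Q" using DD that by (auto simp: PA_def)
      also have "\<dots> \<subseteq> X closure_of D" by (rule closure_of_mono) (use that in \<open>auto simp: D_def\<close>)
      finally show ?thesis .
    qed
    have ok\<sigma>: "ok \<sigma>" unfolding ok_def using \<sigma> \<sigma>A by (auto simp: A_def)
    have dis: "False" if "s \<in> M" "Q \<in> P" "s m \<in> Q" "\<sigma> n \<in> Q" for s Q m n
    proof -
      have "Q \<in> PA" using that unfolding PA_def A_def by blast
      then show False using PAcl \<sigma>(1)[of n] that(4) by blast
    qed
    have "insert \<sigma> M \<in> \<A>"
      unfolding \<A>_def
    proof (intro CollectI conjI ballI allI impI)
      show "ok s" if "s \<in> insert \<sigma> M" for s using that ok\<sigma> M(1) by (auto simp: \<A>_def)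
      fix s t Q m n assume st: "s \<in> insert \<sigma> M" "t \<in> insert \<sigma> M" "Q \<in> P" "s m \<in> Q" "t n \<in> Q"
      show "s = t"
      proof (cases "s = \<sigma> \<or> t = \<sigma>")
        case True
        then show ?thesis using st dis by blast
      next
        case False
        then have "s \<in> M" "t \<in> M" using st by auto
        then show ?thesis using M(1) st unfolding \<A>_def by blast
      qed
    qed
    then have "insert \<sigma> M = M" using M(2) by blast
    then have "\<sigma> 0 \<in> A" unfolding A_def by blast
    then show False using \<sigma>A by blast
  qed
  moreover have "limitin X s q sequentially" "s m \<in> topspace X - {q}" if "s \<in> M" for s m
    using M(1) that unfolding \<A>_def ok_def by blast+
  moreover have "s = t" if "s \<in> M" "t \<in> M" "Q \<in> P" "s m \<in> Q" "t n \<in> Q" for s t Q m n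
    using M(1) that unfolding \<A>_def by blast
  ultimately show thesis by (rule that)
qed

lemma limitin_frequently_in_closure:
  assumes "limitin X \<sigma> z sequentially" "infinite {n::nat. \<sigma> n \<in> P}"
  shows "z \<in> X closure_of P"
  unfolding in_closure_of
proof (intro conjI allI impI)
  show "z \<in> topspace X" using assms(1) by (rule limitin_topspace)
  fix T assume "z \<in> T \<and> openin X T"
  then obtain N where N: "\<And>n. n \<ge> N \<Longrightarrow> \<sigma> n \<in> T"
    using limitinD[OF assms(1), of T] by (auto simp: eventually_sequentially)
  obtain n where "n > N" "n \<in> {n. \<sigma> n \<in> P}"
    using assms(2) unfolding infinite_nat_iff_unbounded by blast
  then show "\<exists>y. y \<in> P \<and> y \<in> T" using N[of n] by auto
qed

section \<open>Neighbourhoods that are k_omega-spaces\<close>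

context stratified
begin

text \<open>Otherwise there are terms \<open>\<tau> (k n)\<close> outside the closure of
  \<open>R n\<close>, with open neighbourhoods that miss \<open>R n\<close> and whose closures miss
  \<open>z\<close>. Density of \<open>D\<close> near \<open>z\<close> gives a sequence in
  \<open>D\<close> that lies in the union of these neighbourhoods and converges to \<open>z\<close>.
  Infinitely many of its terms lie in some \<open>e i\<close>, hence in the first \<open>i\<close>
  neighbourhoods, whose closures do not contain \<open>z\<close>.\<close>

lemma separable_nbhd_sequences:
  assumes FU: "frechet_urysohn_space X" and PX: "\<Union>P \<subseteq> topspace X" and net: "seq_network X P"
    and D: "D \<subseteq> topspace X" and e: "\<And>Q. Q \<in> P \<Longrightarrow> Q \<inter> D \<noteq> {} \<Longrightarrow> Q \<in> range e"
    and eX: "\<And>i::nat. e i \<subseteq> topspace X"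
    and \<tau>: "limitin X \<tau> z sequentially" and z: "z \<in> X interior_of (X closure_of D)"
  shows "\<exists>n. infinite {j::nat. \<tau> j \<in> X closure_of (\<Union>i\<le>n. e i)}"
proof (rule ccontr)
  assume "\<nexists>n. infinite {j. \<tau> j \<in> X closure_of (\<Union>i\<le>n. e i)}"
  then have fin: "finite {j. \<tau> j \<in> X closure_of (\<Union>i\<le>n. e i)}" for n by blast
  define R where "R n = (\<Union>i\<le>n. e i)" for n
  define W where "W = X interior_of (X closure_of D)"
  have W: "openin X W" "W \<subseteq> X closure_of D" "z \<in> W"
    unfolding W_def by (simp, rule interior_of_subset, rule z)
  have zX: "z \<in> topspace X" using \<tau> by (rule limitin_topspace)
  have catch: "\<exists>i. infinite {n. \<rho> n \<in> e i}" if \<rho>: "range \<rho> \<subseteq> D" "limitin X \<rho> z sequentially" for \<rho> :: "nat \<Rightarrow> 'a"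
  proof -
    obtain Q where Q: "Q \<in> P" "infinite {n. \<rho> n \<in> Q}"
      using net[unfolded seq_network_def, rule_format, of \<rho> z "topspace X"] \<rho>(2) zX by blast
    have "{n. \<rho> n \<in> Q} \<noteq> {}" using Q(2) by (intro notI) simp
    then have "Q \<inter> D \<noteq> {}" using \<rho>(1) by blast
    then have "Q \<in> range e" using e Q by blast
    then obtain i where "e i = Q" by blast
    then show ?thesis using Q by blast
  qed
  \<comment> \<open>Since \<open>z\<close> itself belongs to one of the closures, only finitely many
    terms equal \<open>z\<close>; the terms chosen below must differ from \<open>z\<close> to have
    neighbourhoods away from it.\<close>
  obtain n0 where n0: "z \<in> X closure_of R n0"
  proof -
    obtain \<rho> :: "nat \<Rightarrow> 'a" where \<rho>: "range \<rho> \<subseteq> D" "limitin X \<rho> z sequentially"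
      using FU D W unfolding frechet_urysohn_space_def by blast
    then obtain i where i: "infinite {n. \<rho> n \<in> e i}" using catch by blast
    have "z \<in> X closure_of e i" by (rule limitin_frequently_in_closure[OF \<rho>(2) i])
    also have "\<dots> \<subseteq> X closure_of R i" by (rule closure_of_mono) (auto simp: R_def)
    finally show ?thesis by (rule that)
  qed
  have finz: "finite {j. \<tau> j = z}"
    by (rule finite_subset[OF _ fin[of n0]]) (use n0 R_def in auto)
  obtain N where N: "\<And>n. n \<ge> N \<Longrightarrow> \<tau> n \<in> W"
    using limitinD[OF \<tau> W(1,3)] by (auto simp: eventually_sequentially)
  have "\<exists>j\<ge>n. \<tau> j \<in> W \<and> \<tau> j \<notin> X closure_of R n \<and> \<tau> j \<noteq> z" for n
  proof -
    have "finite ({j. \<tau> j \<in> X closure_of R n} \<union> {j. \<tau> j = z} \<union> {..<N} \<union> {..<n})"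
      using fin[of n] finz by (simp add: R_def)
    then obtain j where "j \<notin> {j. \<tau> j \<in> X closure_of R n} \<union> {j. \<tau> j = z} \<union> {..<N} \<union> {..<n}"
      using infinite_UNIV_nat by (metis ex_new_if_finite)
    then show ?thesis using N by (intro exI[of _ j]) auto
  qed
  then obtain k where k: "\<And>n. k n \<ge> n" "\<And>n. \<tau> (k n) \<in> W" "\<And>n. \<tau> (k n) \<notin> X closure_of R n" "\<And>n. \<tau> (k n) \<noteq> z"
    by metis
  have RX: "R n \<subseteq> topspace X" for n unfolding R_def using eX by blast
  have "\<exists>O'. openin X O' \<and> \<tau> (k n) \<in> O' \<and> z \<notin> X closure_of O' \<and> O' \<inter> R n = {}" for n
  proof -
    define A where "A = topspace X - {z} - X closure_of R n"
    have oA: "openin X A" unfolding A_def by (simp add: openin_diff)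
    have "\<tau> (k n) \<in> A" using k[of n] openin_subset[OF W(1)] by (auto simp: A_def)
    then obtain V where V: "openin X V" "\<tau> (k n) \<in> V" "X closure_of V \<subseteq> A" using shrink[OF oA] by metis
    have "V \<subseteq> X closure_of V" using V by (simp add: closure_of_subset openin_subset)
    moreover have "R n \<subseteq> X closure_of R n" using RX by (rule closure_of_subset)
    ultimately have "V \<inter> R n = {}" using V(3) unfolding A_def by blast
    then show ?thesis using V unfolding A_def by blast
  qed
  then obtain O' where O': "\<And>n. openin X (O' n)" "\<And>n. \<tau> (k n) \<in> O' n" "\<And>n. z \<notin> X closure_of O' n" "\<And>n. O' n \<inter> R n = {}"
    by metis
  define B where "B = (\<Union>n. D \<inter> O' n)"
  have "z \<in> X closure_of B"
    unfolding in_closure_of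
  proof (intro conjI zX allI impI)
    fix T assume T: "z \<in> T \<and> openin X T"
    then obtain M where M: "\<And>n. n \<ge> M \<Longrightarrow> \<tau> n \<in> T"
      using limitinD[OF \<tau>, of T] by (auto simp: eventually_sequentially)
    have "\<tau> (k M) \<in> T" using M k(1) by blast
    moreover have "\<tau> (k M) \<in> X closure_of D" using W(2) k(2) by blast
    moreover have "openin X (T \<inter> O' M)" using T O'(1) by blast
    ultimately obtain y where "y \<in> D" "y \<in> T \<inter> O' M" using O'(2) unfolding in_closure_of by (metis IntI)
    then show "\<exists>y. y \<in> B \<and> y \<in> T" unfolding B_def by blast
  qed
  moreover have BX: "B \<subseteq> topspace X" using D by (auto simp: B_def)
  ultimately obtain \<rho> :: "nat \<Rightarrow> 'a" where \<rho>: "range \<rho> \<subseteq> B" "limitin X \<rho> z sequentially"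
    using FU unfolding frechet_urysohn_space_def by blast
  then have "range \<rho> \<subseteq> D" unfolding B_def by blast
  then obtain i where i: "infinite {l. \<rho> l \<in> e i}" using catch \<rho> by blast
  have "{l. \<rho> l \<in> e i} \<subseteq> {l. \<rho> l \<in> (\<Union>n<i. O' n)}"
  proof
    fix l assume l: "l \<in> {l. \<rho> l \<in> e i}"
    obtain n where n: "\<rho> l \<in> O' n" using \<rho>(1) unfolding B_def by blast
    have "n < i"
    proof (rule ccontr)
      assume "\<not> n < i"
      then have "e i \<subseteq> R n" unfolding R_def by (intro UN_upper) simp
      then show False using O'(4)[of n] n l by blast
    qed
    then show "l \<in> {l. \<rho> l \<in> (\<Union>n<i. O' n)}" using n by blast
  qed
  then have "infinite {l. \<rho> l \<in> (\<Union>n<i. O' n)}" using i infinite_super by blast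
  then have "z \<in> X closure_of (\<Union>n<i. O' n)" by (rule limitin_frequently_in_closure[OF \<rho>(2)])
  also have "\<dots> = (\<Union>n<i. X closure_of O' n)" by (simp add: closure_of_Union)
  finally show False using O'(3) by blast
qed

text \<open>The compact sets come from closures of finite unions of members that meet
  \<open>D\<close>. They determine the closed subsets of a closed neighbourhood inside the interior
  of the closure of \<open>D\<close>, because each sequence converging to a point of it has
  infinitely many terms in one of them.\<close>

lemma k_omega_neighbourhood:
  assumes FU: "frechet_urysohn_space X" and pc: "point_countable X P" and PX: "\<Union>P \<subseteq> topspace X"
    and net: "seq_network X P" and pre: "\<And>Q. Q \<in> P \<Longrightarrow> seq_precompact X Q"
    and D: "countable D" "D \<subseteq> topspace X" and q: "q \<in> X interior_of (X closure_of D)"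
  shows "\<exists>U N. openin X U \<and> q \<in> U \<and> U \<subseteq> N \<and> N \<subseteq> topspace X \<and> k_omega_space (subtopology X N)"
proof -
  define PD where "PD = {Q \<in> P. Q \<inter> D \<noteq> {}}"
  have cPD: "countable PD" unfolding PD_def by (rule point_countable_meets_countable[OF pc D])
  define e where "e i = (if PD = {} then {} else from_nat_into PD i)" for i :: nat
  have e1: "Q \<in> range e" if "Q \<in> P" "Q \<inter> D \<noteq> {}" for Q
  proof -
    have "Q \<in> PD" using that by (simp add: PD_def)
    then have "PD \<noteq> {}" by blast
    then have "range (from_nat_into PD) = PD" using cPD by (intro range_from_nat_into)
    then show ?thesis using \<open>Q \<in> PD\<close> \<open>PD \<noteq> {}\<close> by (simp add: e_def)
  qed
  have e2: "e i \<in> P \<or> e i = {}" for i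
    using from_nat_into[of PD i] by (auto simp: e_def PD_def)
  have eX: "e i \<subseteq> topspace X" for i using e2[of i] PX by blast
  have ecomp: "compactin X (X closure_of e i)" for i
  proof (cases "e i = {}")
    case False
    then have "seq_precompact X (e i)" using e2[of i] pre by blast
    then show ?thesis by (intro seq_precompact_imp_compactin seq_precompact_closure) auto
  qed simp
  define K where "K n = X closure_of (\<Union>i\<le>n. e i)" for n
  have Kcl: "closedin X (K n)" for n by (simp add: K_def)
  have Kcomp: "compactin X (K n)" for n
    unfolding K_def by (auto simp: closure_of_Union intro!: compactin_Union ecomp)
  define W where "W = X interior_of (X closure_of D)"
  have "openin X W" "q \<in> W" using q by (auto simp: W_def)
  then obtain V where V: "openin X V" "q \<in> V" "X closure_of V \<subseteq> W" using shrink by metis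
  define N where "N = X closure_of V"
  have Ncl: "closedin X N" by (simp add: N_def)
  have NX: "N \<subseteq> topspace X" using Ncl by (rule closedin_subset)
  have "k_omega_space (subtopology X N)"
    unfolding k_omega_space_def
  proof (intro exI[of _ "\<lambda>n. K n \<inter> N"] conjI allI impI)
    show "compactin (subtopology X N) (K n \<inter> N)" for n
      using closed_Int_compactin[OF Ncl Kcomp[of n]] by (simp add: compactin_subtopology Int_commute)
    fix F assume F: "F \<subseteq> topspace (subtopology X N)"
      "\<forall>n. closedin (subtopology (subtopology X N) (K n \<inter> N)) (F \<inter> (K n \<inter> N))"
    have FN: "F \<subseteq> N" using F(1) by auto
    have FK: "closedin X (F \<inter> K n)" for n
    proof -
      have "closedin (subtopology X (K n \<inter> N)) (F \<inter> (K n \<inter> N))"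
        using F(2) by (simp add: subtopology_subtopology Int_absorb1 Int_absorb2 inf_commute)
      moreover have "closedin X (K n \<inter> N)" using Kcl Ncl by blast
      ultimately have "closedin X (F \<inter> (K n \<inter> N))" by (rule closedin_trans_full)
      moreover have "F \<inter> (K n \<inter> N) = F \<inter> K n" using FN by blast
      ultimately show ?thesis by simp
    qed
    have "closedin X F"
    proof (rule frechet_urysohn_closedin[OF FU])
      show "F \<subseteq> topspace X" using FN NX by blast
      fix \<tau> :: "nat \<Rightarrow> 'a" and z assume \<tau>: "\<And>n. \<tau> n \<in> F" "limitin X \<tau> z sequentially"
      have "z \<in> N" by (rule limitin_closedin[OF \<tau>(2) Ncl]) (use subsetD[OF FN \<tau>(1)] in auto)
      then have "z \<in> X interior_of (X closure_of D)" using V by (auto simp: N_def W_def)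
      then obtain n where "infinite {j. \<tau> j \<in> X closure_of (\<Union>i\<le>n. e i)}"
        using separable_nbhd_sequences[OF FU PX net D(2) e1 eX \<tau>(2)] by blast
      then have "infinite {j. \<tau> j \<in> F \<inter> K n}" using \<tau>(1) by (simp add: K_def)
      then have "z \<in> X closure_of (F \<inter> K n)" by (rule limitin_frequently_in_closure[OF \<tau>(2)])
      then show "z \<in> F" using FK[of n] closure_of_closedin by blast
    qed
    then show "closedin (subtopology X N) F" using FN by (simp add: closedin_closed_subtopology[OF Ncl])
  qed
  moreover have "V \<subseteq> N" unfolding N_def using V(1) by (simp add: closure_of_subset openin_subset)
  ultimately show ?thesis using V NX by blast
qed

lemma metrizable_or_countable_fan:
  assumes FU: "frechet_urysohn_space X" and pc: "point_countable X P" and PX: "\<Union>P \<subseteq> topspace X"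
    and net: "seq_network X P" and nm: "\<not> metrizable_space X"
  obtains p and s :: "nat \<Rightarrow> nat \<Rightarrow> 'a" where "p \<in> topspace X" "\<And>n. limitin X (s n) p sequentially"
    "\<And>n m. s n m \<in> topspace X - {p}"
    "\<And>i m z. strict_mono i \<Longrightarrow> \<not> limitin X (\<lambda>j::nat. s (i j) (m j)) z sequentially"
proof -
  have "\<not> interior_network X P" using interior_network_imp_metrizable[OF FU pc PX] nm by blast
  then obtain U p where U: "openin X U" "p \<in> U"
    and no: "\<not> (\<exists>F\<subseteq>P. finite F \<and> p \<in> X interior_of \<Union>F \<and> \<Union>F \<subseteq> U)"
    unfolding interior_network_def by blast
  have no': "p \<notin> X interior_of \<Union>F" if "F \<subseteq> P" "finite F" "\<Union>F \<subseteq> U" for F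
    using no that by blast
  have pX: "p \<in> topspace X" using U openin_subset by blast
  show thesis
    by (rule countable_fan_exists[OF FU pc net U no']) (assumption+, rule that[OF pX])
qed

lemma locally_k_omega_or_uncountable_fan:
  assumes FU: "frechet_urysohn_space X" and pc: "point_countable X P" and PX: "\<Union>P \<subseteq> topspace X"
    and net: "seq_network X P" and pre: "\<And>Q. Q \<in> P \<Longrightarrow> seq_precompact X Q"
    and nk: "\<not> locally_k_omega_space X"
  obtains q and S :: "(nat \<Rightarrow> 'a) set" where "q \<in> topspace X" "uncountable S"
    "\<And>s. s \<in> S \<Longrightarrow> limitin X s q sequentially" "\<And>s m. s \<in> S \<Longrightarrow> s m \<in> topspace X - {q}"
    "\<And>s t Q m n. \<lbrakk>s \<in> S; t \<in> S; Q \<in> P; s m \<in> Q; t n \<in> Q\<rbrakk> \<Longrightarrow> s = t"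
proof -
  obtain q where q: "q \<in> topspace X"
    and nq: "\<not> (\<exists>U N. openin X U \<and> q \<in> U \<and> U \<subseteq> N \<and> N \<subseteq> topspace X \<and> k_omega_space (subtopology X N))"
    using nk unfolding locally_k_omega_space_def by blast
  have no: "q \<notin> X interior_of (X closure_of D)" if "countable D" "D \<subseteq> topspace X" for D
    using k_omega_neighbourhood[OF FU pc PX net pre that] nq by blast
  have sep: "\<exists>D. countable D \<and> D \<subseteq> topspace X \<and> Q \<subseteq> X closure_of D" if Q: "Q \<in> P" for Q
  proof -
    have "compactin X (X closure_of Q)"
      by (intro seq_precompact_imp_compactin seq_precompact_closure pre Q) auto
    then obtain D where D: "countable D" "D \<subseteq> X closure_of Q" "X closure_of Q \<subseteq> X closure_of D"
      by (rule compactin_separable)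
    have "Q \<subseteq> X closure_of Q" using PX Q by (intro closure_of_subset) blast
    then show ?thesis using D closure_of_subset_topspace[of X Q] by blast
  qed
  show thesis
    by (rule uncountable_fan_exists[OF FU pc PX sep q no]) (assumption+, rule that[OF q])
qed

end

section \<open>Elements of length at most two\<close>

lemma prod_topology_euclidean: "prod_topology euclidean euclidean = (euclidean :: ('a::topological_space \<times> 'b::topological_space) topology)"
  unfolding topology_eq openin_prod_topology_alt open_openin[symmetric]
  by (metis open_prod_def mem_Sigma_iff prod.exhaust)

lemma reduced_length_eq_sum:
  assumes "finite K" "Poly_Mapping.keys g \<subseteq> K"
  shows "reduced_length g = (\<Sum>x\<in>K. nat \<bar>Poly_Mapping.lookup g x\<bar>)"
  unfolding reduced_length_def
  by (rule sum.mono_neutral_left[OF assms]) (auto simp: in_keys_iff)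

lemma reduced_length_add: "reduced_length (a + b) \<le> reduced_length a + reduced_length b"
proof -
  let ?K = "Poly_Mapping.keys a \<union> Poly_Mapping.keys b"
  have "reduced_length (a + b) = (\<Sum>x\<in>?K. nat \<bar>Poly_Mapping.lookup (a + b) x\<bar>)"
    by (rule reduced_length_eq_sum) (auto dest: subsetD[OF Poly_Mapping.keys_add])
  also have "\<dots> \<le> (\<Sum>x\<in>?K. nat \<bar>Poly_Mapping.lookup a x\<bar> + nat \<bar>Poly_Mapping.lookup b x\<bar>)"
    by (rule sum_mono) (simp add: Poly_Mapping.lookup_add)
  also have "\<dots> = reduced_length a + reduced_length b"
    by (simp add: sum.distrib reduced_length_eq_sum[of ?K a] reduced_length_eq_sum[of ?K b])
  finally show ?thesis .
qed

lemma reduced_length_minus [simp]: "reduced_length (- a) = reduced_length a"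
  by (simp add: reduced_length_def)

lemma reduced_length_frag_of [simp]: "reduced_length (frag_of x) = 1"
  by (simp add: reduced_length_def)

lemma reduced_length_0 [simp]: "reduced_length 0 = 0"
  by (simp add: reduced_length_def)

lemma reduced_length_pair:
  "reduced_length (frag_of x + frag_of y) \<le> 2" "reduced_length (frag_of x - frag_of y) \<le> 2"
  using reduced_length_add[of "frag_of x" "frag_of y"] reduced_length_add[of "frag_of x" "- frag_of y"] by auto

text \<open>Subtracting the sign of one coefficient removes exactly one letter and introduces
  none.\<close>

lemma reduced_length_reduce:
  assumes "g \<noteq> 0"
  obtains x h where "x \<in> Poly_Mapping.keys g" "Poly_Mapping.keys h \<subseteq> Poly_Mapping.keys g"
    "reduced_length g = Suc (reduced_length h)" "g = h + frag_of x \<or> g = h - frag_of x"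
proof -
  obtain x where x: "x \<in> Poly_Mapping.keys g" using assms by fastforce
  define c where "c = Poly_Mapping.lookup g x"
  have c: "c \<noteq> 0" using x by (simp add: c_def in_keys_iff)
  define h where "h = g - Poly_Mapping.single x (sgn c)"
  have lh: "Poly_Mapping.lookup h y = (if y = x then c - sgn c else Poly_Mapping.lookup g y)" for y
    by (simp add: h_def c_def lookup_minus lookup_single when_def)
  have kh: "Poly_Mapping.keys h \<subseteq> Poly_Mapping.keys g"
    using c by (auto simp: in_keys_iff lh c_def split: if_splits)
  have "reduced_length g = nat \<bar>c\<bar> + (\<Sum>y\<in>Poly_Mapping.keys g - {x}. nat \<bar>Poly_Mapping.lookup g y\<bar>)"
    unfolding reduced_length_def c_def by (rule sum.remove) (use x in auto)
  moreover have "reduced_length h = nat \<bar>c - sgn c\<bar> + (\<Sum>y\<in>Poly_Mapping.keys g - {x}. nat \<bar>Poly_Mapping.lookup g y\<bar>)"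
  proof -
    have "reduced_length h = (\<Sum>y\<in>Poly_Mapping.keys g. nat \<bar>Poly_Mapping.lookup h y\<bar>)"
      by (rule reduced_length_eq_sum[OF _ kh]) simp
    also have "\<dots> = nat \<bar>Poly_Mapping.lookup h x\<bar> + (\<Sum>y\<in>Poly_Mapping.keys g - {x}. nat \<bar>Poly_Mapping.lookup h y\<bar>)"
      by (rule sum.remove) (use x in auto)
    also have "(\<Sum>y\<in>Poly_Mapping.keys g - {x}. nat \<bar>Poly_Mapping.lookup h y\<bar>) =
        (\<Sum>y\<in>Poly_Mapping.keys g - {x}. nat \<bar>Poly_Mapping.lookup g y\<bar>)"
      by (rule sum.cong) (auto simp: lh)
    finally show ?thesis by (simp add: lh)
  qed
  moreover have "nat \<bar>c\<bar> = Suc (nat \<bar>c - sgn c\<bar>)" using c by (auto simp: sgn_if)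
  ultimately have "reduced_length g = Suc (reduced_length h)" by simp
  moreover have "g = h + frag_of x \<or> g = h - frag_of x"
    using c by (auto simp: h_def sgn_if single_uminus)
  ultimately show thesis using that x kh by blast
qed

lemma reduced_length_le_2_cases:
  assumes g: "Poly_Mapping.keys g \<subseteq> S" "reduced_length g \<le> 2"
  obtains "g = 0" | x where "x \<in> S" "g = frag_of x" | x where "x \<in> S" "g = - frag_of x"
    | x y where "x \<in> S" "y \<in> S" "g = frag_of x + frag_of y"
    | x y where "x \<in> S" "y \<in> S" "g = - (frag_of x + frag_of y)"
    | x y where "x \<in> S" "y \<in> S" "x \<noteq> y" "g = frag_of x - frag_of y"
proof (cases "g = 0")
  case False
  then obtain x h where x: "x \<in> Poly_Mapping.keys g" "Poly_Mapping.keys h \<subseteq> Poly_Mapping.keys g"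
    "reduced_length g = Suc (reduced_length h)" "g = h + frag_of x \<or> g = h - frag_of x"
    by (rule reduced_length_reduce)
  have xS: "x \<in> S" using x g by blast
  show thesis
  proof (cases "h = 0")
    case True
    then show thesis using x(4) xS that(2,3) by auto
  next
    case False
    then obtain y k where y: "y \<in> Poly_Mapping.keys h" "Poly_Mapping.keys k \<subseteq> Poly_Mapping.keys h"
      "reduced_length h = Suc (reduced_length k)" "h = k + frag_of y \<or> h = k - frag_of y"
      by (rule reduced_length_reduce)
    have yS: "y \<in> S" using x y g by blast
    have "reduced_length k = 0" using x y g by simp
    then have k: "k = 0" using reduced_length_reduce[of k] by (metis nat.distinct(1))
    consider "g = frag_of y + frag_of x" | "g = frag_of y - frag_of x" | "g = - (frag_of y + frag_of x)"
      | "g = frag_of x - frag_of y"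
      using x(4) y(4) k by fastforce
    then show thesis
    proof cases
      case 1 then show thesis using xS yS that(4) by blast
    next
      case 2 then show thesis using xS yS that(6) \<open>g \<noteq> 0\<close> by (metis diff_self)
    next
      case 3 then show thesis using xS yS that(5) by blast
    next
      case 4 then show thesis using xS yS that(6) \<open>g \<noteq> 0\<close> by (metis diff_self)
    qed
  qed
qed (use that in blast)

section \<open>Continuous homomorphisms on the free Abelian topological group\<close>

text \<open>The universal property for the additive group of a normed space. The reals give
  functionals that tell elements of length at most two apart; a space of bounded functions turns a
  pseudometric on \<open>X\<close> into a continuous seminorm on A(X).\<close>

lemma free_abelian_extension:
  fixes f :: "'a \<Rightarrow> 'b::real_normed_vector"
  assumes T: "free_abelian_topology X T" and f: "continuous_map X euclidean f"
  obtains F where "continuous_map T euclidean F" "\<And>x. x \<in> topspace X \<Longrightarrow> F (frag_of x) = f x"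
    "\<And>a b. a \<in> topspace T \<Longrightarrow> b \<in> topspace T \<Longrightarrow> F (a + b) = F a + F b"
    "\<And>a. a \<in> topspace T \<Longrightarrow> F (- a) = - F a"
proof -
  define H :: "'b monoid" where "H = \<lparr>carrier = UNIV, mult = (+), one = 0\<rparr>"
  have H [simp]: "carrier H = UNIV" "\<And>a b. a \<otimes>\<^bsub>H\<^esub> b = a + b" "\<one>\<^bsub>H\<^esub> = 0"
    by (auto simp: H_def)
  have cH: "comm_group H"
    by (rule comm_groupI) (auto simp: add.assoc add.commute intro: exI[of _ "- x" for x])
  interpret H: comm_group H by (rule cH)
  have inv [simp]: "inv\<^bsub>H\<^esub> a = - a" for a by (rule H.inv_equality) auto
  have "abelian_topological_group H euclidean"
    unfolding abelian_topological_group_def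
  proof (intro conjI cH)
    show "tychonoff_space (euclidean :: 'b topology)"
      unfolding tychonoff_space_def
      by (simp add: metrizable_imp_completely_regular_space metrizable_space_euclidean metrizable_imp_Hausdorff_space)
    have "continuous_on UNIV (\<lambda>z. fst z + snd z :: 'b)" by (intro continuous_intros)
    then show "continuous_map (prod_topology euclidean euclidean) euclidean (\<lambda>(x, y). x \<otimes>\<^bsub>H\<^esub> y)"
      by (simp add: prod_topology_euclidean case_prod_unfold)
    have "continuous_on UNIV (\<lambda>z. - z :: 'b)" by (intro continuous_intros)
    then show "continuous_map euclidean euclidean (\<lambda>x. inv\<^bsub>H\<^esub> x)" by simp
  qed simp
  then obtain F where F: "F \<in> hom (free_Abelian_group (topspace X)) H" "continuous_map T euclidean F"
    "\<And>x. x \<in> topspace X \<Longrightarrow> F (frag_of x) = f x"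
    using free_abelian_topology_universal[OF T _ f] by metis
  have tT: "topspace T = carrier (free_Abelian_group (topspace X))"
    using T by (simp add: free_abelian_topology_def abelian_topological_group_def)
  have add: "F (a + b) = F a + F b" if "a \<in> topspace T" "b \<in> topspace T" for a b
    using F(1) that unfolding tT hom_def by (auto simp: H)
  have "F (- a) = - F a" if a: "a \<in> topspace T" for a
  proof -
    have 0: "0 \<in> topspace T" "- a \<in> topspace T" using a by (auto simp: tT)
    have "F 0 = 0" using add[OF 0(1) 0(1)] by simp
    then have "F (- a) + F a = 0" using add[OF 0(2) a] by simp
    then show ?thesis by (simp add: eq_neg_iff_add_eq_0)
  qed
  then show thesis using that[of F] F add by blast
qed

locale free_stratified = stratified X G for X :: "'a topology" and G +
  fixes T :: "('a \<Rightarrow>\<^sub>0 int) topology"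
  assumes T: "free_abelian_topology X T"
begin

lemma topspace_T: "topspace T = {c. Poly_Mapping.keys c \<subseteq> topspace X}"
  using T by (auto simp: free_abelian_topology_def abelian_topological_group_def)

lemma in_T [simp]:
  "x \<in> topspace X \<Longrightarrow> frag_of x \<in> topspace T"
  "a \<in> topspace T \<Longrightarrow> b \<in> topspace T \<Longrightarrow> a + b \<in> topspace T"
  "a \<in> topspace T \<Longrightarrow> - a \<in> topspace T"
  "a \<in> topspace T \<Longrightarrow> b \<in> topspace T \<Longrightarrow> a - b \<in> topspace T"
  "0 \<in> topspace T"
  using Poly_Mapping.keys_add[of a b] keys_diff[of a b] by (auto simp: topspace_T)

lemma tychonoff_T: "tychonoff_space T"
  using T by (simp add: free_abelian_topology_def abelian_topological_group_def)

lemma continuous_T_frag_of: "continuous_map X T frag_of"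
  using T by (simp add: free_abelian_topology_def)

lemma continuous_T_add: "continuous_map (prod_topology T T) T (\<lambda>z. fst z + snd z)"
proof -
  have "continuous_map (prod_topology T T) T (\<lambda>(x, y). x \<otimes>\<^bsub>free_Abelian_group (topspace X)\<^esub> y)"
    using T by (simp add: free_abelian_topology_def abelian_topological_group_def)
  then show ?thesis by (simp add: case_prod_unfold)
qed

lemma continuous_T_minus: "continuous_map T T uminus"
proof -
  have "continuous_map T T (\<lambda>x. inv\<^bsub>free_Abelian_group (topspace X)\<^esub> x)"
    using T by (simp add: free_abelian_topology_def abelian_topological_group_def)
  then show ?thesis by (rule continuous_map_eq) (simp add: topspace_T)
qed

lemma continuous_plus:
  assumes "continuous_map Z T f" "continuous_map Z T g"
  shows "continuous_map Z T (\<lambda>z. f z + g z)"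
  using continuous_map_compose[OF continuous_map_pairedI[OF assms] continuous_T_add] by (simp add: o_def)

lemma continuous_uminus:
  assumes "continuous_map Z T f"
  shows "continuous_map Z T (\<lambda>z. - f z)"
  using continuous_map_compose[OF assms continuous_T_minus] by (simp add: o_def)

lemma real_extension:
  assumes f: "continuous_map X euclideanreal f"
  obtains F where "continuous_map T euclideanreal F" "F 0 = 0"
    "\<And>x. x \<in> topspace X \<Longrightarrow> F (frag_of x) = f x"
    "\<And>x. x \<in> topspace X \<Longrightarrow> F (- frag_of x) = - f x"
    "\<And>x y. x \<in> topspace X \<Longrightarrow> y \<in> topspace X \<Longrightarrow> F (frag_of x + frag_of y) = f x + f y"
    "\<And>x y. x \<in> topspace X \<Longrightarrow> y \<in> topspace X \<Longrightarrow> F (- (frag_of x + frag_of y)) = - f x - f y"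
    "\<And>x y. x \<in> topspace X \<Longrightarrow> y \<in> topspace X \<Longrightarrow> F (frag_of x - frag_of y) = f x - f y"
proof -
  obtain F where F: "continuous_map T euclideanreal F" "\<And>x. x \<in> topspace X \<Longrightarrow> F (frag_of x) = f x"
    "\<And>a b. a \<in> topspace T \<Longrightarrow> b \<in> topspace T \<Longrightarrow> F (a + b) = F a + F b"
    "\<And>a. a \<in> topspace T \<Longrightarrow> F (- a) = - F a"
    using free_abelian_extension[OF T f] by metis
  show thesis
  proof (rule that[of F])
    show "F 0 = 0" using F(3)[of 0 0] by simp
    show "F (frag_of x - frag_of y) = f x - f y" if "x \<in> topspace X" "y \<in> topspace X" for x y
      using F(3)[of "frag_of x" "- frag_of y"] that by (simp add: F(2,4))
    show "F (- frag_of x) = - f x" if "x \<in> topspace X" for x using that by (simp add: F(2,4))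
    show "F (frag_of x + frag_of y) = f x + f y" if "x \<in> topspace X" "y \<in> topspace X" for x y
      using that by (simp add: F(2,3))
    show "F (- (frag_of x + frag_of y)) = - f x - f y" if "x \<in> topspace X" "y \<in> topspace X" for x y
      using F(4)[of "frag_of x + frag_of y"] that by (simp add: F(2,3))
  qed (use F in auto)
qed

text \<open>The sum of the coefficients, that is, the homomorphism induced by the constant 1. Only
  its values on elements of length at most two are recorded, as these separate sums, single letters
  and differences.\<close>

definition degree :: "(('a \<Rightarrow>\<^sub>0 int) \<Rightarrow> real) \<Rightarrow> bool" where
  "degree D \<longleftrightarrow> continuous_map T euclideanreal D \<and> D 0 = 0 \<and>
     (\<forall>x\<in>topspace X. D (frag_of x) = 1 \<and> D (- frag_of x) = - 1 \<and>
       (\<forall>y\<in>topspace X. D (frag_of x + frag_of y) = 2 \<and> D (- (frag_of x + frag_of y)) = - 2 \<and>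
          D (frag_of x - frag_of y) = 0))"

lemma degreeD:
  assumes "degree D"
  shows "continuous_map T euclideanreal D" "D 0 = 0"
    "\<And>x. x \<in> topspace X \<Longrightarrow> D (frag_of x) = 1"
    "\<And>x. x \<in> topspace X \<Longrightarrow> D (- frag_of x) = - 1"
    "\<And>x y. x \<in> topspace X \<Longrightarrow> y \<in> topspace X \<Longrightarrow> D (frag_of x + frag_of y) = 2"
    "\<And>x y. x \<in> topspace X \<Longrightarrow> y \<in> topspace X \<Longrightarrow> D (- (frag_of x + frag_of y)) = - 2"
    "\<And>x y. x \<in> topspace X \<Longrightarrow> y \<in> topspace X \<Longrightarrow> D (frag_of x - frag_of y) = 0"
  using assms unfolding degree_def by blast+

lemma degree_exists: "\<exists>D. degree D"
proof -
  have "continuous_map X euclideanreal (\<lambda>_. 1)" by simp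
  then show ?thesis
  proof (rule real_extension)
    fix F :: "('a \<Rightarrow>\<^sub>0 int) \<Rightarrow> real"
    assume "continuous_map T euclideanreal F" "F 0 = 0"
      "\<And>x. x \<in> topspace X \<Longrightarrow> F (frag_of x) = 1" "\<And>x. x \<in> topspace X \<Longrightarrow> F (- frag_of x) = - 1"
      "\<And>x y. x \<in> topspace X \<Longrightarrow> y \<in> topspace X \<Longrightarrow> F (frag_of x + frag_of y) = 1 + 1"
      "\<And>x y. x \<in> topspace X \<Longrightarrow> y \<in> topspace X \<Longrightarrow> F (- (frag_of x + frag_of y)) = - 1 - 1"
      "\<And>x y. x \<in> topspace X \<Longrightarrow> y \<in> topspace X \<Longrightarrow> F (frag_of x - frag_of y) = 1 - 1"
    then show ?thesis unfolding degree_def by (intro exI[of _ F]) simp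
  qed
qed

section \<open>Neighbourhoods cut out by real homomorphisms\<close>

lemma bump_exists:
  assumes U: "openin X U" "x \<in> U"
  obtains f where "continuous_map X euclideanreal f" "f x = 1"
    "\<forall>y\<in>topspace X. 0 \<le> f y \<and> f y \<le> 1 \<and> (y \<notin> U \<longrightarrow> f y = 0)"
proof -
  have xX: "x \<in> topspace X" using U openin_subset by blast
  have c1: "closedin X (topspace X - U)" using U by blast
  have c2: "closedin X {x}" using t1 xX by (simp add: t1_space_closedin_singleton)
  have dj: "disjnt (topspace X - U) {x}" using U by (simp add: disjnt_def)
  obtain f where f: "continuous_map X (top_of_set {0..1::real}) f" "f ` (topspace X - U) \<subseteq> {0}" "f ` {x} \<subseteq> {1}"
    using Urysohn_lemma[OF normal c1 c2 dj zero_le_one] by metis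
  show thesis
  proof (rule that[of f])
    show "continuous_map X euclideanreal f" using f(1) by (simp add: continuous_map_in_subtopology)
    show "\<forall>y\<in>topspace X. 0 \<le> f y \<and> f y \<le> 1 \<and> (y \<notin> U \<longrightarrow> f y = 0)"
      using f(1,2) by (auto simp: continuous_map_in_subtopology)
  qed (use f in auto)
qed

lemma length_2_cases:
  assumes "g \<in> topspace T" "reduced_length g \<le> 2"
  obtains "g = 0" | x where "x \<in> topspace X" "g = frag_of x" | x where "x \<in> topspace X" "g = - frag_of x"
    | x y where "x \<in> topspace X" "y \<in> topspace X" "g = frag_of x + frag_of y"
    | x y where "x \<in> topspace X" "y \<in> topspace X" "g = - (frag_of x + frag_of y)"
    | x y where "x \<in> topspace X" "y \<in> topspace X" "x \<noteq> y" "g = frag_of x - frag_of y"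
proof -
  have k: "Poly_Mapping.keys g \<subseteq> topspace X" using assms(1) by (simp add: topspace_T)
  show thesis
    by (rule reduced_length_le_2_cases[OF k assms(2)])
      (erule that(1), erule (1) that(2), erule (1) that(3), erule (2) that(4), erule (2) that(5), erule (3) that(6))
qed

text \<open>A degree above 3/2 leaves only sums of two letters. If \<open>x = y\<close>, one bump
  with total above 3/2 forces both letters into \<open>U \<inter> V\<close>, its values being at
  most 1. If \<open>x \<noteq> y\<close>, two bumps with disjoint supports and totals above 1/2
  force one letter into \<open>U\<close> and the other into \<open>V\<close>; commutativity makes
  the order irrelevant.\<close>

lemma nbhd_sum:
  assumes U: "openin X U" "x \<in> U" and V: "openin X V" "y \<in> V"
  obtains W where "openin T W" "frag_of x + frag_of y \<in> W"
    "\<And>g. g \<in> W \<Longrightarrow> reduced_length g \<le> 2 \<Longrightarrow> \<exists>u\<in>U. \<exists>v\<in>V. g = frag_of u + frag_of v"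
proof -
  have UX: "U \<subseteq> topspace X" "V \<subseteq> topspace X" using U V openin_subset by auto
  obtain D where "degree D" using degree_exists by metis
  note D = degreeD[OF this]
  have D2: "\<exists>u\<in>topspace X. \<exists>v\<in>topspace X. g = frag_of u + frag_of v"
    if "g \<in> topspace T" "reduced_length g \<le> 2" "D g > 3/2" for g
    using that(1,2) by (rule length_2_cases) (use that(3) D(2-) in auto)
  show thesis
  proof (cases "x = y")
    case True
    have "openin X (U \<inter> V)" "x \<in> U \<inter> V" using U V True by auto
    then obtain f where f: "continuous_map X euclideanreal f" "f x = 1"
      "\<forall>y\<in>topspace X. 0 \<le> f y \<and> f y \<le> 1 \<and> (y \<notin> U \<inter> V \<longrightarrow> f y = 0)"
      by (rule bump_exists)
    obtain F where F: "continuous_map T euclideanreal F"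
      "\<And>x y. x \<in> topspace X \<Longrightarrow> y \<in> topspace X \<Longrightarrow> F (frag_of x + frag_of y) = f x + f y"
      using real_extension[OF f(1)] by metis
    show thesis
    proof (rule that[of "{g \<in> topspace T. 3/2 < D g} \<inter> {g \<in> topspace T. 3/2 < F g}"])
      show "openin T ({g \<in> topspace T. 3/2 < D g} \<inter> {g \<in> topspace T. 3/2 < F g})"
        by (intro openin_Int openin_less_preimage D F)
      show "frag_of x + frag_of y \<in> {g \<in> topspace T. 3/2 < D g} \<inter> {g \<in> topspace T. 3/2 < F g}"
        using U V UX True f(2) D(5) F(2) by auto
      fix g assume g: "g \<in> {g \<in> topspace T. 3/2 < D g} \<inter> {g \<in> topspace T. 3/2 < F g}" "reduced_length g \<le> 2"
      then obtain u v where uv: "u \<in> topspace X" "v \<in> topspace X" "g = frag_of u + frag_of v"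
        using D2 by blast
      have "f u + f v > 3/2" using g uv F(2) by auto
      then have "u \<in> U \<inter> V" "v \<in> U \<inter> V" using bspec[OF f(3) uv(1)] bspec[OF f(3) uv(2)] by force+
      then show "\<exists>u\<in>U. \<exists>v\<in>V. g = frag_of u + frag_of v" using uv by blast
    qed
  next
    case False
    then obtain U0 V0 where UV0: "openin X U0" "openin X V0" "x \<in> U0" "y \<in> V0" "disjnt U0 V0"
      using Hausdorff U V UX unfolding Hausdorff_space_def by (metis subsetD)
    have "openin X (U \<inter> U0)" "x \<in> U \<inter> U0" using U UV0 by auto
    then obtain f where f: "continuous_map X euclideanreal f" "f x = 1"
      "\<forall>y\<in>topspace X. 0 \<le> f y \<and> f y \<le> 1 \<and> (y \<notin> U \<inter> U0 \<longrightarrow> f y = 0)"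
      by (rule bump_exists)
    have "openin X (V \<inter> V0)" "y \<in> V \<inter> V0" using V UV0 by auto
    then obtain f' where f': "continuous_map X euclideanreal f'" "f' y = 1"
      "\<forall>y\<in>topspace X. 0 \<le> f' y \<and> f' y \<le> 1 \<and> (y \<notin> V \<inter> V0 \<longrightarrow> f' y = 0)"
      by (rule bump_exists)
    obtain F where F: "continuous_map T euclideanreal F"
      "\<And>x y. x \<in> topspace X \<Longrightarrow> y \<in> topspace X \<Longrightarrow> F (frag_of x + frag_of y) = f x + f y"
      using real_extension[OF f(1)] by metis
    obtain F' where F': "continuous_map T euclideanreal F'"
      "\<And>x y. x \<in> topspace X \<Longrightarrow> y \<in> topspace X \<Longrightarrow> F' (frag_of x + frag_of y) = f' x + f' y"
      using real_extension[OF f'(1)] by metis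
    define W where "W = {g \<in> topspace T. 3/2 < D g} \<inter> ({g \<in> topspace T. 1/2 < F g} \<inter> {g \<in> topspace T. 1/2 < F' g})"
    show thesis
    proof (rule that[of W])
      show "openin T W" unfolding W_def
        by (intro openin_Int openin_less_preimage D F F')
      have "x \<in> topspace X" "y \<in> topspace X" using U V UX by auto
      then show "frag_of x + frag_of y \<in> W"
        unfolding W_def using f(2) f'(2) f(3) f'(3) D(5) F(2) F'(2) by auto
      fix g assume g: "g \<in> W" "reduced_length g \<le> 2"
      then obtain u v where uv: "u \<in> topspace X" "v \<in> topspace X" "g = frag_of u + frag_of v"
        using D2[of g] unfolding W_def by blast
      have "f u + f v > 1/2" "f' u + f' v > 1/2" using g uv F(2) F'(2) by (auto simp: W_def)
      then have "u \<in> U \<inter> U0 \<or> v \<in> U \<inter> U0" "u \<in> V \<inter> V0 \<or> v \<in> V \<inter> V0"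
        using bspec[OF f(3) uv(1)] bspec[OF f(3) uv(2)] bspec[OF f'(3) uv(1)] bspec[OF f'(3) uv(2)] by force+
      then have "u \<in> U \<and> v \<in> V \<or> v \<in> U \<and> u \<in> V" using UV0(5) by (auto simp: disjnt_def)
      then show "\<exists>u\<in>U. \<exists>v\<in>V. g = frag_of u + frag_of v" using uv(3) by (metis add.commute)
    qed
  qed
qed

end

section \<open>Failure of the k_R-property\<close>

context free_stratified
begin

text \<open>Otherwise the range of \<open>u\<close> is closed and discrete, so a non-negative
  continuous \<open>g\<close> exists with \<open>g (u j) \<ge> j\<close>. The induced homomorphism
  is then unbounded on \<open>K\<close>: the summand \<open>g (v j)\<close> cannot compensate, being
  non-negative.\<close>

lemma compact_support_subseq:
  assumes FU: "frechet_urysohn_space X" and K: "compactin T K"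
    and uv: "\<And>j::nat. u j \<in> topspace X" "\<And>j. v j \<in> topspace X" "\<And>j. frag_of (u j) + frag_of (v j) \<in> K"
  shows "\<not> no_convergent_subseq X u"
proof
  assume nc: "no_convergent_subseq X u"
  then have nc': "\<not> limitin X (u \<circ> r) z sequentially" if "strict_mono r" for r z
    using that by (simp add: no_convergent_subseq_def)
  have ru: "range u \<subseteq> topspace X" using uv by blast
  have lf: "\<exists>O'. openin X O' \<and> z \<in> O' \<and> finite {j. u j \<in> O'}" if "z \<in> topspace X" for z
    using frechet_urysohn_locally_finite[OF FU t1 ru nc' that] .
  have cl: "closedin X A" if A: "A \<subseteq> range u" for A
    unfolding closedin_def
  proof (intro conjI)
    show "A \<subseteq> topspace X" using A ru by blast
    show "openin X (topspace X - A)"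
    proof (subst openin_subopen, intro ballI)
      fix z assume z: "z \<in> topspace X - A"
      then obtain O' where O': "openin X O'" "z \<in> O'" "finite {j. u j \<in> O'}" using lf by blast
      have "finite (u ` {j. u j \<in> O'} \<inter> A)" "u ` {j. u j \<in> O'} \<inter> A \<subseteq> topspace X"
        using O'(3) A ru by auto
      then have "closedin X (u ` {j. u j \<in> O'} \<inter> A)"
        using t1 unfolding t1_space_closedin_finite by simp
      then have "openin X (O' - (u ` {j. u j \<in> O'} \<inter> A))" using O'(1) by (simp add: openin_diff)
      moreover have "O' - (u ` {j. u j \<in> O'} \<inter> A) \<subseteq> topspace X - A"
        using A openin_subset[OF O'(1)] by blast
      ultimately show "\<exists>W. openin X W \<and> z \<in> W \<and> W \<subseteq> topspace X - A" using z O'(2) by blast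
    qed
  qed
  have fin: "finite {j. u j = c}" if "c \<in> topspace X" for c
    using limitin_subseq_const[OF that, of u] nc' by blast
  \<comment> \<open>A value may be repeated, though only finitely often; the largest index keeps
    \<open>f (u j) \<ge> j\<close>.\<close>
  define f where "f c = real (Max {j. u j = c})" for c
  have fu: "f (u j) \<ge> real j" for j
    unfolding f_def using fin[OF uv(1)[of j]] by (simp add: Max_ge)
  have fc: "continuous_map (subtopology X (range u)) euclideanreal f"
    unfolding continuous_map_closedin
  proof (intro conjI allI impI)
    fix C :: "real set" 
    have "{x \<in> range u. f x \<in> C} = {x \<in> range u. f x \<in> C} \<inter> range u" by blast
    moreover have "closedin X {x \<in> range u. f x \<in> C}" by (rule cl) blast
    ultimately have "closedin (subtopology X (range u)) {x \<in> range u. f x \<in> C}"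
      unfolding closedin_subtopology by blast
    then show "closedin (subtopology X (range u)) {x \<in> topspace (subtopology X (range u)). f x \<in> C}"
      using ru by (simp add: Int_absorb1)
  qed simp
  have fr: "f ` range u \<subseteq> {0..}" by (auto simp: f_def)
  have ne: "{0::real..} \<noteq> {}" by simp
  obtain g where g: "continuous_map X euclideanreal g" "g ` topspace X \<subseteq> {0..}" "\<And>x. x \<in> range u \<Longrightarrow> g x = f x"
    using Tietze_extension_realinterval[OF normal cl[OF subset_refl] is_interval_ci ne fc fr] by metis
  obtain F where F: "continuous_map T euclideanreal F"
    "\<And>x y. x \<in> topspace X \<Longrightarrow> y \<in> topspace X \<Longrightarrow> F (frag_of x + frag_of y) = g x + g y"
    using real_extension[OF g(1)] by metis
  have "compactin euclideanreal (F ` K)" using image_compactin[OF K F(1)] .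
  then have "bounded (F ` K)" by (simp add: compact_imp_bounded)
  then obtain B where B: "\<And>x. x \<in> K \<Longrightarrow> \<bar>F x\<bar> \<le> B" unfolding bounded_iff by auto
  obtain j :: nat where j: "real j > B" using reals_Archimedean2 by blast
  have "g (v j) \<ge> 0" using g(2) uv(2) by auto
  then have "F (frag_of (u j) + frag_of (v j)) \<ge> real j"
    using F(2)[OF uv(1,2)] g(3)[of "u j"] fu[of j] by simp
  then show False using B[OF uv(3)[of j]] j by simp
qed

lemma frag_sum_eq:
  assumes "frag_of u + frag_of v = frag_of p + frag_of q"
  shows "p = u \<or> p = v"
proof -
  have "Poly_Mapping.lookup (frag_of u + frag_of v) p = Poly_Mapping.lookup (frag_of p + frag_of q) p"
    using assms by simp
  then show ?thesis by (auto simp: Poly_Mapping.lookup_add split: if_splits)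
qed

text \<open>The test function is the sum of bumps at \<open>a e + b e\<close>. Compact sets meet only finitely many
  of their supports, but the bumps accumulate at \<open>p + q\<close>.\<close>

lemma not_k_R_level_2:
  fixes a b :: "'e \<Rightarrow> 'a"
  assumes FU: "frechet_urysohn_space X" and pq: "p \<in> topspace X" "q \<in> topspace X"
    and U: "\<And>e. e \<in> E \<Longrightarrow> openin X (U e) \<and> a e \<in> U e \<and> p \<notin> U e"
    and V: "\<And>e. e \<in> E \<Longrightarrow> openin X (V e) \<and> b e \<in> V e \<and> p \<notin> V e"
    and cf: "\<And>\<epsilon> u v z w. \<lbrakk>inj \<epsilon>; \<And>j::nat. \<epsilon> j \<in> E \<and> u j \<in> U (\<epsilon> j) \<and> v j \<in> V (\<epsilon> j);
        limitin X u z sequentially; limitin X v w sequentially\<rbrakk> \<Longrightarrow> False"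
    and acc: "\<And>U' V'. \<lbrakk>openin X U'; p \<in> U'; openin X V'; q \<in> V'\<rbrakk> \<Longrightarrow> \<exists>e\<in>E. a e \<in> U' \<and> b e \<in> V'"
  shows "\<not> k_R_space (free_abelian_level T 2)"
proof
  assume kR: "k_R_space (free_abelian_level T 2)"
  define A2 where "A2 = {g \<in> topspace T. reduced_length g \<le> 2}"
  have lev: "free_abelian_level T 2 = subtopology T A2" by (simp add: free_abelian_level_def A2_def)
  define m where "m x y = frag_of x + frag_of y" for x y :: 'a
  have mA2: "m x y \<in> A2" if "x \<in> topspace X" "y \<in> topspace X" for x y
    using that reduced_length_pair(1) by (simp add: m_def A2_def)
  have UX: "U e \<subseteq> topspace X" "V e \<subseteq> topspace X" if "e \<in> E" for e
    using U[OF that] V[OF that] by (auto dest: openin_subset)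
  have "\<exists>W. openin T W \<and> m (a e) (b e) \<in> W \<and> (\<forall>g\<in>W. reduced_length g \<le> 2 \<longrightarrow> (\<exists>u\<in>U e. \<exists>v\<in>V e. g = m u v))" if e: "e \<in> E" for e
  proof -
    have "openin X (U e)" "a e \<in> U e" "openin X (V e)" "b e \<in> V e" using U V e by auto
    then obtain W where "openin T W" "frag_of (a e) + frag_of (b e) \<in> W"
      "\<And>g. g \<in> W \<Longrightarrow> reduced_length g \<le> 2 \<Longrightarrow> \<exists>u\<in>U e. \<exists>v\<in>V e. g = frag_of u + frag_of v"
      using nbhd_sum by metis
    then show ?thesis unfolding m_def by blast
  qed
  then obtain W where W: "\<And>e. e \<in> E \<Longrightarrow> openin T (W e)" "\<And>e. e \<in> E \<Longrightarrow> m (a e) (b e) \<in> W e"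
    "\<And>e g. e \<in> E \<Longrightarrow> g \<in> W e \<Longrightarrow> reduced_length g \<le> 2 \<Longrightarrow> \<exists>u\<in>U e. \<exists>v\<in>V e. g = m u v"
    by metis
  have "\<exists>\<phi>::_ \<Rightarrow> real. continuous_map T euclideanreal \<phi> \<and> \<phi> (m (a e) (b e)) = 1 \<and>
      (\<forall>g\<in>topspace T. 0 \<le> \<phi> g \<and> (g \<notin> W e \<longrightarrow> \<phi> g = 0))" if e: "e \<in> E" for e
  proof -
    have "closedin T (topspace T - W e)" "m (a e) (b e) \<in> topspace T - (topspace T - W e)"
      using W(1,2)[OF e] openin_subset by auto
    then obtain f :: "_ \<Rightarrow> real" where f: "continuous_map T (top_of_set {0..1}) f" "f (m (a e) (b e)) = 0"
      "f ` (topspace T - W e) \<subseteq> {1}"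
      using tychonoff_T unfolding tychonoff_space_def completely_regular_space_def by metis
    have f01: "f g \<in> {0..1}" if "g \<in> topspace T" for g
      using f(1) that by (auto simp: continuous_map_in_subtopology)
    show ?thesis
    proof (intro exI[of _ "\<lambda>g. 1 - f g"] conjI ballI impI)
      have "continuous_map T euclideanreal f" using f(1) by (simp add: continuous_map_in_subtopology)
      then show "continuous_map T euclideanreal (\<lambda>g. 1 - f g)" by (intro continuous_intros) auto
      show "0 \<le> 1 - f g" if "g \<in> topspace T" for g using f01[OF that] by simp
      show "1 - f g = 0" if "g \<in> topspace T" "g \<notin> W e" for g using f(3) that by auto
    qed (simp add: f(2))
  qed
  then obtain \<phi> :: "'e \<Rightarrow> ('a \<Rightarrow>\<^sub>0 int) \<Rightarrow> real" where
    \<phi>c: "\<And>e. e \<in> E \<Longrightarrow> continuous_map T euclideanreal (\<phi> e)" and \<phi>1: "\<And>e. e \<in> E \<Longrightarrow> \<phi> e (m (a e) (b e)) = 1"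
    and \<phi>0: "\<And>e g. e \<in> E \<Longrightarrow> g \<in> topspace T \<Longrightarrow> 0 \<le> \<phi> e g \<and> (g \<notin> W e \<longrightarrow> \<phi> e g = 0)"
    by metis
  have \<phi>m: "\<exists>u\<in>U e. \<exists>v\<in>V e. g = m u v" if "e \<in> E" "g \<in> A2" "\<phi> e g \<noteq> 0" for e g
    using W(3)[OF that(1), of g] \<phi>0[OF that(1), of g] that by (auto simp: A2_def)
  \<comment> \<open>The indices of bumps that do not vanish on \<open>K\<close>. Infinitely many of
    them would give sums of \<open>u j\<close> and \<open>v j\<close> in \<open>K\<close> with
    distinct indices; convergent subsequences, first of \<open>u\<close> and then of
    \<open>v\<close>, contradict \<open>cf\<close>.\<close>
  define S where "S K = {e \<in> E. \<exists>g\<in>K. \<phi> e g \<noteq> 0}" for K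
  have finS: "finite (S K)" if K: "compactin T K" "K \<subseteq> A2" for K
  proof (rule ccontr)
    assume "infinite (S K)"
    then obtain \<epsilon> :: "nat \<Rightarrow> 'e" where \<epsilon>: "inj \<epsilon>" "range \<epsilon> \<subseteq> S K"
      using infinite_countable_subset by blast
    have "\<exists>u v. u \<in> U (\<epsilon> j) \<and> v \<in> V (\<epsilon> j) \<and> m u v \<in> K" for j
    proof -
      have "\<epsilon> j \<in> S K" using \<epsilon>(2) by blast
      then obtain g where g: "\<epsilon> j \<in> E" "g \<in> K" "\<phi> (\<epsilon> j) g \<noteq> 0" by (auto simp: S_def)
      then have "g \<in> A2" using K(2) by blast
      then show ?thesis using \<phi>m[OF g(1) _ g(3)] g(2) by blast
    qed
    then obtain u v where uv: "\<And>j. u j \<in> U (\<epsilon> j)" "\<And>j. v j \<in> V (\<epsilon> j)" "\<And>j. m (u j) (v j) \<in> K" by metis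
    have \<epsilon>E: "\<epsilon> j \<in> E" for j using \<epsilon>(2) by (auto simp: S_def)
    have uvX: "u j \<in> topspace X" "v j \<in> topspace X" for j using uv(1,2)[of j] UX[OF \<epsilon>E[of j]] by auto
    have "\<not> no_convergent_subseq X u"
      by (rule compact_support_subseq[OF FU K(1) uvX]) (use uv(3) in \<open>simp add: m_def\<close>)
    then obtain r z where r: "strict_mono r" "limitin X (u \<circ> r) z sequentially"
      unfolding no_convergent_subseq_def by blast
    have "\<not> no_convergent_subseq X (v \<circ> r)"
      by (rule compact_support_subseq[OF FU K(1), where v = "u \<circ> r"])
        (use uv(3) uvX in \<open>simp_all add: m_def add.commute\<close>)
    then obtain s w where s: "strict_mono s" "limitin X (v \<circ> r \<circ> s) w sequentially"
      unfolding no_convergent_subseq_def by blast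
    have "limitin X (u \<circ> r \<circ> s) z sequentially" using limitin_subsequence[OF s(1) r(2)] by (simp add: o_assoc)
    moreover have "inj (\<epsilon> \<circ> r \<circ> s)"
      using \<epsilon>(1) r(1) s(1) by (intro inj_compose strict_mono_imp_inj_on)
    ultimately show False
      using cf[of "\<epsilon> \<circ> r \<circ> s" "u \<circ> r \<circ> s" "v \<circ> r \<circ> s" z w] s(2) uv \<epsilon>E by simp
  qed
  \<comment> \<open>Singletons are compact, so the sum is finite. On a compact \<open>K\<close> it
    can be taken over the fixed finite set \<open>S K\<close>, whence continuity there.\<close>
  define \<Phi> where "\<Phi> g = (\<Sum>e\<in>S {g}. \<phi> e g)" for g
  have \<Phi>K: "\<Phi> g = (\<Sum>e\<in>S K. \<phi> e g)" if K: "compactin T K" "K \<subseteq> A2" "g \<in> K" for K g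
    unfolding \<Phi>_def
    by (rule sum.mono_neutral_left[OF finS[OF K(1,2)]]) (use K(3) in \<open>auto simp: S_def\<close>)
  have "continuous_map (subtopology T A2) euclideanreal \<Phi>"
  proof -
    have "continuous_map (subtopology (subtopology T A2) K) euclideanreal \<Phi>" if K: "compactin (subtopology T A2) K" for K
    proof -
      have K': "compactin T K" "K \<subseteq> A2" using K by (auto simp: compactin_subtopology)
      have "continuous_map (subtopology T K) euclideanreal (\<lambda>g. \<Sum>e\<in>S K. \<phi> e g)"
        by (intro continuous_map_sum continuous_map_from_subtopology \<phi>c finS[OF K']) (simp add: S_def)
      then have "continuous_map (subtopology T K) euclideanreal \<Phi>"
        by (rule continuous_map_eq) (use \<Phi>K[OF K'] in auto)
      then show ?thesis using K'(2) by (simp add: subtopology_subtopology Int_absorb1)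
    qed
    then show ?thesis using kR unfolding k_R_space_def lev by blast
  qed
  moreover have "continuous_map (prod_topology X X) (subtopology T A2) (\<lambda>z. m (fst z) (snd z))"
    unfolding continuous_map_in_subtopology
  proof (intro conjI)
    show "continuous_map (prod_topology X X) T (\<lambda>z. m (fst z) (snd z))"
      unfolding m_def
      by (intro continuous_plus continuous_map_compose[OF _ continuous_T_frag_of, unfolded o_def]
          continuous_map_fst continuous_map_snd)
    show "(\<lambda>z. m (fst z) (snd z)) \<in> topspace (prod_topology X X) \<rightarrow> A2" using mA2 by auto
  qed
  ultimately have "continuous_map (prod_topology X X) euclideanreal (\<Phi> \<circ> (\<lambda>z. m (fst z) (snd z)))"
    by (rule continuous_map_compose[rotated])
  from openin_less_preimage(2)[OF this, of 1]
  have oP: "openin (prod_topology X X) {z \<in> topspace (prod_topology X X). \<Phi> (m (fst z) (snd z)) < 1}"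
    by simp
  \<comment> \<open>A bump is non-zero only at sums of two letters both different from
    \<open>p\<close>, hence not at \<open>p + q\<close>. So \<open>\<Phi>\<close> is 0 at
    \<open>p + q\<close> but at least 1 at each \<open>a e + b e\<close>.\<close>
  have "S {m p q} = {}"
  proof (rule equals0I)
    fix e assume "e \<in> S {m p q}"
    then have e: "e \<in> E" "\<phi> e (m p q) \<noteq> 0" by (auto simp: S_def)
    then obtain u v where uv: "u \<in> U e" "v \<in> V e" "m p q = m u v" using \<phi>m mA2[OF pq] by blast
    then have "p = u \<or> p = v" unfolding m_def by (intro frag_sum_eq[of u v p q]) simp
    then show False using U[OF e(1)] V[OF e(1)] uv by blast
  qed
  then have "(p, q) \<in> {z \<in> topspace (prod_topology X X). \<Phi> (m (fst z) (snd z)) < 1}"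
    using pq by (simp add: \<Phi>_def)
  then obtain U' V' where UV': "openin X U'" "openin X V'" "p \<in> U'" "q \<in> V'"
    "U' \<times> V' \<subseteq> {z \<in> topspace (prod_topology X X). \<Phi> (m (fst z) (snd z)) < 1}"
    using oP unfolding openin_prod_topology_alt by meson
  then obtain e where e: "e \<in> E" "a e \<in> U'" "b e \<in> V'" using acc by metis
  have "a e \<in> U e" "b e \<in> V e" using U V e(1) by auto
  then have ab: "m (a e) (b e) \<in> A2" using mA2 UX[OF e(1)] by blast
  then have sing: "compactin T {m (a e) (b e)}" by (simp add: A2_def)
  have "e \<in> S {m (a e) (b e)}" using \<phi>1[OF e(1)] e(1) by (simp add: S_def)
  then have "\<phi> e (m (a e) (b e)) \<le> \<Phi> (m (a e) (b e))"
    unfolding \<Phi>_def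
    by (rule member_le_sum) (use finS[OF sing] ab \<phi>0 in \<open>auto simp: S_def A2_def\<close>)
  moreover have "\<Phi> (m (a e) (b e)) < 1" using UV'(5) e by auto
  ultimately show False using \<phi>1[OF e(1)] by simp
qed

end

section \<open>The k-property\<close>

context free_stratified
begin

text \<open>A degree near 0 leaves 0 and the differences. The bump at \<open>x\<close> vanishes at
  \<open>y\<close>, so it has the value 1 at \<open>x - y\<close>; the threshold 1/2 excludes 0 and
  puts the positive letter into \<open>U\<close>. The bump at \<open>y\<close> treats the negative
  letter in the same way.\<close>

lemma nbhd_diff:
  assumes U: "openin X U" "x \<in> U" and V: "openin X V" "y \<in> V" and xy: "x \<noteq> y"
  obtains W where "openin T W" "frag_of x - frag_of y \<in> W"
    "\<forall>g\<in>W. reduced_length g \<le> 2 \<longrightarrow> (\<exists>u\<in>U. \<exists>v\<in>V. g = frag_of u - frag_of v)"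
proof -
  have UX: "U \<subseteq> topspace X" "V \<subseteq> topspace X" using U V openin_subset by auto
  then have xyX: "x \<in> topspace X" "y \<in> topspace X" using U V by auto
  obtain D where "degree D" using degree_exists by metis
  note D = degreeD[OF this]
  have "openin X (U - {y})" "x \<in> U - {y}" using U xy xyX t1 
    by (auto simp: t1_space_closedin_singleton intro!: openin_diff)
  then obtain f where f: "continuous_map X euclideanreal f" "f x = 1"
    "\<forall>z\<in>topspace X. 0 \<le> f z \<and> f z \<le> 1 \<and> (z \<notin> U - {y} \<longrightarrow> f z = 0)"
    by (rule bump_exists)
  have "openin X (V - {x})" "y \<in> V - {x}" using V xy xyX t1
    by (auto simp: t1_space_closedin_singleton intro!: openin_diff)
  then obtain f' where f': "continuous_map X euclideanreal f'" "f' y = 1"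
    "\<forall>z\<in>topspace X. 0 \<le> f' z \<and> f' z \<le> 1 \<and> (z \<notin> V - {x} \<longrightarrow> f' z = 0)"
    by (rule bump_exists)
  obtain F where F: "continuous_map T euclideanreal F" "F 0 = 0"
    "\<And>x y. x \<in> topspace X \<Longrightarrow> y \<in> topspace X \<Longrightarrow> F (frag_of x - frag_of y) = f x - f y"
    using real_extension[OF f(1)] by metis
  obtain F' where F': "continuous_map T euclideanreal F'"
    "\<And>x y. x \<in> topspace X \<Longrightarrow> y \<in> topspace X \<Longrightarrow> F' (frag_of x - frag_of y) = f' x - f' y"
    using real_extension[OF f'(1)] by metis
  define W where "W = ({g \<in> topspace T. -1/2 < D g} \<inter> {g \<in> topspace T. D g < 1/2}) \<inter>
      ({g \<in> topspace T. 1/2 < F g} \<inter> {g \<in> topspace T. F' g < -1/2})"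
  show thesis
  proof (rule that[of W])
    show "openin T W" unfolding W_def by (intro openin_Int openin_less_preimage D F F')
    have "f y = 0" "f' x = 0" using f(3) f'(3) xyX by auto
    then show "frag_of x - frag_of y \<in> W"
      unfolding W_def using f(2) f'(2) D(7) F(3) F'(2) xyX by auto
    show "\<forall>g\<in>W. reduced_length g \<le> 2 \<longrightarrow> (\<exists>u\<in>U. \<exists>v\<in>V. g = frag_of u - frag_of v)"
    proof (intro ballI impI)
      fix g assume g: "g \<in> W" "reduced_length g \<le> 2"
      have gT: "g \<in> topspace T" and Dg: "-1/2 < D g" "D g < 1/2" and Fg: "1/2 < F g" "F' g < -1/2"
        using g(1) by (auto simp: W_def)
      have "\<exists>u\<in>topspace X. \<exists>v\<in>topspace X. g = frag_of u - frag_of v"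
        using gT g(2) by (rule length_2_cases) (use Dg Fg D(3-6) F(2) in auto)
      then obtain u v where uv: "u \<in> topspace X" "v \<in> topspace X" "g = frag_of u - frag_of v" by blast
      have "f u - f v > 1/2" "f' u - f' v < -1/2" using Fg uv F(3) F'(2) by auto
      then have "u \<in> U" "v \<in> V"
        using bspec[OF f(3) uv(1)] bspec[OF f(3) uv(2)] bspec[OF f'(3) uv(1)] bspec[OF f'(3) uv(2)] by force+
      then show "\<exists>u\<in>U. \<exists>v\<in>V. g = frag_of u - frag_of v" using uv by blast
    qed
  qed
qed

lemma nbhd_single:
  assumes U: "openin X U" "x \<in> U"
  obtains W where "openin T W" "frag_of x \<in> W"
    "\<forall>g\<in>W. reduced_length g \<le> 2 \<longrightarrow> (\<exists>u\<in>U. g = frag_of u)"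
proof -
  have xX: "x \<in> topspace X" using U openin_subset by auto
  obtain D where "degree D" using degree_exists by metis
  note D = degreeD[OF this]
  obtain f where f: "continuous_map X euclideanreal f" "f x = 1"
    "\<forall>z\<in>topspace X. 0 \<le> f z \<and> f z \<le> 1 \<and> (z \<notin> U \<longrightarrow> f z = 0)"
    using U by (rule bump_exists)
  obtain F where F: "continuous_map T euclideanreal F"
    "\<And>x. x \<in> topspace X \<Longrightarrow> F (frag_of x) = f x"
    using real_extension[OF f(1)] by metis
  define W where "W = ({g \<in> topspace T. 1/2 < D g} \<inter> {g \<in> topspace T. D g < 3/2}) \<inter> {g \<in> topspace T. 1/2 < F g}"
  show thesis
  proof (rule that[of W])
    show "openin T W" unfolding W_def by (intro openin_Int openin_less_preimage D F)
    show "frag_of x \<in> W" unfolding W_def using f(2) D(3) F(2) xX by auto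
    show "\<forall>g\<in>W. reduced_length g \<le> 2 \<longrightarrow> (\<exists>u\<in>U. g = frag_of u)"
    proof (intro ballI impI)
      fix g assume g: "g \<in> W" "reduced_length g \<le> 2"
      have gT: "g \<in> topspace T" and Dg: "1/2 < D g" "D g < 3/2" and Fg: "1/2 < F g"
        using g(1) by (auto simp: W_def)
      have "\<exists>u\<in>topspace X. g = frag_of u"
        using gT g(2) by (rule length_2_cases) (use Dg D(2-) in auto)
      then obtain u where u: "u \<in> topspace X" "g = frag_of u" by blast
      have "f u > 1/2" using Fg u F(2) by auto
      then have "u \<in> U" using bspec[OF f(3) u(1)] by force
      then show "\<exists>u\<in>U. g = frag_of u" using u by blast
    qed
  qed
qed

text \<open>A bounded continuous pseudometric embeds \<open>X\<close> into a space of bounded functions; the norm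
  of the induced homomorphism bounds the pseudometric.\<close>

lemma pseudometric_extension:
  assumes d: "continuous_pseudometric X d"
  obtains N where "continuous_map T euclideanreal N" "N 0 = 0"
    "\<And>x y. x \<in> topspace X \<Longrightarrow> y \<in> topspace X \<Longrightarrow> d x y \<le> N (frag_of x - frag_of y)"
proof -
  have dp: "\<And>x. d x x = 0" "\<And>x y. d x y = d y x" "\<And>x y. 0 \<le> d x y" "\<And>x y. d x y \<le> 1"
    "\<And>x y z. d x z \<le> d x y + d y z"
    using d by (auto simp: continuous_pseudometric_def pseudometric_def)
  \<comment> \<open>On a discrete copy of the type every function is continuous, so the bounded
    continuous functions are all bounded functions.\<close>
  define \<phi> :: "'a \<Rightarrow> ('a discrete \<Rightarrow>\<^sub>C real)" where "\<phi> x = Bcontfun (\<lambda>z. d x (of_discrete z))" for x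
  have \<phi>: "apply_bcontfun (\<phi> x) z = d x (of_discrete z)" for x z
  proof -
    have "(\<lambda>z. d x (of_discrete z)) \<in> bcontfun"
    proof (rule bcontfun_normI[where b = 1])
      show "continuous_on UNIV (\<lambda>z. d x (of_discrete z))"
        unfolding continuous_on_open_invariant using open_discrete by blast
    qed (use dp in auto)
    then show ?thesis unfolding \<phi>_def by (simp add: Bcontfun_inverse)
  qed
  have dist1: "dist (\<phi> x) (\<phi> y) \<le> d x y" for x y
  proof (rule dist_bound)
    fix z show "dist (apply_bcontfun (\<phi> x) z) (apply_bcontfun (\<phi> y) z) \<le> d x y"
      using dp(2)[of x y] dp(5)[of x "of_discrete z" y] dp(5)[of y "of_discrete z" x]
      by (auto simp: \<phi> dist_real_def)
  qed
  \<comment> \<open>The two functions are compared at the point \<open>y\<close>, where their values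
    are \<open>d x y\<close> and 0.\<close>
  have dist2: "d x y \<le> dist (\<phi> x) (\<phi> y)" for x y
    using dist_bounded[of "\<phi> x" "discrete y" "\<phi> y"] dp(1)[of y] dp(3)[of x y]
    by (simp add: \<phi> dist_real_def discrete_inverse)
  have c\<phi>: "continuous_map X euclidean \<phi>"
    unfolding continuous_map_def
  proof (intro conjI allI impI)
    fix A :: "('a discrete \<Rightarrow>\<^sub>C real) set" assume "openin euclidean A"
    then have A: "open A" by simp
    show "openin X {x \<in> topspace X. \<phi> x \<in> A}"
    proof (subst openin_subopen, intro ballI)
      fix x assume x: "x \<in> {x \<in> topspace X. \<phi> x \<in> A}"
      then obtain e where e: "e > 0" "\<And>y. dist y (\<phi> x) < e \<Longrightarrow> y \<in> A" using A unfolding open_dist by blast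
      obtain O' where O': "openin X O'" "x \<in> O'" "\<forall>y\<in>O'. d x y < e"
        using d x e(1) unfolding continuous_pseudometric_def by blast
      have "\<phi> y \<in> A" if "y \<in> O'" for y
        using e(2)[of "\<phi> y"] dist1[of x y] O'(3) that by (force simp: dist_commute)
      then have "O' \<subseteq> {x \<in> topspace X. \<phi> x \<in> A}" using openin_subset[OF O'(1)] by blast
      then show "\<exists>W. openin X W \<and> x \<in> W \<and> W \<subseteq> {x \<in> topspace X. \<phi> x \<in> A}" using O' by blast
    qed
  qed simp
  obtain F where F: "continuous_map T euclidean F" "\<And>x. x \<in> topspace X \<Longrightarrow> F (frag_of x) = \<phi> x"
    "\<And>a b. a \<in> topspace T \<Longrightarrow> b \<in> topspace T \<Longrightarrow> F (a + b) = F a + F b"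
    "\<And>a. a \<in> topspace T \<Longrightarrow> F (- a) = - F a"
    using free_abelian_extension[OF T c\<phi>] by metis
  show thesis
  proof (rule that[of "\<lambda>g. norm (F g)"])
    show "continuous_map T euclideanreal (\<lambda>g. norm (F g))"
      using F(1) by (rule continuous_map_norm)
    show "norm (F 0) = 0" using F(3)[of 0 0] by simp
    fix x y assume xy: "x \<in> topspace X" "y \<in> topspace X"
    then have "F (frag_of x - frag_of y) = \<phi> x - \<phi> y"
      using F(3)[of "frag_of x" "- frag_of y"] F(2,4) by simp
    then show "d x y \<le> norm (F (frag_of x - frag_of y))" using dist2[of x y] by (simp add: dist_norm)
  qed
qed

text \<open>Squares \<open>U x \<times> U x\<close> inside \<open>O'\<close> cover the diagonal. For
  a pseudometric subordinate to the sets \<open>U x\<close>, an associated seminorm of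
  \<open>u - v\<close> below 1 puts \<open>u\<close> and \<open>v\<close> into a common
  \<open>U x\<close>; a degree near 0 discards single letters and sums.\<close>

lemma nbhd_zero:
  assumes O': "openin (prod_topology X X) O'" "\<And>x. x \<in> topspace X \<Longrightarrow> (x, x) \<in> O'"
  obtains W where "openin T W" "0 \<in> W"
    "\<forall>g\<in>W. reduced_length g \<le> 2 \<longrightarrow> g = 0 \<or> (\<exists>(u, v)\<in>O'. g = frag_of u - frag_of v)"
proof -
  obtain D where "degree D" using degree_exists by metis
  note D = degreeD[OF this]
  have "\<exists>U. openin X U \<and> (x \<in> topspace X \<longrightarrow> x \<in> U) \<and> U \<times> U \<subseteq> O'" for x
  proof (cases "x \<in> topspace X")
    case True
    then obtain A B where "openin X A" "openin X B" "x \<in> A" "x \<in> B" "A \<times> B \<subseteq> O'"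
      using O' unfolding openin_prod_topology_alt by meson
    then show ?thesis by (intro exI[of _ "A \<inter> B"]) auto
  qed (auto intro: exI[of _ "{}"])
  then obtain U where U: "\<And>x. openin X (U x)" "\<And>x. x \<in> topspace X \<Longrightarrow> x \<in> U x" "\<And>x. U x \<times> U x \<subseteq> O'"
    by metis
  have "topspace X \<subseteq> (\<Union>i. U i)" using U(2) by blast
  then obtain d where d: "continuous_pseudometric X d"
    "\<And>x y. \<lbrakk>x \<in> topspace X; y \<in> topspace X; d x y < 1\<rbrakk> \<Longrightarrow> \<exists>i. x \<in> U i \<and> y \<in> U i"
    using cover_pseudometric[of U] U(1) by metis
  obtain N where N: "continuous_map T euclideanreal N" "N 0 = 0"
    "\<And>x y. x \<in> topspace X \<Longrightarrow> y \<in> topspace X \<Longrightarrow> d x y \<le> N (frag_of x - frag_of y)"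
    using pseudometric_extension[OF d(1)] by metis
  define W where "W = ({g \<in> topspace T. -1/2 < D g} \<inter> {g \<in> topspace T. D g < 1/2}) \<inter> {g \<in> topspace T. N g < 1}"
  show thesis
  proof (rule that[of W])
    show "openin T W" unfolding W_def by (intro openin_Int openin_less_preimage D N)
    show "0 \<in> W" unfolding W_def using D(2) N(2) by simp
    show "\<forall>g\<in>W. reduced_length g \<le> 2 \<longrightarrow> g = 0 \<or> (\<exists>(u, v)\<in>O'. g = frag_of u - frag_of v)"
    proof (intro ballI impI)
      fix g assume g: "g \<in> W" "reduced_length g \<le> 2"
      have gT: "g \<in> topspace T" and Dg: "-1/2 < D g" "D g < 1/2" and Ng: "N g < 1"
        using g(1) by (auto simp: W_def)
      have "g = 0 \<or> (\<exists>u\<in>topspace X. \<exists>v\<in>topspace X. g = frag_of u - frag_of v)"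
        using gT g(2) by (rule length_2_cases) (use Dg D(3-6) in auto)
      moreover have "(u, v) \<in> O'" if uv: "u \<in> topspace X" "v \<in> topspace X" "g = frag_of u - frag_of v" for u v
      proof -
        have "d u v < 1" using N(3)[OF uv(1,2)] Ng uv(3) by simp
        then obtain i where "u \<in> U i" "v \<in> U i" using d(2)[OF uv(1,2)] by blast
        then show ?thesis using U(3) by blast
      qed
      ultimately show "g = 0 \<or> (\<exists>(u, v)\<in>O'. g = frag_of u - frag_of v)" by blast
    qed
  qed
qed

lemma k_closed_preimage:
  assumes Z: "k_space Z" and f: "continuous_map Z Y f"
    and S: "\<And>K. compactin Y K \<Longrightarrow> closedin (subtopology Y K) (K \<inter> S)"
  shows "closedin Z {z \<in> topspace Z. f z \<in> S}"
proof -
  have "closedin (subtopology Z L) (L \<inter> {z \<in> topspace Z. f z \<in> S})" if L: "compactin Z L" for L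
  proof -
    have LZ: "L \<subseteq> topspace Z" using L by (rule compactin_subset_topspace)
    have "continuous_map (subtopology Z L) (subtopology Y (f ` L)) f"
      using f by (auto simp: continuous_map_in_subtopology continuous_map_from_subtopology)
    moreover have "closedin (subtopology Y (f ` L)) (f ` L \<inter> S)"
      by (rule S[OF image_compactin[OF L f]])
    ultimately have "closedin (subtopology Z L) {z \<in> topspace (subtopology Z L). f z \<in> f ` L \<inter> S}"
      by (rule closedin_continuous_map_preimage)
    moreover have "{z \<in> topspace (subtopology Z L). f z \<in> f ` L \<inter> S} = L \<inter> {z \<in> topspace Z. f z \<in> S}"
      using LZ by auto
    ultimately show ?thesis by simp
  qed
  then show ?thesis using Z unfolding k_space by (metis (no_types, lifting) mem_Collect_eq subsetI)
qed

text \<open>Apart from 0, an element of the level has a neighbourhood consisting of images of a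
  single rectangle under one of the continuous maps from \<open>X \<times> X\<close>, so openness
  can be checked upstairs. At 0 no rectangle is enough: the preimage of the complement of
  \<open>S\<close> under subtraction contains the whole diagonal, and \<open>nbhd_zero\<close>
  applies to it.\<close>

theorem k_space_level_2:
  assumes k: "k_space (prod_topology X X)"
  shows "k_space (free_abelian_level T 2)"
proof -
  define A2 where "A2 = {g \<in> topspace T. reduced_length g \<le> 2}"
  have lev: "free_abelian_level T 2 = subtopology T A2" by (simp add: free_abelian_level_def A2_def)
  have A2T: "A2 \<subseteq> topspace T" by (auto simp: A2_def)
  have closed: "closedin (subtopology T A2) S" if SA: "S \<subseteq> A2"
    and S: "\<And>K. compactin (subtopology T A2) K \<Longrightarrow> closedin (subtopology (subtopology T A2) K) (K \<inter> S)" for S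
  proof -
    have pre: "openin (prod_topology X X) {z \<in> topspace (prod_topology X X). f z \<notin> S}"
      if f: "continuous_map (prod_topology X X) T f" "\<And>z. z \<in> topspace (prod_topology X X) \<Longrightarrow> reduced_length (f z) \<le> 2" for f
    proof -
      have "f z \<in> topspace T" if "z \<in> topspace (prod_topology X X)" for z
        using f(1) that continuous_map_funspace by blast
      then have "continuous_map (prod_topology X X) (subtopology T A2) f"
        using f by (auto simp: continuous_map_in_subtopology A2_def)
      then have "closedin (prod_topology X X) {z \<in> topspace (prod_topology X X). f z \<in> S}"
        using k_closed_preimage[OF k _ S] by blast
      then have "openin (prod_topology X X) (topspace (prod_topology X X) - {z \<in> topspace (prod_topology X X). f z \<in> S})"
        by blast
      moreover have "topspace (prod_topology X X) - {z \<in> topspace (prod_topology X X). f z \<in> S} =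
          {z \<in> topspace (prod_topology X X). f z \<notin> S}" by blast
      ultimately show ?thesis by simp
    qed
    have rect: "\<exists>U V. openin X U \<and> openin X V \<and> x \<in> U \<and> y \<in> V \<and> (\<forall>u\<in>U. \<forall>v\<in>V. f (u, v) \<notin> S)"
      if f: "continuous_map (prod_topology X X) T f" "\<And>z. z \<in> topspace (prod_topology X X) \<Longrightarrow> reduced_length (f z) \<le> 2"
        and xy: "x \<in> topspace X" "y \<in> topspace X" "f (x, y) \<notin> S" for f x y
    proof -
      have "(x, y) \<in> {z \<in> topspace (prod_topology X X). f z \<notin> S}" using xy by simp
      then obtain U V where "openin X U" "openin X V" "x \<in> U" "y \<in> V" "U \<times> V \<subseteq> {z \<in> topspace (prod_topology X X). f z \<notin> S}"
        using pre[OF f] unfolding openin_prod_topology_alt by meson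
      then show ?thesis by blast
    qed
    have cf: "continuous_map (prod_topology X X) T (\<lambda>z. frag_of (fst z))" "continuous_map (prod_topology X X) T (\<lambda>z. frag_of (snd z))"
      by (auto intro!: continuous_map_compose[OF _ continuous_T_frag_of, unfolded o_def] continuous_map_fst continuous_map_snd)
    have cs: "continuous_map (prod_topology X X) T (\<lambda>z. frag_of (fst z) + frag_of (snd z))"
      by (intro continuous_plus cf)
    have cd: "continuous_map (prod_topology X X) T (\<lambda>z. frag_of (fst z) - frag_of (snd z))"
      using continuous_plus[OF cf(1) continuous_uminus[OF cf(2)]] by simp
    have neg: "\<exists>W'. openin T W' \<and> - a \<in> W' \<and> (\<forall>g\<in>W'. - g \<in> W)" if W: "openin T W" "a \<in> W" for W a
    proof (intro exI[of _ "{g \<in> topspace T. - g \<in> W}"] conjI)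
      show "openin T {g \<in> topspace T. - g \<in> W}" using openin_continuous_map_preimage[OF continuous_T_minus W(1)] .
      show "- a \<in> {g \<in> topspace T. - g \<in> W}" using W(2) openin_subset[OF W(1)] by auto
    qed simp
    have main: "\<exists>W. openin T W \<and> g \<in> W \<and> (\<forall>h\<in>W. reduced_length h \<le> 2 \<longrightarrow> h \<notin> S)" if g: "g \<in> A2" "g \<notin> S" for g
    proof -
      have gT: "g \<in> topspace T" "reduced_length g \<le> 2" using g by (auto simp: A2_def)
      from gT show ?thesis
      proof (rule length_2_cases)
        assume g0: "g = 0"
        let ?O = "{z \<in> topspace (prod_topology X X). frag_of (fst z) - frag_of (snd z) \<notin> S}"
        have o: "openin (prod_topology X X) ?O" by (rule pre[OF cd]) (simp add: reduced_length_pair)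
        have d: "(x, x) \<in> ?O" if "x \<in> topspace X" for x using that g g0 by simp
        obtain W where W: "openin T W" "0 \<in> W"
          "\<forall>g\<in>W. reduced_length g \<le> 2 \<longrightarrow> g = 0 \<or> (\<exists>(u, v)\<in>?O. g = frag_of u - frag_of v)"
          using o d by (rule nbhd_zero)
        have "\<forall>h\<in>W. reduced_length h \<le> 2 \<longrightarrow> h \<notin> S" using W(3) g(2) g0 by fastforce
        then show ?thesis using W g0 by blast
      next
        fix x assume x: "x \<in> topspace X" "g = frag_of x"
        \<comment> \<open>A single letter is viewed as a function on the product that depends on the
          first coordinate only.\<close>
        obtain U V where U: "openin X U" "x \<in> U" "x \<in> V" "\<forall>u\<in>U. \<forall>v\<in>V. frag_of u \<notin> S"
          using rect[OF cf(1), of x x] x g by auto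
        obtain W where "openin T W" "frag_of x \<in> W" "\<forall>g\<in>W. reduced_length g \<le> 2 \<longrightarrow> (\<exists>u\<in>U. g = frag_of u)"
          using U(1,2) by (rule nbhd_single)
        then show ?thesis using U(3,4) x(2) by blast
      next
        fix x assume x: "x \<in> topspace X" "g = - frag_of x"
        obtain U V where U: "openin X U" "x \<in> U" "x \<in> V" "\<forall>u\<in>U. \<forall>v\<in>V. - frag_of u \<notin> S"
          using rect[OF continuous_uminus[OF cf(1)], of x x] x g by auto
        obtain W where W: "openin T W" "frag_of x \<in> W" "\<forall>g\<in>W. reduced_length g \<le> 2 \<longrightarrow> (\<exists>u\<in>U. g = frag_of u)"
          using U(1,2) by (rule nbhd_single)
        obtain W' where W': "openin T W'" "- frag_of x \<in> W'" "\<forall>g\<in>W'. - g \<in> W" using neg[OF W(1,2)] by blast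
        have "h \<notin> S" if h: "h \<in> W'" "reduced_length h \<le> 2" for h
        proof -
          obtain u where "u \<in> U" "- h = frag_of u" using W(3) W'(3) h by (metis reduced_length_minus)
          then have "h = - frag_of u" "u \<in> U" by (metis minus_minus, simp)
          then show ?thesis using U(3,4) by blast
        qed
        then show ?thesis using W' x(2) by blast
      next
        fix x y assume x: "x \<in> topspace X" "y \<in> topspace X" "g = frag_of x + frag_of y"
        obtain U V where U: "openin X U" "openin X V" "x \<in> U" "y \<in> V" "\<forall>u\<in>U. \<forall>v\<in>V. frag_of u + frag_of v \<notin> S"
          using rect[OF cs, of x y] x g by (auto simp: reduced_length_pair)
        obtain W where "openin T W" "frag_of x + frag_of y \<in> W"
          "\<And>g. g \<in> W \<Longrightarrow> reduced_length g \<le> 2 \<Longrightarrow> \<exists>u\<in>U. \<exists>v\<in>V. g = frag_of u + frag_of v"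
          using nbhd_sum[OF U(1,3) U(2,4)] by metis
        then show ?thesis using U(5) x(3) by blast
      next
        fix x y assume x: "x \<in> topspace X" "y \<in> topspace X" "g = - (frag_of x + frag_of y)"
        have "reduced_length (- (frag_of u + frag_of v)) \<le> 2" for u v :: 'a
          using reduced_length_pair(1)[of u v] by (simp only: reduced_length_minus)
        then obtain U V where U: "openin X U" "openin X V" "x \<in> U" "y \<in> V" "\<forall>u\<in>U. \<forall>v\<in>V. - (frag_of u + frag_of v) \<notin> S"
          using rect[OF continuous_uminus[OF cs], of x y] x g by auto
        obtain W where W: "openin T W" "frag_of x + frag_of y \<in> W"
          "\<And>g. g \<in> W \<Longrightarrow> reduced_length g \<le> 2 \<Longrightarrow> \<exists>u\<in>U. \<exists>v\<in>V. g = frag_of u + frag_of v"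
          using nbhd_sum[OF U(1,3) U(2,4)] by metis
        obtain W' where W': "openin T W'" "- (frag_of x + frag_of y) \<in> W'" "\<forall>g\<in>W'. - g \<in> W" using neg[OF W(1,2)] by blast
        have "h \<notin> S" if h: "h \<in> W'" "reduced_length h \<le> 2" for h
        proof -
          obtain u v where "u \<in> U" "v \<in> V" "- h = frag_of u + frag_of v"
            using W(3)[of "- h"] W'(3) h by auto
          then have "h = - (frag_of u + frag_of v)" "u \<in> U" "v \<in> V" by (metis minus_minus, simp_all)
          then show ?thesis using U(5) by blast
        qed
        then show ?thesis using W' x(3) by blast
      next
        fix x y assume x: "x \<in> topspace X" "y \<in> topspace X" "x \<noteq> y" "g = frag_of x - frag_of y"
        obtain U V where U: "openin X U" "openin X V" "x \<in> U" "y \<in> V" "\<forall>u\<in>U. \<forall>v\<in>V. frag_of u - frag_of v \<notin> S"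
          using rect[OF cd, of x y] x g by (auto simp: reduced_length_pair)
        obtain W where "openin T W" "frag_of x - frag_of y \<in> W"
          "\<forall>g\<in>W. reduced_length g \<le> 2 \<longrightarrow> (\<exists>u\<in>U. \<exists>v\<in>V. g = frag_of u - frag_of v)"
          using U(1,3) U(2,4) x(3) by (rule nbhd_diff)
        then show ?thesis using U(5) x(4) by blast
      qed
    qed
    have "openin (subtopology T A2) (A2 - S)"
    proof (subst openin_subopen, intro ballI)
      fix g assume "g \<in> A2 - S"
      then obtain W where W: "openin T W" "g \<in> W" "\<forall>h\<in>W. reduced_length h \<le> 2 \<longrightarrow> h \<notin> S" and gA: "g \<in> A2"
        using main by blast
      have "openin (subtopology T A2) (W \<inter> A2)" using W(1) by (auto simp: openin_subtopology)
      moreover have "W \<inter> A2 \<subseteq> A2 - S" using W(3) by (auto simp: A2_def)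
      ultimately show "\<exists>W. openin (subtopology T A2) W \<and> g \<in> W \<and> W \<subseteq> A2 - S" using W(2) gA by blast
    qed
    moreover have "topspace (subtopology T A2) = A2" using A2T by auto
    ultimately show ?thesis unfolding closedin_def using SA by simp
  qed
  show ?thesis
    unfolding k_space lev
  proof (intro allI impI, elim conjE)
    fix S assume "S \<subseteq> topspace (subtopology T A2)"
      "\<forall>K. compactin (subtopology T A2) K \<longrightarrow> closedin (subtopology (subtopology T A2) K) (K \<inter> S)"
    then show "closedin (subtopology T A2) S" using closed[of S] by auto
  qed
qed

end

section \<open>Products of k_omega-spaces\<close>

lemma k_omega_increasing:
  assumes Y: "k_omega_space Y" and x: "x \<in> topspace Y"
  obtains K :: "nat \<Rightarrow> 'a set" where "\<forall>n. compactin Y (K n)" "\<forall>n. K n \<subseteq> K (Suc n)" "x \<in> K 0"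
    "\<forall>U\<subseteq>topspace Y. (\<forall>n. openin (subtopology Y (K n)) (U \<inter> K n)) \<longrightarrow> openin Y U"
proof -
  obtain L :: "nat \<Rightarrow> 'a set" where L: "\<And>n. compactin Y (L n)"
    "\<And>F. F \<subseteq> topspace Y \<Longrightarrow> (\<forall>n. closedin (subtopology Y (L n)) (F \<inter> L n)) \<Longrightarrow> closedin Y F"
    using Y unfolding k_omega_space_def by metis
  define K where "K n = insert x (\<Union>i\<le>n. L i)" for n
  have LX: "L n \<subseteq> topspace Y" for n using L(1) by (rule compactin_subset_topspace)
  show thesis
  proof (rule that[of K])
    show "\<forall>n. compactin Y (K n)"
    proof
      fix n
      have "compactin Y ({x} \<union> (\<Union>i\<le>n. L i))"
        by (intro compactin_Un compactin_Union) (use L(1) x in auto)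
      then show "compactin Y (K n)" by (simp add: K_def)
    qed
    show "\<forall>n. K n \<subseteq> K (Suc n)" unfolding K_def by (auto simp: le_Suc_eq)
    show "x \<in> K 0" by (simp add: K_def)
    show "\<forall>U\<subseteq>topspace Y. (\<forall>n. openin (subtopology Y (K n)) (U \<inter> K n)) \<longrightarrow> openin Y U"
    proof (intro allI impI)
      fix U assume U: "U \<subseteq> topspace Y" "\<forall>n. openin (subtopology Y (K n)) (U \<inter> K n)"
      have "closedin (subtopology Y (L n)) ((topspace Y - U) \<inter> L n)" for n
      proof -
        have LK: "L n \<subseteq> K n" unfolding K_def by blast
        obtain O' where O': "openin Y O'" "U \<inter> K n = O' \<inter> K n"
          using U(2) unfolding openin_subtopology by metis
        have "(topspace Y - U) \<inter> L n = (topspace Y - O') \<inter> L n" using O'(2) LK by blast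
        moreover have "closedin Y (topspace Y - O')" using O'(1) by blast
        ultimately show ?thesis unfolding closedin_subtopology by blast
      qed
      then have "closedin Y (topspace Y - U)" using L(2) by blast
      then show "openin Y U" using U(1) by (simp add: openin_closedin)
    qed
  qed
qed

text \<open>\<open>A (Suc n)\<close> contains a relative neighbourhood of \<open>A n\<close> in
  \<open>K (Suc n)\<close>. Hence the union of the chain has the same trace on \<open>K n\<close> as
  the union of the open sets \<open>P m\<close> with \<open>m \<ge> n\<close>, although no
  \<open>A m\<close> need be open.\<close>

lemma k_omega_open_chain:
  assumes K: "\<And>n. K n \<subseteq> K (Suc n)" "\<And>n. K n \<subseteq> topspace Y"
    and det: "\<And>U. \<lbrakk>U \<subseteq> topspace Y; \<And>n. openin (subtopology Y (K n)) (U \<inter> K n)\<rbrakk> \<Longrightarrow> openin Y U"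
    and A: "\<And>n::nat. A n \<subseteq> K n" "\<And>n. \<exists>P. openin Y P \<and> A n \<subseteq> P \<and> P \<inter> K (Suc n) \<subseteq> A (Suc n)"
  shows "openin Y (\<Union>n. A n)" "mono A"
proof -
  obtain P where P: "\<And>n. openin Y (P n)" "\<And>n. A n \<subseteq> P n" "\<And>n. P n \<inter> K (Suc n) \<subseteq> A (Suc n)"
    using A(2) by metis
  have monoK: "mono K" using K(1) by (simp add: mono_iff_le_Suc)
  have "A n \<subseteq> A (Suc n)" for n using A(1)[of n] K(1)[of n] P(2)[of n] P(3)[of n] by blast
  then show monoA: "mono A" by (simp add: mono_iff_le_Suc)
  show "openin Y (\<Union>n. A n)"
  proof (rule det)
    show "(\<Union>n. A n) \<subseteq> topspace Y" using A(1) K(2) by blast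
    fix n
    have "(\<Union>m. A m) \<inter> K n = (\<Union>m\<in>{n..}. P m) \<inter> K n"
    proof
      show "(\<Union>m. A m) \<inter> K n \<subseteq> (\<Union>m\<in>{n..}. P m) \<inter> K n"
      proof
        fix a assume a: "a \<in> (\<Union>m. A m) \<inter> K n"
        then obtain m where "a \<in> A m" by blast
        then have "a \<in> A (max m n)" using monoD[OF monoA, of m "max m n"] by auto
        then have "a \<in> P (max m n)" using P(2) by blast
        then show "a \<in> (\<Union>m\<in>{n..}. P m) \<inter> K n" using a by auto
      qed
      show "(\<Union>m\<in>{n..}. P m) \<inter> K n \<subseteq> (\<Union>m. A m) \<inter> K n"
      proof
        fix a assume a: "a \<in> (\<Union>m\<in>{n..}. P m) \<inter> K n"
        then obtain m where m: "m \<ge> n" "a \<in> P m" by auto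
        then have "a \<in> K (Suc m)" using monoD[OF monoK, of n "Suc m"] a by auto
        then have "a \<in> A (Suc m)" using P(3) m(2) by blast
        then show "a \<in> (\<Union>m. A m) \<inter> K n" using a by blast
      qed
    qed
    moreover have "openin Y (\<Union>m\<in>{n..}. P m)" using P(1) by blast
    ultimately show "openin (subtopology Y (K n)) ((\<Union>n. A n) \<inter> K n)"
      by (auto simp: openin_subtopology)
  qed
qed

lemma compact_neighbourhood_step:
  assumes H: "Hausdorff_space Y" and K: "compactin Y K" and A: "compactin Y A" "A \<subseteq> K"
    and U: "openin (subtopology Y K) U" "A \<subseteq> U"
  obtains A' P where "compactin Y A'" "A' \<subseteq> K" "A' \<subseteq> U" "openin Y P" "A \<subseteq> P" "P \<inter> K \<subseteq> A'"
proof -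
  let ?Y = "subtopology Y K"
  have cY: "compact_space ?Y" using K by (rule compact_space_subtopology)
  have HY: "Hausdorff_space ?Y" using H by (rule Hausdorff_space_subtopology)
  have nY: "normal_space ?Y" using cY HY compact_Hausdorff_or_regular_imp_normal_space by blast
  have "compactin ?Y A" using A by (simp add: compactin_subtopology)
  then have "closedin ?Y A" by (rule compactin_imp_closedin[OF HY])
  then obtain V where V: "openin ?Y V" "A \<subseteq> V" "?Y closure_of V \<subseteq> U"
    using nY[unfolded normal_space_alt, rule_format, of A U] U by blast
  obtain P where P: "openin Y P" "V = P \<inter> K" using V(1) by (auto simp: openin_subtopology)
  have "compactin ?Y (?Y closure_of V)" using cY by (simp add: closedin_compact_space)
  then have "compactin Y (?Y closure_of V)" "?Y closure_of V \<subseteq> K" by (auto simp: compactin_subtopology)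
  moreover have "V \<subseteq> ?Y closure_of V" by (rule closure_of_subset[OF openin_subset[OF V(1)]])
  ultimately show thesis using that[of "?Y closure_of V" P] V P by blast
qed

text \<open>Compact rectangles inside \<open>W\<close> are enlarged step by step: Wallace's theorem
  gives a relatively open rectangle around the current one, in which compact neighbourhoods are
  taken. The unions of both chains are open, and monotonicity brings any two stages to a common one,
  so their product stays in \<open>W\<close>.\<close>

lemma k_omega_product_open:
  fixes Y :: "'a topology" and Z :: "'b topology"
  assumes Y: "k_omega_space Y" "Hausdorff_space Y" and Z: "k_omega_space Z" "Hausdorff_space Z"
    and O': "\<And>L. compactin (prod_topology Y Z) L \<Longrightarrow> openin (subtopology (prod_topology Y Z) L) (L \<inter> W)"
    and xy: "(x, y) \<in> W" "x \<in> topspace Y" "y \<in> topspace Z"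
  obtains U V where "openin Y U" "openin Z V" "x \<in> U" "y \<in> V" "U \<times> V \<subseteq> W"
proof -
  obtain K where K0: "\<forall>n. compactin Y (K n)" "\<forall>n. K n \<subseteq> K (Suc n)" "x \<in> K 0"
    and detK: "\<forall>U\<subseteq>topspace Y. (\<forall>n. openin (subtopology Y (K n)) (U \<inter> K n)) \<longrightarrow> openin Y U"
    by (rule k_omega_increasing[OF Y(1) xy(2)])
  obtain L where L0: "\<forall>n. compactin Z (L n)" "\<forall>n. L n \<subseteq> L (Suc n)" "y \<in> L 0"
    and detL: "\<forall>U\<subseteq>topspace Z. (\<forall>n. openin (subtopology Z (L n)) (U \<inter> L n)) \<longrightarrow> openin Z U"
    by (rule k_omega_increasing[OF Z(1) xy(3)])
  note K = K0(1)[rule_format] K0(2)[rule_format] K0(3)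
  note L = L0(1)[rule_format] L0(2)[rule_format] L0(3)
  define R where "R n A B \<longleftrightarrow> compactin Y A \<and> A \<subseteq> K n \<and> compactin Z B \<and> B \<subseteq> L n \<and> A \<times> B \<subseteq> W \<and> x \<in> A \<and> y \<in> B" for n A B
  define next' where "next' n A A' B B' \<longleftrightarrow> (\<exists>P. openin Y P \<and> A \<subseteq> P \<and> P \<inter> K (Suc n) \<subseteq> A') \<and>
      (\<exists>P. openin Z P \<and> B \<subseteq> P \<and> P \<inter> L (Suc n) \<subseteq> B')" for n A A' B B'
  have step: "\<exists>A' B'. R (Suc n) A' B' \<and> next' n A A' B B'" if R: "R n A B" for n A B
  proof -
    let ?K = "K (Suc n)" and ?L = "L (Suc n)"
    have A: "compactin Y A" "A \<subseteq> ?K" and B: "compactin Z B" "B \<subseteq> ?L" and AB: "A \<times> B \<subseteq> W"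
      and xyAB: "x \<in> A" "y \<in> B"
      using R K(2)[of n] L(2)[of n] unfolding R_def by auto
    have cA: "compactin (subtopology Y ?K) A" and cB: "compactin (subtopology Z ?L) B"
      using A B by (auto simp: compactin_subtopology)
    have "compactin (prod_topology Y Z) (?K \<times> ?L)" using K(1) L(1) by (simp add: compactin_Times)
    then have "openin (subtopology (prod_topology Y Z) (?K \<times> ?L)) ((?K \<times> ?L) \<inter> W)" by (rule O')
    then have o: "openin (prod_topology (subtopology Y ?K) (subtopology Z ?L)) ((?K \<times> ?L) \<inter> W)"
      by (simp add: subtopology_Times)
    have sub: "A \<times> B \<subseteq> (?K \<times> ?L) \<inter> W" using A B AB by blast
    obtain U V where UV: "openin (subtopology Y ?K) U" "openin (subtopology Z ?L) V" "A \<subseteq> U" "B \<subseteq> V"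
      "U \<times> V \<subseteq> (?K \<times> ?L) \<inter> W"
      using Wallace_theorem_prod_topology[OF cA cB o sub] by metis
    obtain A' P where A': "compactin Y A'" "A' \<subseteq> ?K" "A' \<subseteq> U" "openin Y P" "A \<subseteq> P" "P \<inter> ?K \<subseteq> A'"
      using compact_neighbourhood_step[OF Y(2) K(1) A UV(1,3)] by metis
    obtain B' Q where B': "compactin Z B'" "B' \<subseteq> ?L" "B' \<subseteq> V" "openin Z Q" "B \<subseteq> Q" "Q \<inter> ?L \<subseteq> B'"
      using compact_neighbourhood_step[OF Z(2) L(1) B UV(2,4)] by metis
    have "A' \<times> B' \<subseteq> W" using A'(3) B'(3) UV(5) by blast
    moreover have "x \<in> A'" "y \<in> B'" using A A'(5,6) B B'(5,6) xyAB by blast+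
    ultimately show ?thesis using A' B' unfolding R_def next'_def by blast
  qed
  have "\<exists>f. \<forall>n. R n (fst (f n)) (snd (f n)) \<and>
      next' n (fst (f n)) (fst (f (Suc n))) (snd (f n)) (snd (f (Suc n)))"
  proof (rule dependent_nat_choice)
    have "R 0 {x} {y}" using K(3) L(3) xy unfolding R_def by auto
    then show "\<exists>z. R 0 (fst z) (snd z)" by (intro exI[of _ "({x}, {y})"]) simp
    show "\<exists>z'. R (Suc n) (fst z') (snd z') \<and> next' n (fst z) (fst z') (snd z) (snd z')"
      if "R n (fst z) (snd z)" for z n
      using step[OF that] by (metis fst_conv snd_conv)
  qed
  then obtain f where f: "\<And>n. R n (fst (f n)) (snd (f n))"
    "\<And>n. next' n (fst (f n)) (fst (f (Suc n))) (snd (f n)) (snd (f (Suc n)))" by metis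
  define A where "A n = fst (f n)" for n
  define B where "B n = snd (f n)" for n
  have R: "R n (A n) (B n)" and N: "next' n (A n) (A (Suc n)) (B n) (B (Suc n))" for n
    using f by (simp_all add: A_def B_def)
  have oA: "openin Y (\<Union>n. A n)" "mono A"
  proof -
    have 1: "openin Y U" if "U \<subseteq> topspace Y" "\<And>n. openin (subtopology Y (K n)) (U \<inter> K n)" for U
      using detK that by blast
    have 2: "K n \<subseteq> topspace Y" "A n \<subseteq> K n" for n
      using compactin_subset_topspace[OF K(1)] R[of n] by (auto simp: R_def)
    have 3: "\<exists>P. openin Y P \<and> A n \<subseteq> P \<and> P \<inter> K (Suc n) \<subseteq> A (Suc n)" for n
      using N[of n] by (auto simp: next'_def)
    show "openin Y (\<Union>n. A n)" "mono A"
      using k_omega_open_chain[of K Y A, OF K(2) 2(1) 1 2(2) 3] by auto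
  qed
  have oB: "openin Z (\<Union>n. B n)" "mono B"
  proof -
    have 1: "openin Z U" if "U \<subseteq> topspace Z" "\<And>n. openin (subtopology Z (L n)) (U \<inter> L n)" for U
      using detL that by blast
    have 2: "L n \<subseteq> topspace Z" "B n \<subseteq> L n" for n
      using compactin_subset_topspace[OF L(1)] R[of n] by (auto simp: R_def)
    have 3: "\<exists>P. openin Z P \<and> B n \<subseteq> P \<and> P \<inter> L (Suc n) \<subseteq> B (Suc n)" for n
      using N[of n] by (auto simp: next'_def)
    show "openin Z (\<Union>n. B n)" "mono B"
      using k_omega_open_chain[of L Z B, OF L(2) 2(1) 1 2(2) 3] by auto
  qed
  have "(\<Union>n. A n) \<times> (\<Union>n. B n) \<subseteq> W"
  proof
    fix z assume "z \<in> (\<Union>n. A n) \<times> (\<Union>n. B n)"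
    then obtain i j where "fst z \<in> A i" "snd z \<in> B j" by auto
    then have "fst z \<in> A (max i j)" "snd z \<in> B (max i j)"
      using monoD[OF oA(2), of i "max i j"] monoD[OF oB(2), of j "max i j"] by auto
    then have "(fst z, snd z) \<in> A (max i j) \<times> B (max i j)" by blast
    then have "(fst z, snd z) \<in> W" using R[of "max i j"] unfolding R_def by blast
    then show "z \<in> W" by simp
  qed
  moreover have "x \<in> (\<Union>n. A n)" "y \<in> (\<Union>n. B n)" using R[of 0] by (auto simp: R_def)
  ultimately show thesis using oA(1) oB(1) by (intro that)
qed

lemma locally_k_omega_square:
  assumes H: "Hausdorff_space X" and lk: "locally_k_omega_space X"
  shows "k_space (prod_topology X X)"
  unfolding k_space_open
proof (intro allI impI, elim conjE)
  fix S :: "('a \<times> 'a) set"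
  assume S: "S \<subseteq> topspace (prod_topology X X)"
    and SK: "\<forall>K. compactin (prod_topology X X) K \<longrightarrow> openin (subtopology (prod_topology X X) K) (K \<inter> S)"
  show "openin (prod_topology X X) S"
    unfolding openin_prod_topology_alt
  proof (intro allI impI)
    fix x y assume xy: "(x, y) \<in> S"
    then have X: "x \<in> topspace X" "y \<in> topspace X" using S by auto
    obtain U1 N1 where N1: "openin X U1" "x \<in> U1" "U1 \<subseteq> N1" "N1 \<subseteq> topspace X" "k_omega_space (subtopology X N1)"
      using bspec[OF lk[unfolded locally_k_omega_space_def] X(1)] by (elim exE conjE)
    obtain U2 N2 where N2: "openin X U2" "y \<in> U2" "U2 \<subseteq> N2" "N2 \<subseteq> topspace X" "k_omega_space (subtopology X N2)"
      using bspec[OF lk[unfolded locally_k_omega_space_def] X(2)] by (elim exE conjE)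
    have xy': "(x, y) \<in> S \<inter> (N1 \<times> N2)" "x \<in> topspace (subtopology X N1)" "y \<in> topspace (subtopology X N2)"
      using xy X N1 N2 by auto
    have *: "openin (subtopology (prod_topology (subtopology X N1) (subtopology X N2)) L) (L \<inter> (S \<inter> (N1 \<times> N2)))"
      if L: "compactin (prod_topology (subtopology X N1) (subtopology X N2)) L" for L
    proof -
      have eq: "prod_topology (subtopology X N1) (subtopology X N2) = subtopology (prod_topology X X) (N1 \<times> N2)"
        by (simp add: subtopology_Times)
      have L': "compactin (prod_topology X X) L" "L \<subseteq> N1 \<times> N2"
        using L unfolding eq by (auto simp: compactin_subtopology)
      then have "openin (subtopology (prod_topology X X) L) (L \<inter> S)" using SK by blast
      moreover have "L \<inter> (S \<inter> (N1 \<times> N2)) = L \<inter> S" using L'(2) by blast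
      ultimately show ?thesis unfolding eq using L'(2) by (simp add: subtopology_subtopology Int_absorb1)
    qed
    obtain U V where UV: "openin (subtopology X N1) U" "openin (subtopology X N2) V" "x \<in> U" "y \<in> V"
      "U \<times> V \<subseteq> S \<inter> (N1 \<times> N2)"
      by (rule k_omega_product_open[OF N1(5) Hausdorff_space_subtopology[OF H] N2(5) Hausdorff_space_subtopology[OF H] * xy'])
    obtain U' V' where U': "openin X U'" "U = U' \<inter> N1" and V': "openin X V'" "V = V' \<inter> N2"
      using UV(1,2) by (auto simp: openin_subtopology)
    have "openin X (U' \<inter> U1)" "openin X (V' \<inter> U2)" using U' V' N1 N2 by auto
    moreover have "x \<in> U' \<inter> U1" "y \<in> V' \<inter> U2" using UV U' V' N1 N2 by auto
    moreover have "(U' \<inter> U1) \<times> (V' \<inter> U2) \<subseteq> S" using UV(5) U' V' N1(3) N2(3) by blast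
    ultimately show "\<exists>U V. openin X U \<and> openin X V \<and> x \<in> U \<and> y \<in> V \<and> U \<times> V \<subseteq> S" by blast
  qed
qed

lemma metrizable_square:
  assumes "metrizable_space X"
  shows "k_space (prod_topology X X)"
  by (rule metrizable_imp_k_space) (simp add: metrizable_space_prod_topology assms)

section \<open>The two obstructions\<close>

lemma filterlim_inj_at_top:
  fixes f :: "nat \<Rightarrow> nat"
  assumes "inj f"
  shows "filterlim f at_top sequentially"
  unfolding filterlim_at_top
proof
  fix Z
  have "finite (f -` {..<Z})" using assms by (intro finite_vimageI) auto
  then have "finite {j. \<not> Z \<le> f j}" by (rule rev_finite_subset) auto
  then show "\<forall>\<^sub>F j in sequentially. Z \<le> f j"
    unfolding cofinite_eq_sequentially[symmetric] eventually_cofinite .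
qed

lemma infinite_fibre_subseq:
  assumes "infinite {j::nat. P j}"
  obtains r :: "nat \<Rightarrow> nat" where "strict_mono r" "\<forall>j. P (r j)"
  using infinite_enumerate[OF assms] by auto

text \<open>Cardinals are comparable: either \<open>S\<close> embeds into the reals, or the reals
  embed into \<open>S\<close> and their image is the required subset.\<close>

lemma uncountable_real_embedding:
  fixes S :: "'b set"
  assumes "uncountable S"
  obtains S' and x :: "'b \<Rightarrow> real" where "S' \<subseteq> S" "uncountable S'" "inj_on x S'"
proof -
  have "(card_of S, card_of (UNIV :: real set)) \<in> ordLeq \<or> (card_of (UNIV :: real set), card_of S) \<in> ordLeq"
    by (rule ordLeq_total[OF card_of_Well_order card_of_Well_order])
  then consider f :: "'b \<Rightarrow> real" where "inj_on f S" | f :: "real \<Rightarrow> 'b" where "inj f" "range f \<subseteq> S"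
    unfolding card_of_ordLeq[symmetric] by blast
  then show thesis
  proof cases
    case 1
    then show thesis using that[of S f] assms by blast
  next
    case 2
    have "uncountable (range f)" using 2(1) uncountable_UNIV_real countable_image_inj_eq by blast
    moreover have "inj_on (inv_into UNIV f) (range f)" by (rule inj_on_inv_into) simp
    ultimately show thesis using that[of "range f" "inv_into UNIV f"] 2(2) by blast
  qed
qed

text \<open>Scaling by \<open>n\<close> and rounding down maps into the countable set of integers,
  so two points share a value.\<close>

lemma uncountable_reals_close:
  fixes A :: "real set"
  assumes "uncountable A"
  obtains a b where "a \<in> A" "b \<in> A" "a \<noteq> b" "real n * \<bar>a - b\<bar> \<le> 1"
proof -
  have "\<not> inj_on (\<lambda>a. \<lfloor>real n * a\<rfloor>) A"
  proof
    assume "inj_on (\<lambda>a. \<lfloor>real n * a\<rfloor>) A"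
    then have "countable A" by (rule countableI_type[THEN countable_subset[OF subset_UNIV], THEN countable_image_inj_on])
    then show False using assms by blast
  qed
  then obtain a b where ab: "a \<in> A" "b \<in> A" "a \<noteq> b" "\<lfloor>real n * a\<rfloor> = \<lfloor>real n * b\<rfloor>"
    unfolding inj_on_def by blast
  have "\<bar>real n * a - real n * b\<bar> \<le> 1" using ab(4) by linarith
  then have "real n * \<bar>a - b\<bar> \<le> 1" by (simp add: abs_mult flip: right_diff_distrib)
  then show thesis using that ab by blast
qed

context free_stratified
begin

text \<open>The pairs couple \<open>s n m\<close> with \<open>d n m\<close>. A sequence of distinct
  index pairs either has rows tending to infinity along a subsequence, where the fan does not
  converge, or stays infinitely often in one row, where \<open>d n\<close> does not converge. They
  accumulate at \<open>(p, q)\<close>: some row \<open>d n\<close> enters the neighbourhood of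
  \<open>q\<close> infinitely often, and \<open>s n\<close> converges to \<open>p\<close>.\<close>

lemma countable_fan_bad_point:
  assumes FU: "frechet_urysohn_space X" and p: "p \<in> topspace X"
    and s: "\<And>n::nat. limitin X (s n) p sequentially" "\<And>n m::nat. s n m \<in> topspace X - {p}"
    and fan: "\<And>i m z. strict_mono i \<Longrightarrow> \<not> limitin X (\<lambda>j::nat. s (i j) (m j)) z sequentially"
    and bad: "bad_point X q"
  shows "\<not> k_R_space (free_abelian_level T 2)"
proof -
  obtain d :: "nat \<Rightarrow> nat \<Rightarrow> 'a" where q: "q \<in> topspace X" and dX: "\<And>n m. d n m \<in> topspace X"
    and d: "\<And>n. no_convergent_subseq X (d n)"
    and dq: "\<And>V. openin X V \<Longrightarrow> q \<in> V \<Longrightarrow> \<exists>n. infinite {m. d n m \<in> V}"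
    using bad unfolding bad_point_def by metis
  define E where "E = {(n, m). d n m \<noteq> p}"
  define a where "a e = s (fst e) (snd e)" for e :: "nat \<times> nat"
  define b where "b e = d (fst e) (snd e)" for e :: "nat \<times> nat"
  \<comment> \<open>The code of the index pair serves as the size: along distinct index pairs it
    tends to infinity, so \<open>limitin_nb_centres\<close> transfers convergence from the supports
    to the chosen points. Removing \<open>p\<close> keeps \<open>p + q\<close> outside all
    supports.\<close>
  define U where "U e = nb (prod_encode e) (a e) - {p}" for e
  define V where "V e = nb (prod_encode e) (b e) - {p}" for e
  have cp: "closedin X {p}" using t1 p by (simp add: t1_space_closedin_singleton)
  have oU: "openin X (U e)" "openin X (V e)" for e unfolding U_def V_def using cp by (simp_all add: openin_diff)
  show ?thesis
  proof (rule not_k_R_level_2[OF FU p q, of E U a V b])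
    show "openin X (U e) \<and> a e \<in> U e \<and> p \<notin> U e" for e
      using oU[of e] s(2) nb_self by (auto simp: U_def a_def)
    show "openin X (V e) \<and> b e \<in> V e \<and> p \<notin> V e" if "e \<in> E" for e
      using oU[of e] dX nb_self that by (auto simp: V_def b_def E_def)
  next
    fix \<epsilon> :: "nat \<Rightarrow> nat \<times> nat" and u v z w
    assume \<epsilon>: "inj \<epsilon>" and uv: "\<And>j. \<epsilon> j \<in> E \<and> u j \<in> U (\<epsilon> j) \<and> v j \<in> V (\<epsilon> j)"
      and uz: "limitin X u z sequentially" and vw: "limitin X v w sequentially"
    have "inj (\<lambda>j. prod_encode (\<epsilon> j))"
      using inj_compose[OF inj_prod_encode \<epsilon>] by (simp add: o_def)
    then have lim: "filterlim (\<lambda>j. prod_encode (\<epsilon> j)) at_top sequentially" by (rule filterlim_inj_at_top)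
    have az: "limitin X (\<lambda>j. a (\<epsilon> j)) z sequentially"
      by (rule limitin_nb_centres[OF uz lim]) (use uv in \<open>auto simp: U_def\<close>)
    have bw: "limitin X (\<lambda>j. b (\<epsilon> j)) w sequentially"
      by (rule limitin_nb_centres[OF vw lim]) (use uv in \<open>auto simp: V_def\<close>)
    show False
    proof (cases "\<forall>i. finite {j. fst (\<epsilon> j) = i}")
      case True
      then obtain t :: "nat \<Rightarrow> nat" where t: "strict_mono t" "strict_mono ((\<lambda>j. fst (\<epsilon> j)) \<circ> t)"
        using strict_mono_subseq_finite_fibres[of "\<lambda>j. fst (\<epsilon> j)"] by metis
      have "limitin X (\<lambda>j. s (fst (\<epsilon> (t j))) (snd (\<epsilon> (t j)))) z sequentially"
        using limitin_subsequence[OF t(1) az] by (simp add: o_def a_def)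
      then show False using fan[OF t(2)] by (simp add: o_def)
    next
      case False
      then obtain i where "infinite {j. fst (\<epsilon> j) = i}" by blast
      then obtain r :: "nat \<Rightarrow> nat" where r: "strict_mono r" "\<forall>j. fst (\<epsilon> (r j)) = i"
        by (rule infinite_fibre_subseq)
      define M where "M j = snd (\<epsilon> (r j))" for j
      have \<epsilon>r: "\<epsilon> (r j) = (i, M j)" for j using r(2) by (simp add: M_def prod_eq_iff)
      have "inj M"
      proof (rule injI)
        fix j k assume "M j = M k"
        then have "\<epsilon> (r j) = \<epsilon> (r k)" by (simp add: \<epsilon>r)
        then have "r j = r k" using \<epsilon> by (simp add: inj_eq)
        then show "j = k" using r(1) by (simp add: strict_mono_eq)
      qed
      then have "finite {j. M j = l}" for l
        using finite_vimageI[of "{l}" M] by (simp add: vimage_def)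
      then obtain t :: "nat \<Rightarrow> nat" where t: "strict_mono t" "strict_mono (M \<circ> t)"
        by (rule strict_mono_subseq_finite_fibres)
      have "limitin X (\<lambda>j. b (\<epsilon> (r (t j)))) w sequentially"
        using limitin_subsequence[OF t(1) limitin_subsequence[OF r(1) bw]] by (simp add: o_def)
      then have "limitin X (d i \<circ> (M \<circ> t)) w sequentially" by (simp add: b_def \<epsilon>r o_def)
      then show False using d[of i] t(2) unfolding no_convergent_subseq_def by blast
    qed
  next
    fix U' V' assume U': "openin X U'" "p \<in> U'" and V': "openin X V'" "q \<in> V'"
    obtain n where n: "infinite {m. d n m \<in> V'}" using dq[OF V'] by blast
    have "finite {m. d n m = p}"
      using limitin_subseq_const[OF p, of "d n"] d[of n] unfolding no_convergent_subseq_def by blast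
    moreover obtain N where N: "\<And>m. m \<ge> N \<Longrightarrow> s n m \<in> U'"
      using limitinD[OF s(1)[of n] U'] by (auto simp: eventually_sequentially)
    ultimately have "infinite ({m. d n m \<in> V'} - ({m. d n m = p} \<union> {..<N}))" using n by simp
    then have "{m. d n m \<in> V'} - ({m. d n m = p} \<union> {..<N}) \<noteq> {}" by (intro notI) simp
    then obtain m where "m \<in> {m. d n m \<in> V'} - ({m. d n m = p} \<union> {..<N})" by blast
    then have "d n m \<in> V'" "d n m \<noteq> p" "m \<ge> N" by auto
    then show "\<exists>e\<in>E. a e \<in> U' \<and> b e \<in> V'"
      using N by (intro bexI[of _ "(n, m)"]) (auto simp: E_def a_def b_def)
  qed
qed

text \<open>At a fixed height \<open>n\<close> the points \<open>s n\<close> are closed and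
  discrete: a convergent sequence of them has infinitely many terms in one member of the network,
  which meets only one sequence of the fan. They can therefore be swollen to a discrete family of
  open sets.\<close>

lemma fan_separation:
  assumes FU: "frechet_urysohn_space X" and net: "seq_network X P"
    and sX: "\<And>s m. s \<in> S \<Longrightarrow> s m \<in> topspace X"
    and fan: "\<And>s t Q m n. \<lbrakk>s \<in> S; t \<in> S; Q \<in> P; s m \<in> Q; t n \<in> Q\<rbrakk> \<Longrightarrow> s = t"
  obtains O' :: "(nat \<Rightarrow> 'a) \<Rightarrow> 'a set" where "\<forall>s\<in>S. openin X (O' s) \<and> s n \<in> O' s"
    "\<forall>\<sigma> u z. (\<forall>j. \<sigma> j \<in> S \<and> u j \<in> O' (\<sigma> j)) \<longrightarrow> limitin X u z sequentially \<longrightarrow>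
       (\<exists>s\<in>S. \<forall>\<^sub>F j::nat in sequentially. \<sigma> j = s)"
proof -
  have eq: "s = t" if st: "s \<in> S" "t \<in> S" "s n = t n" for s t
  proof -
    have "s n \<in> topspace X" using sX st by blast
    then have "limitin X (\<lambda>_::nat. s n) (s n) sequentially" "openin X (topspace X)" "s n \<in> topspace X"
      by simp_all
    then obtain Q where Q: "Q \<in> P" "infinite {j::nat. s n \<in> Q}"
      using net[unfolded seq_network_def, rule_format, of "\<lambda>_. s n" "s n" "topspace X"] by blast
    then have "s n \<in> Q" by (cases "s n \<in> Q") auto
    then show ?thesis using fan[OF st(1,2) Q(1)] st(3) by metis
  qed
  have cl: "closedin X ((\<lambda>s. s n) ` A)" if A: "A \<subseteq> S" for A
  proof (rule frechet_urysohn_closedin[OF FU])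
    show "(\<lambda>s. s n) ` A \<subseteq> topspace X" using A sX by blast
    fix \<sigma> :: "nat \<Rightarrow> 'a" and z assume \<sigma>: "\<And>j. \<sigma> j \<in> (\<lambda>s. s n) ` A" "limitin X \<sigma> z sequentially"
    have "\<forall>j. \<exists>s. s \<in> A \<and> \<sigma> j = s n" using \<sigma>(1) by blast
    then obtain t where t: "\<And>j. t j \<in> A" "\<And>j. \<sigma> j = t j n" by metis
    have zX: "z \<in> topspace X" using \<sigma>(2) by (rule limitin_topspace)
    obtain Q where Q: "Q \<in> P" "infinite {j. \<sigma> j \<in> Q}"
      using net[unfolded seq_network_def, rule_format, of \<sigma> z "topspace X"] \<sigma>(2) zX by blast
    have "{j. \<sigma> j \<in> Q} \<noteq> {}" using Q(2) by (intro notI) simp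
    then obtain j0 where j0: "\<sigma> j0 \<in> Q" by blast
    have "\<sigma> j = \<sigma> j0" if "\<sigma> j \<in> Q" for j
    proof -
      have "t j = t j0" using fan[of "t j" "t j0" Q n n] t that j0 Q(1) A by auto
      then show ?thesis by (simp add: t(2))
    qed
    then have "{j. \<sigma> j \<in> Q} \<subseteq> {j. \<sigma> j \<in> {\<sigma> j0}}" by blast
    then have "infinite {j. \<sigma> j \<in> {\<sigma> j0}}" using Q(2) infinite_super by blast
    then have "z \<in> X closure_of {\<sigma> j0}" by (rule limitin_frequently_in_closure[OF \<sigma>(2)])
    moreover have "\<sigma> j0 \<in> topspace X" using subsetD[OF A t(1)] sX t(2) by simp
    then have "X closure_of {\<sigma> j0} = {\<sigma> j0}"
      using t1 by (simp add: t1_space_closedin_singleton closure_of_eq)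
    ultimately show "z \<in> (\<lambda>s. s n) ` A" using \<sigma>(1)[of j0] by simp
  qed
  define D where "D = (\<lambda>s. s n) ` S"
  have cD: "closedin X D" unfolding D_def by (rule cl) simp
  define W where "W s = topspace X - (\<lambda>s. s n) ` (S - {s})" for s
  obtain V where V: "\<And>s. s \<in> S \<Longrightarrow> openin X (V s)" "\<And>s. s \<in> S \<Longrightarrow> {s n} \<subseteq> V s"
    "\<And>s. s \<in> S \<Longrightarrow> V s \<subseteq> W s" "disjoint_family_on V S"
  proof (rule disjoint_expansion[of S "\<lambda>s. {s n}" W])
    show "closedin X {s n}" if "s \<in> S" for s using t1 sX that by (simp add: t1_space_closedin_singleton)
    show "openin X (W s)" if "s \<in> S" for s unfolding W_def by (rule openin_diff[OF openin_topspace cl]) blast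
    show "{s n} \<subseteq> W s" if s: "s \<in> S" for s
    proof -
      have "s n \<notin> (\<lambda>s. s n) ` (S - {s})"
      proof
        assume "s n \<in> (\<lambda>s. s n) ` (S - {s})"
        then obtain t where "t \<in> S" "t \<noteq> s" "s n = t n" by auto
        then show False using eq[OF s] by blast
      qed
      then show ?thesis using sX[OF s] unfolding W_def by simp
    qed
    show "W s \<inter> {t n} = {}" if "s \<in> S" "t \<in> S" "s \<noteq> t" for s t
      using that unfolding W_def by blast
  qed blast
  have oV: "openin X (\<Union>s\<in>S. V s)" using V(1) by blast
  have "D \<subseteq> (\<Union>s\<in>S. V s)" using V(2) unfolding D_def by blast
  \<comment> \<open>Cutting down to \<open>W'\<close> turns the disjoint family into a discrete one:
    a limit of points in these sets lies in the closure of \<open>W'\<close>, hence in some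
    \<open>V s\<close>.\<close>
  then obtain W' where W': "openin X W'" "D \<subseteq> W'" "X closure_of W' \<subseteq> (\<Union>s\<in>S. V s)"
    using normal[unfolded normal_space_alt, rule_format, of D "\<Union>s\<in>S. V s"] cD oV by blast
  show thesis
  proof (rule that[of "\<lambda>s. V s \<inter> W'"])
    show "\<forall>s\<in>S. openin X (V s \<inter> W') \<and> s n \<in> V s \<inter> W'" using V(1,2) W'(1,2) by (auto simp: D_def)
    show "\<forall>\<sigma> u z. (\<forall>j. \<sigma> j \<in> S \<and> u j \<in> V (\<sigma> j) \<inter> W') \<longrightarrow> limitin X u z sequentially \<longrightarrow>
       (\<exists>s\<in>S. \<forall>\<^sub>F j::nat in sequentially. \<sigma> j = s)"
    proof (intro allI impI)
      fix \<sigma> and u :: "nat \<Rightarrow> 'a" and z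
      assume \<sigma>: "\<forall>j. \<sigma> j \<in> S \<and> u j \<in> V (\<sigma> j) \<inter> W'" and u: "limitin X u z sequentially"
      have "z \<in> X closure_of W'" by (rule limitin_in_closure[OF u]) (use \<sigma> in blast)
      then obtain s where s: "s \<in> S" "z \<in> V s" using W'(3) by blast
      have "\<forall>\<^sub>F j in sequentially. u j \<in> V s" using limitinD[OF u V(1)[OF s(1)] s(2)] .
      then have "\<forall>\<^sub>F j in sequentially. \<sigma> j = s"
      proof eventually_elim
        case (elim j)
        then show ?case using \<sigma> V(4) s(1) unfolding disjoint_family_on_def by blast
      qed
      then show "\<exists>s\<in>S. \<forall>\<^sub>F j in sequentially. \<sigma> j = s" using s(1) by blast
    qed
  qed
qed

text \<open>For an uncountable fan the pairs are \<open>(s, t)\<close> with \<open>s \<noteq> t\<close>, taken at a height that is the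
  inverse distance of two reals labelling \<open>s\<close> and \<open>t\<close>.\<close>

lemma uncountable_fan_not_k_R:
  assumes FU: "frechet_urysohn_space X" and net: "seq_network X P" and q: "q \<in> topspace X"
    and S0: "uncountable S0" "\<And>s. s \<in> S0 \<Longrightarrow> limitin X s q sequentially"
      "\<And>s m. s \<in> S0 \<Longrightarrow> s m \<in> topspace X - {q}"
      "\<And>s t Q m n. \<lbrakk>s \<in> S0; t \<in> S0; Q \<in> P; s m \<in> Q; t n \<in> Q\<rbrakk> \<Longrightarrow> s = t"
  shows "\<not> k_R_space (free_abelian_level T 2)"
proof -
  obtain S and x :: "(nat \<Rightarrow> 'a) \<Rightarrow> real" where SS: "S \<subseteq> S0" and uS: "uncountable S" and x: "inj_on x S"
    using S0(1) by (rule uncountable_real_embedding)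
  have lim: "limitin X s q sequentially" if "s \<in> S" for s using S0(2) SS that by blast
  have sX: "s m \<in> topspace X - {q}" if "s \<in> S" for s m using S0(3) SS that by blast
  have sX': "s m \<in> topspace X" if "s \<in> S" for s m using sX[OF that] by blast
  have fan: "s = t" if "s \<in> S" "t \<in> S" "Q \<in> P" "s m \<in> Q" "t n \<in> Q" for s t Q m n
    using S0(4)[of s t Q m n] SS that by blast
  have "\<exists>O'. (\<forall>s\<in>S. openin X (O' s) \<and> s n \<in> O' s) \<and>
    (\<forall>\<sigma> u z. (\<forall>j. \<sigma> j \<in> S \<and> u j \<in> O' (\<sigma> j)) \<longrightarrow> limitin X u z sequentially \<longrightarrow>
       (\<exists>s\<in>S. \<forall>\<^sub>F j::nat in sequentially. \<sigma> j = s))" for n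
    by (rule fan_separation[where P = P and S = S and n = n])
      (rule FU, rule net, erule sX', erule (4) fan, blast)
  then obtain O' where O': "\<And>n s. s \<in> S \<Longrightarrow> openin X (O' n s)" "\<And>n s. s \<in> S \<Longrightarrow> s n \<in> O' n s"
    and sep: "\<And>n \<sigma> u z. (\<forall>j. \<sigma> j \<in> S \<and> u j \<in> O' n (\<sigma> j)) \<Longrightarrow> limitin X u z sequentially \<Longrightarrow>
       \<exists>s\<in>S. \<forall>\<^sub>F j::nat in sequentially. \<sigma> j = s" by metis
  have cq: "closedin X {q}" using t1 q by (simp add: t1_space_closedin_singleton)
  \<comment> \<open>\<open>nb n (s n)\<close> handles heights that tend to infinity, where the
    network forces a single fan member; \<open>O' n s\<close> handles a height that is repeated
    infinitely often. In both cases a convergent choice follows one fan member along a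
    subsequence.\<close>
  define N where "N n s = (nb n (s n) \<inter> O' n s) - {q}" for n :: nat and s
  have N: "openin X (N n s) \<and> s n \<in> N n s \<and> q \<notin> N n s" if "s \<in> S" for n s
    using O'[OF that] sX[OF that, of n] nb_self cq
    by (auto simp: N_def intro!: openin_diff openin_Int)
  have conv: "\<exists>r s. strict_mono (r :: nat \<Rightarrow> nat) \<and> (\<forall>j. \<sigma> (r j) = s)"
    if \<sigma>: "\<And>j. \<sigma> j \<in> S" and u: "\<And>j. u j \<in> N (h j) (\<sigma> j)" "limitin X u z sequentially" for \<sigma> u z and h :: "nat \<Rightarrow> nat"
  proof (cases "\<forall>i. finite {j. h j = i}")
    case True
    then obtain t :: "nat \<Rightarrow> nat" where t: "strict_mono t" "strict_mono (h \<circ> t)"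
      using strict_mono_subseq_finite_fibres[of h] by metis
    have lim: "limitin X (\<lambda>j. \<sigma> (t j) (h (t j))) z sequentially"
    proof (rule limitin_nb_centres[OF limitin_subsequence[OF t(1) u(2)]])
      show "filterlim (h \<circ> t) at_top sequentially" using filterlim_subseq[OF t(2)] .
      show "(u \<circ> t) j \<in> nb ((h \<circ> t) j) (\<sigma> (t j) (h (t j)))" for j
        using u(1)[of "t j"] by (simp add: N_def)
    qed
    have zX: "z \<in> topspace X" using u(2) by (rule limitin_topspace)
    obtain Q where Q: "Q \<in> P" "infinite {j. \<sigma> (t j) (h (t j)) \<in> Q}"
      using net[unfolded seq_network_def, rule_format, of "\<lambda>j. \<sigma> (t j) (h (t j))" z "topspace X"] lim zX by blast
    obtain r :: "nat \<Rightarrow> nat" where r: "strict_mono r" "\<forall>j. \<sigma> (t (r j)) (h (t (r j))) \<in> Q"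
      using Q(2) by (rule infinite_fibre_subseq)
    have "\<sigma> (t (r j)) = \<sigma> (t (r 0))" for j
      using fan[OF \<sigma> \<sigma> Q(1)] r(2) by blast
    then show ?thesis
      using strict_mono_o[OF t(1) r(1)] by (intro exI[of _ "t \<circ> r"] exI[of _ "\<sigma> (t (r 0))"]) simp
  next
    case False
    then obtain n where "infinite {j. h j = n}" by blast
    then obtain r :: "nat \<Rightarrow> nat" where r: "strict_mono r" "\<forall>j. h (r j) = n" by (rule infinite_fibre_subseq)
    have "\<forall>j. (\<sigma> \<circ> r) j \<in> S \<and> (u \<circ> r) j \<in> O' n ((\<sigma> \<circ> r) j)"
    proof
      fix j show "(\<sigma> \<circ> r) j \<in> S \<and> (u \<circ> r) j \<in> O' n ((\<sigma> \<circ> r) j)"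
        using \<sigma>[of "r j"] u(1)[of "r j"] r(2) by (simp add: N_def)
    qed
    then obtain s where "\<forall>\<^sub>F j in sequentially. (\<sigma> \<circ> r) j = s"
      using sep limitin_subsequence[OF r(1) u(2)] by blast
    then obtain M where "\<And>j. j \<ge> M \<Longrightarrow> \<sigma> (r j) = s" by (auto simp: eventually_sequentially)
    moreover have "strict_mono (\<lambda>j. r (j + M))" using r(1) by (simp add: strict_mono_def)
    ultimately show ?thesis by (intro exI[of _ "\<lambda>j. r (j + M)"] exI[of _ s]) simp
  qed
  define E where "E = {(s, t). s \<in> S \<and> t \<in> S \<and> s \<noteq> t}"
  \<comment> \<open>The labels of \<open>s\<close> and \<open>t\<close> differ for pairs in
    \<open>E\<close>. Rounding up makes pairs with labels at distance at most \<open>1/n\<close>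
    have height at least \<open>n\<close>.\<close>
  define f where "f e = nat \<lceil>1 / \<bar>x (fst e) - x (snd e)\<bar>\<rceil>" for e
  show ?thesis
  proof (rule not_k_R_level_2[OF FU q q, of E "\<lambda>e. N (f e) (fst e)" "\<lambda>e. fst e (f e)" "\<lambda>e. N (f e) (snd e)" "\<lambda>e. snd e (f e)"])
    show "openin X (N (f e) (fst e)) \<and> fst e (f e) \<in> N (f e) (fst e) \<and> q \<notin> N (f e) (fst e)" if "e \<in> E" for e
      by (rule N) (use that in \<open>auto simp: E_def\<close>)
    show "openin X (N (f e) (snd e)) \<and> snd e (f e) \<in> N (f e) (snd e) \<and> q \<notin> N (f e) (snd e)" if "e \<in> E" for e
      by (rule N) (use that in \<open>auto simp: E_def\<close>)
  next
    fix \<epsilon> :: "nat \<Rightarrow> (nat \<Rightarrow> 'a) \<times> (nat \<Rightarrow> 'a)" and u v z w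
    assume \<epsilon>: "inj \<epsilon>"
      and uv: "\<And>j. \<epsilon> j \<in> E \<and> u j \<in> N (f (\<epsilon> j)) (fst (\<epsilon> j)) \<and> v j \<in> N (f (\<epsilon> j)) (snd (\<epsilon> j))"
      and uz: "limitin X u z sequentially" and vw: "limitin X v w sequentially"
    have S: "fst (\<epsilon> j) \<in> S" "snd (\<epsilon> j) \<in> S" for j using uv[of j] by (auto simp: E_def)
    obtain r s where r: "strict_mono (r :: nat \<Rightarrow> nat)" "\<And>j. fst (\<epsilon> (r j)) = s"
      using conv[of "\<lambda>j. fst (\<epsilon> j)" u "\<lambda>j. f (\<epsilon> j)" z] S(1) uv uz by blast
    obtain r' t where r': "strict_mono (r' :: nat \<Rightarrow> nat)" "\<And>j. snd (\<epsilon> (r (r' j))) = t"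
      using conv[of "\<lambda>j. snd (\<epsilon> (r j))" "v \<circ> r" "\<lambda>j. f (\<epsilon> (r j))" w] S(2) uv limitin_subsequence[OF r(1) vw]
      by auto
    \<comment> \<open>Both coordinates have become constant on a common subsequence, against
      injectivity.\<close>
    have "\<epsilon> (r (r' 0)) = \<epsilon> (r (r' 1))" by (simp add: prod_eq_iff r(2) r'(2))
    then have "r (r' 0) = r (r' 1)" using \<epsilon> by (simp add: inj_eq)
    then show False using r(1) r'(1) by (simp add: strict_mono_eq)
  next
    fix U' V' assume U': "openin X U'" "q \<in> U'" and V': "openin X V'" "q \<in> V'"
    have "\<forall>s\<in>S. \<exists>n. \<forall>m\<ge>n. s m \<in> U' \<inter> V'"
    proof
      fix s assume "s \<in> S"
      then have "\<forall>\<^sub>F m in sequentially. s m \<in> U' \<inter> V'"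
        using limitinD[OF lim, of s "U' \<inter> V'"] U' V' by auto
      then show "\<exists>n. \<forall>m\<ge>n. s m \<in> U' \<inter> V'" by (simp add: eventually_sequentially)
    qed
    then obtain g where g: "\<And>s m. s \<in> S \<Longrightarrow> m \<ge> g s \<Longrightarrow> s m \<in> U' \<inter> V'" by metis
    \<comment> \<open>Uncountably many fan members share a threshold \<open>n\<close> beyond which
      they stay in \<open>U' \<inter> V'\<close>. Two of them have labels at distance at most
      \<open>1/n\<close>, so the height of this pair exceeds or equals both thresholds.\<close>
    have "\<exists>n. uncountable {s \<in> S. g s = n}"
    proof (rule ccontr)
      assume "\<not> ?thesis"
      then have "countable (\<Union>n. {s \<in> S. g s = n})" by (intro countable_UN) auto
      moreover have "(\<Union>n. {s \<in> S. g s = n}) = S" by blast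
      ultimately show False using uS by metis
    qed
    then obtain n where n: "uncountable {s \<in> S. g s = n}" ..
    have "inj_on x {s \<in> S. g s = n}" using x by (rule inj_on_subset) blast
    then have "uncountable (x ` {s \<in> S. g s = n})" using n countable_image_inj_on[of x "{s \<in> S. g s = n}"] by argo
    then obtain a b where ab: "a \<in> x ` {s \<in> S. g s = n}" "b \<in> x ` {s \<in> S. g s = n}" "a \<noteq> b" "real n * \<bar>a - b\<bar> \<le> 1"
      by (rule uncountable_reals_close[where n = n])
    then obtain s t where st: "s \<in> S" "g s = n" "t \<in> S" "g t = n" "a = x s" "b = x t" by blast
    have "real n \<le> 1 / \<bar>x s - x t\<bar>" using ab(3,4) st(5,6) by (simp add: le_divide_eq)
    then have "n \<le> f (s, t)" unfolding f_def by (simp add: le_nat_iff) linarith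
    then have "s (f (s, t)) \<in> U'" "t (f (s, t)) \<in> V'" using g[OF st(1)] g[OF st(3)] st by auto
    moreover have "(s, t) \<in> E" using st ab(3) by (auto simp: E_def)
    ultimately show "\<exists>e\<in>E. fst e (f e) \<in> U' \<and> snd e (f e) \<in> V'" by (intro bexI[of _ "(s, t)"]) auto
  qed
qed

end

theorem theorem4p2:
  fixes X :: "'a topology" and T :: "('a \<Rightarrow>\<^sub>0 int) topology"
  assumes "tychonoff_space X" and "topspace X \<noteq> {}"
    and "stratifiable_space X"
    and "frechet_urysohn_space X"
    and "\<exists>\<P>. k_network X \<P> \<and> point_countable X \<P>"
    and "free_abelian_topology X T"
  shows "(k_space (free_abelian_level T 2) \<longleftrightarrow> k_R_space (free_abelian_level T 2)) \<and>
         (k_R_space (free_abelian_level T 2) \<longleftrightarrow> metrizable_space X \<or> locally_k_omega_space X)"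
proof -
  have H: "Hausdorff_space X" using assms(1) by (simp add: tychonoff_space_def)
  then have t1: "t1_space X" by (rule Hausdorff_imp_t1_space)
  obtain G where G: "stratified X G" using stratifiable_imp_stratified[OF assms(3) t1] .
  interpret free_stratified X G T
    using G assms(6) by (intro free_stratified.intro free_stratified_axioms.intro)
  note FU = assms(4)
  obtain P where P: "k_network X P" "point_countable X P" using assms(5) by blast
  have PX: "\<Union>P \<subseteq> topspace X" using P(1) by (auto simp: k_network_def)
  have net: "seq_network X P" using P(1) by (rule k_network_imp_seq_network)
  have "tychonoff_space (free_abelian_level T 2)"
    using tychonoff_T unfolding tychonoff_space_def free_abelian_level_def
    by (simp add: completely_regular_space_subtopology Hausdorff_space_subtopology)
  then have 12: "k_R_space (free_abelian_level T 2)" if "k_space (free_abelian_level T 2)"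
    unfolding k_R_space_def using continuous_map_from_k_space[OF that] by blast
  have 23: "metrizable_space X \<or> locally_k_omega_space X" if kR: "k_R_space (free_abelian_level T 2)"
  proof (rule ccontr)
    assume "\<not> ?thesis"
    then have nm: "\<not> metrizable_space X" and nk: "\<not> locally_k_omega_space X" by auto
    have good: "\<not> bad_point X q" for q
    proof
      assume bad: "bad_point X q"
      show False
      proof (rule metrizable_or_countable_fan[OF FU P(2) PX net nm])
        fix p and s :: "nat \<Rightarrow> nat \<Rightarrow> 'a"
        assume s: "p \<in> topspace X" "\<And>n. limitin X (s n) p sequentially" "\<And>n m. s n m \<in> topspace X - {p}"
          "\<And>i m z. strict_mono i \<Longrightarrow> \<not> limitin X (\<lambda>j::nat. s (i j) (m j)) z sequentially"
        show False using countable_fan_bad_point[OF FU s bad] kR by simp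
      qed
    qed
    define P' where "P' = {Q \<in> P. seq_precompact X Q}"
    have net': "seq_network X P'" unfolding P'_def by (rule seq_network_precompact[OF good P(2) PX net])
    have pc': "point_countable X P'" unfolding point_countable_def
    proof
      fix x assume "x \<in> topspace X"
      then have "countable {Q \<in> P. x \<in> Q}" using P(2) by (auto simp: point_countable_def)
      then show "countable {Q \<in> P'. x \<in> Q}" by (rule countable_subset[rotated]) (auto simp: P'_def)
    qed
    have PX': "\<Union>P' \<subseteq> topspace X" using PX by (auto simp: P'_def)
    have pre: "seq_precompact X Q" if "Q \<in> P'" for Q using that by (simp add: P'_def)
    show False
    proof (rule locally_k_omega_or_uncountable_fan[OF FU pc' PX' net' pre nk])
      fix q and S :: "(nat \<Rightarrow> 'a) set"
      assume S: "q \<in> topspace X" "uncountable S"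
        "\<And>s. s \<in> S \<Longrightarrow> limitin X s q sequentially" "\<And>s m. s \<in> S \<Longrightarrow> s m \<in> topspace X - {q}"
        "\<And>s t Q m n. \<lbrakk>s \<in> S; t \<in> S; Q \<in> P'; s m \<in> Q; t n \<in> Q\<rbrakk> \<Longrightarrow> s = t"
      have "\<not> k_R_space (free_abelian_level T 2)"
        by (rule uncountable_fan_not_k_R[of P' q S])
          (rule FU, rule net', rule S(1), rule S(2), erule S(3), erule S(4), erule (4) S(5))
      then show False using kR by simp
    qed
  qed
  have 31: "k_space (free_abelian_level T 2)" if "metrizable_space X \<or> locally_k_omega_space X"
    using that metrizable_square locally_k_omega_square[OF H] by (intro k_space_level_2) blast
  show ?thesis using 12 23 31 by blast
qed

end
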